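(* Let $n\ge2$, let $\Omega\subset\mathbb R^n$ be a bounded domain with $\partial\Omega\in C^{1,1}$, and let $U\in L^{p,1}(\Omega)^n$ with $p>n$, $\mathrm{div}(U)=0$ in $\mathcal D'(\Omega)$ and $U\cdot\nu=0$ on $\partial\Omega$. Let $V$ be a potential on $\Omega$ whose set $K_V$ of irregular points is compact, and assume that $\mathrm{Cap}_{V,\infty}(K_V)=0$. Let $a\in\Omega$. If $a\in K_V$, then there is no $u\in L^1(V)\cap L^1_0(\Omega)$ such that $$\int_\Omega u[-\Delta\varphi-U\cdot\nabla\varphi+V\varphi]\,dx=\varphi(a)\qquad\forall\,\varphi\in C^2_0(\overline\Omega)$$ (i.e. no solution of the problem whose right-hand side is the Dirac measure at $a$).
   Context: A potential on $\Omega$ is a measurable function $V:\Omega\to[0,+\infty]$ that is not identically zero (a.e.). For $\psi\in C^2_c(\Omega)$, $$\|\psi\|_{V,\infty}=\|\psi\|_{L^1(\Omega)}+\Big\|\frac{\nabla\psi}{\sqrt V}\Big\|_{L^\infty(\Omega)}+\Big\|\frac{\Delta\psi}{V}\Big\|_{L^\infty(\Omega)}\in[0,+\infty],$$ where a quotient is taken to be $0$ where its numerator vanishes or where $V=+\infty$, and to be $+\infty$ in absolute value where $V=0$ and the numerator is nonzero. For a compact $K\subset\Omega$, $$\mathbb B^2_K=\{\psi\in C^2_c(\Omega):\ 0\le\psi\le1,\ \psi=1\text{ in a neighborhood of }K\},\qquad \mathrm{Cap}_{V,\infty}(K)=\inf\{\|\psi\|_{V,\infty}:\ \psi\in\mathbb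 B^2_K\}.$$ Irregular points: $\Omega_V=\{x\in\Omega:\ \exists\,r_x>0,\ B(x;r_x)\subset\Omega,\ \|V\|_{L^{\frac n2,1}(B(x;r_x))}<+\infty\}$, an open set, and $K_V=\Omega\setminus\Omega_V$; the points of $K_V$ are called the irregular points of $V$. $C^2_0(\overline\Omega)=\{\varphi\in C^2(\overline\Omega):\ \varphi=0\text{ on }\partial\Omega\}$; with $\delta(x)=\mathrm{dist}(x;\partial\Omega)$, $L^1(V)=\{g\text{ measurable on }\Omega:\ \int_\Omega|g|V\,dx<+\infty\}$ and $L^1_0(\Omega)=\{g\in L^1(\Omega):\ \lim_{\varepsilon\to0}\frac1\varepsilon\int_{\{\delta\le\varepsilon\}}|g|\,dx=0\}$. For a function $u$ to satisfy the equation it is understood that the integrals make sense, i.e. $u|U|\in L^1(\Omega)$. The conditions $\mathrm{div}(U)=0$ and $U\cdot\nu=0$ on $\partial\Omega$ ($\nu$ the exterior normal) are understood in the weak sense: $\int_\Omega U\cdot\nabla\varphi\,dx=0$ for all $\varphi\in C^1(\overline\Omega)$. Lorentz spaces: with $|u|_*(s)=\inf\{t:\ |\{|u|>t\}|\le s\}$ and $|u|_{**}(t)=\frac1t\int_0^t|u|_*(\sigma)\,d\sigma$, for $1\le p<+\infty$, $L^{p,1}(\Omega)$ is the set of measurable $u$ with $\frac1{|\Omega|}\int_0^{|\Omega|}t^{1/p}|u|_{**}(t)\frac{dt}t<+\infty$ (similarly on balls). *)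

theory Defs
  imports "HOL-Analysis.Analysis" "HOL-Probability.Essential_Supremum"
begin

section \<open>Classical derivatives and spaces of differentiable functions\<close>

definition partial_deriv :: "'n::finite \<Rightarrow> (real ^ 'n \<Rightarrow> real) \<Rightarrow> real ^ 'n \<Rightarrow> real" where
  "partial_deriv i f x = frechet_derivative f (at x) (axis i 1)"

definition gradient :: "(real ^ 'n::finite \<Rightarrow> real) \<Rightarrow> real ^ 'n \<Rightarrow> real ^ 'n" where
  "gradient f x = (\<chi> i. partial_deriv i f x)"

definition laplacian :: "(real ^ 'n::finite \<Rightarrow> real) \<Rightarrow> real ^ 'n \<Rightarrow> real" where
  "laplacian f x = (\<Sum>i\<in>UNIV. partial_deriv i (partial_deriv i f) x)"

text \<open>The sets \<open>\<Omega>\<close> below are meant to be open; functions on \<open>\<Omega>\<close> are total functions whose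
  values outside \<open>\<Omega>\<close> (or outside its closure) play no role unless mentioned.\<close>

definition C1 :: "(real ^ 'n::finite) set \<Rightarrow> (real ^ 'n \<Rightarrow> real) set" where
  "C1 \<Omega> = {f. (\<forall>x\<in>\<Omega>. f differentiable (at x)) \<and> (\<forall>i. continuous_on \<Omega> (partial_deriv i f))}"

definition C2 :: "(real ^ 'n::finite) set \<Rightarrow> (real ^ 'n \<Rightarrow> real) set" where
  "C2 \<Omega> = {f \<in> C1 \<Omega>. \<forall>i. partial_deriv i f \<in> C1 \<Omega>}"

definition extends_continuously :: "(real ^ 'n::finite) set \<Rightarrow> (real ^ 'n \<Rightarrow> real) \<Rightarrow> bool" where
  "extends_continuously \<Omega> g \<longleftrightarrow> (\<exists>h. continuous_on (closure \<Omega>) h \<and> (\<forall>x\<in>\<Omega>. h x = g x))"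

text \<open>A function is \<open>C\<^sup>k\<close> up to the boundary if it is \<open>C\<^sup>k\<close> in \<open>\<Omega>\<close> and all its derivatives of
  order at most \<open>k\<close> extend continuously to the closure of \<open>\<Omega>\<close>; the function itself is taken to
  have its continuous boundary values.\<close>

definition C1_closure :: "(real ^ 'n::finite) set \<Rightarrow> (real ^ 'n \<Rightarrow> real) set" where
  "C1_closure \<Omega> = {f \<in> C1 \<Omega>. continuous_on (closure \<Omega>) f \<and>
     (\<forall>i. extends_continuously \<Omega> (partial_deriv i f))}"

definition C2_closure :: "(real ^ 'n::finite) set \<Rightarrow> (real ^ 'n \<Rightarrow> real) set" where
  "C2_closure \<Omega> = {f \<in> C2 \<Omega>. f \<in> C1_closure \<Omega> \<and>
     (\<forall>i j. extends_continuously \<Omega> (partial_deriv i (partial_deriv j f)))}"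

definition C2_0 :: "(real ^ 'n::finite) set \<Rightarrow> (real ^ 'n \<Rightarrow> real) set" where
  "C2_0 \<Omega> = {f \<in> C2_closure \<Omega>. \<forall>x\<in>frontier \<Omega>. f x = 0}"

text \<open>Compactly supported functions on \<open>\<Omega>\<close> are identified with their extension by zero.\<close>

definition C2_c :: "(real ^ 'n::finite) set \<Rightarrow> (real ^ 'n \<Rightarrow> real) set" where
  "C2_c \<Omega> = {f \<in> C2 \<Omega>. compact (closure {x. f x \<noteq> 0}) \<and> closure {x. f x \<noteq> 0} \<subseteq> \<Omega>}"


section \<open>Domains with \<open>C\<^sup>1\<^sup>,\<^sup>1\<close> boundary\<close>

definition C11_function :: "(real ^ 'n::finite \<Rightarrow> real) \<Rightarrow> bool" where
  "C11_function g \<longleftrightarrow> (\<exists>G L. (\<forall>x. (g has_derivative (\<lambda>h. G x \<bullet> h)) (at x)) \<and>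
     L-lipschitz_on UNIV (G :: real ^ 'n \<Rightarrow> real ^ 'n))"

text \<open>Locally, after a rotation sending the unit vector \<open>e\<close> to the last coordinate direction, \<open>\<Omega>\<close>
  is the region above the graph of a \<open>C\<^sup>1\<^sup>,\<^sup>1\<close> function of the other \<open>n - 1\<close> coordinates. A
  function on the hyperplane orthogonal to \<open>e\<close> is encoded by a function on the whole space (compose
  with the orthogonal projection), used only at points of that hyperplane.\<close>

definition C11_boundary :: "(real ^ 'n::finite) set \<Rightarrow> bool" where
  "C11_boundary \<Omega> \<longleftrightarrow> (\<forall>z\<in>frontier \<Omega>. \<exists>r>0. \<exists>e g. norm e = 1 \<and> C11_function g \<and>
     \<Omega> \<inter> ball z r = {x \<in> ball z r. x \<bullet> e > g (x - (x \<bullet> e) *\<^sub>R e)})"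


section \<open>Lorentz spaces\<close>

definition rearrangement :: "(real ^ 'n::finite) set \<Rightarrow> (real ^ 'n \<Rightarrow> ennreal) \<Rightarrow> real \<Rightarrow> ennreal" where
  "rearrangement S f s = Inf {t. emeasure (lebesgue_on S) {x \<in> S. t < f x} \<le> ennreal s}"

definition avg_rearrangement :: "(real ^ 'n::finite) set \<Rightarrow> (real ^ 'n \<Rightarrow> ennreal) \<Rightarrow> real \<Rightarrow> ennreal" where
  "avg_rearrangement S f t = ennreal (1 / t) * (\<integral>\<^sup>+\<sigma>\<in>{0<..<t}. rearrangement S f \<sigma> \<partial>lborel)"

text \<open>The \<open>L\<^sup>p\<^sup>,\<^sup>1\<close> (quasi)norm of a nonnegative measurable function on a set \<open>S\<close> of
  finite positive measure.\<close>

definition lorentz_norm :: "real \<Rightarrow> (real ^ 'n::finite) set \<Rightarrow> (real ^ 'n \<Rightarrow> ennreal) \<Rightarrow> ennreal" where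
  "lorentz_norm p S f = ennreal (1 / measure lebesgue S) *
     (\<integral>\<^sup>+t\<in>{0<..<measure lebesgue S}.
        ennreal (t powr (1 / p)) * avg_rearrangement S f t * ennreal (1 / t) \<partial>lborel)"

definition lorentz_space :: "real \<Rightarrow> (real ^ 'n::finite) set \<Rightarrow> (real ^ 'n \<Rightarrow> real) set" where
  "lorentz_space p S = {f \<in> borel_measurable (lebesgue_on S). lorentz_norm p S (\<lambda>x. ennreal \<bar>f x\<bar>) < \<infinity>}"


section \<open>Potentials, capacity and irregular points\<close>

definition potential :: "(real ^ 'n::finite) set \<Rightarrow> (real ^ 'n \<Rightarrow> ennreal) \<Rightarrow> bool" where
  "potential \<Omega> V \<longleftrightarrow> V \<in> borel_measurable (lebesgue_on \<Omega>) \<and> \<not> (AE x in lebesgue_on \<Omega>. V x = 0)"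

definition ennreal_sqrt :: "ennreal \<Rightarrow> ennreal" where
  "ennreal_sqrt v = (if v = \<infinity> then \<infinity> else ennreal (sqrt (enn2real v)))"

text \<open>Division in \<^typ>\<open>ennreal\<close> follows exactly the conventions wanted for the quotients:
  \<open>0 / v = 0\<close>, \<open>ennreal c / \<infinity> = 0\<close>, and \<open>c / 0 = \<infinity>\<close> for \<open>c \<noteq> 0\<close>.\<close>

definition V_inf_norm :: "(real ^ 'n::finite) set \<Rightarrow> (real ^ 'n \<Rightarrow> ennreal) \<Rightarrow> (real ^ 'n \<Rightarrow> real) \<Rightarrow> ennreal" where
  "V_inf_norm \<Omega> V \<psi> =
     (\<integral>\<^sup>+x. ennreal \<bar>\<psi> x\<bar> \<partial>lebesgue_on \<Omega>)
     + esssup (lebesgue_on \<Omega>) (\<lambda>x. ennreal (norm (gradient \<psi> x)) / ennreal_sqrt (V x))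
     + esssup (lebesgue_on \<Omega>) (\<lambda>x. ennreal \<bar>laplacian \<psi> x\<bar> / V x)"

definition B2 :: "(real ^ 'n::finite) set \<Rightarrow> (real ^ 'n) set \<Rightarrow> (real ^ 'n \<Rightarrow> real) set" where
  "B2 \<Omega> K = {\<psi> \<in> C2_c \<Omega>. (\<forall>x. 0 \<le> \<psi> x \<and> \<psi> x \<le> 1) \<and>
     (\<exists>N. open N \<and> K \<subseteq> N \<and> (\<forall>x\<in>N. \<psi> x = 1))}"

definition Cap :: "(real ^ 'n::finite) set \<Rightarrow> (real ^ 'n \<Rightarrow> ennreal) \<Rightarrow> (real ^ 'n) set \<Rightarrow> ennreal" where
  "Cap \<Omega> V K = (INF \<psi>\<in>B2 \<Omega> K. V_inf_norm \<Omega> V \<psi>)"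

definition regular_points :: "(real ^ 'n::finite) set \<Rightarrow> (real ^ 'n \<Rightarrow> ennreal) \<Rightarrow> (real ^ 'n) set" where
  "regular_points \<Omega> V = {x \<in> \<Omega>. \<exists>r>0. ball x r \<subseteq> \<Omega> \<and> lorentz_norm (real CARD('n) / 2) (ball x r) V < \<infinity>}"

definition irregular_points :: "(real ^ 'n::finite) set \<Rightarrow> (real ^ 'n \<Rightarrow> ennreal) \<Rightarrow> (real ^ 'n) set" where
  "irregular_points \<Omega> V = \<Omega> - regular_points \<Omega> V"


section \<open>The equation\<close>

definition div_free_tangential :: "(real ^ 'n::finite) set \<Rightarrow> (real ^ 'n \<Rightarrow> real ^ 'n) \<Rightarrow> bool" where
  "div_free_tangential \<Omega> U \<longleftrightarrow> (\<forall>\<phi>\<in>C1_closure \<Omega>. (LINT x|lebesgue_on \<Omega>. U x \<bullet> gradient \<phi> x) = 0)"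

definition L1_weighted :: "(real ^ 'n::finite) set \<Rightarrow> (real ^ 'n \<Rightarrow> ennreal) \<Rightarrow> (real ^ 'n \<Rightarrow> real) set" where
  "L1_weighted \<Omega> V = {g \<in> borel_measurable (lebesgue_on \<Omega>).
     (\<integral>\<^sup>+x. ennreal \<bar>g x\<bar> * V x \<partial>lebesgue_on \<Omega>) < \<infinity>}"

definition L1_0 :: "(real ^ 'n::finite) set \<Rightarrow> (real ^ 'n \<Rightarrow> real) set" where
  "L1_0 \<Omega> = {g. integrable (lebesgue_on \<Omega>) g \<and>
     ((\<lambda>\<epsilon>. (1 / \<epsilon>) * (LINT x|lebesgue_on {x \<in> \<Omega>. infdist x (frontier \<Omega>) \<le> \<epsilon>}. \<bar>g x\<bar>)) \<longlongrightarrow> 0) (at_right 0)}"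

text \<open>The integrals make sense when \<open>u \<in> L\<^sup>1(V) \<inter> L\<^sup>1\<close> and \<open>u \<bar>U\<bar> \<in> L\<^sup>1\<close>. Then \<open>u = 0\<close>
  almost everywhere on \<open>{V = \<infinity>}\<close>, so the value \<open>enn2real \<infinity> = 0\<close> implements the usual convention
  \<open>0 * \<infinity> = 0\<close> for the product \<open>u V\<close>.\<close>

definition solves_dirac ::
  "(real ^ 'n::finite) set \<Rightarrow> (real ^ 'n \<Rightarrow> real ^ 'n) \<Rightarrow> (real ^ 'n \<Rightarrow> ennreal) \<Rightarrow> real ^ 'n \<Rightarrow> (real ^ 'n \<Rightarrow> real) \<Rightarrow> bool" where
  "solves_dirac \<Omega> U V a u \<longleftrightarrow>
     integrable (lebesgue_on \<Omega>) (\<lambda>x. u x * norm (U x)) \<and>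
     (\<forall>\<phi>\<in>C2_0 \<Omega>.
        (LINT x|lebesgue_on \<Omega>.
           u x * (- laplacian \<phi> x - U x \<bullet> gradient \<phi> x + enn2real (V x) * \<phi> x)) = \<phi> a)"

end

theory Submission
  imports Defs
begin

text \<open>
  Let \<open>u\<close> be a solution with source at an irregular point \<open>a\<close>.  A cutoff \<open>\<psi>\<close> that is admissible for
  the capacity equals \<open>1\<close> near \<open>a\<close>, so the product of \<open>\<psi>\<close> with a fixed bump around \<open>a\<close> is a test
  function with value \<open>1\<close> at \<open>a\<close>.  If the norm of \<open>\<psi>\<close> is at most \<open>\<epsilon>\<close>, then
  \<open>\<bar>\<Delta>\<psi>\<bar> \<le> \<epsilon> V\<close> and \<open>\<bar>\<nabla>\<psi>\<bar> \<le> \<epsilon> sqrt V\<close> almost everywhere on the set where \<open>V\<close> is finite, outside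
  of which \<open>u\<close> vanishes almost everywhere, and the integral of \<open>\<psi>\<close> is at most \<open>\<epsilon>\<close>.  In the equation the terms
  that contain \<open>\<psi>\<close> itself are small because \<open>\<bar>u\<bar> (1 + \<bar>U\<bar> + V)\<close> is integrable and \<open>0 \<le> \<psi> \<le> 1\<close>, and
  \<open>u \<Delta>\<psi>\<close> is dominated by \<open>\<epsilon> \<bar>u\<bar> V\<close>.  The drift term is dominated by
  \<open>\<epsilon> \<bar>u\<bar> \<bar>U\<bar> sqrt V \<le> \<epsilon> \<bar>u\<bar> (\<bar>U\<bar>\<^sup>2 + V)\<close>.  So the equation yields \<open>1 \<le> o(1)\<close>, a contradiction, as soon
  as \<open>\<bar>u\<bar> \<bar>U\<bar>\<^sup>2\<close> is integrable near \<open>a\<close> (lemmas \<open>cutoff_test_estimate\<close> and \<open>no_solution\<close>).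

  This integrability is a regularity property of \<open>u\<close>, obtained from potential estimates.  The bump
  times a regularised Newton potential with pole \<open>y\<close> is a test function; its Laplacian is, up to lower
  order terms and a constant factor, an approximate identity at \<open>y\<close>.  When the regularisation is removed, the equation
  yields, for almost every \<open>y\<close> near \<open>a\<close>,
  \<open>\<bar>u y\<bar> \<le> C (\<integral> \<bar>x - y\<bar>\<^sup>-\<^sup>b d\<nu>(x) + \<integral> \<bar>u x\<bar> (1 + \<bar>U x\<bar>) \<bar>x - y\<bar>\<^sup>1\<^sup>-\<^sup>n dx)\<close>,
  where \<open>\<nu>\<close> is the finite measure \<open>\<delta>\<^sub>a + \<bar>u\<bar> (1 + \<bar>U\<bar> + V) dx\<close> and \<open>b\<close> is slightly larger than \<open>n - 2\<close>
  (lemma \<open>solution_bound_on_smaller_ball\<close>).  Bounding the last integral by the potential of \<open>\<nu>\<close>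
  with exponent \<open>n - 1\<close> gives a first bound of \<open>u\<close> by a potential of \<open>\<nu>\<close>.  Inserting a bound of this
  kind into the last integral improves its exponent by a fixed amount: the Lorentz condition puts \<open>U\<close>
  into \<open>L\<^sup>q\<close> for some \<open>n < q < p\<close>, hence \<open>1 + \<bar>U\<bar>\<close> is integrable, uniformly in \<open>z\<close>, against
  \<open>\<bar>x - z\<bar>\<^sup>-\<^sup>\<tau>\<close> for some \<open>\<tau> > n - 1\<close>, and the excess \<open>\<tau> - (n - 1)\<close> is the gain (lemma
  \<open>drift_pot_le_pot\<close>).  After finitely many steps, each on a slightly smaller ball, \<open>\<bar>u\<bar>\<close> is bounded by the
  potential of \<open>\<nu>\<close> with exponent \<open>b\<close> (lemma \<open>AE_solution_le_pot\<close>).  For \<open>b\<close> close to \<open>n - 2\<close> the function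
  \<open>\<bar>U\<bar>\<^sup>2\<close> is integrable against \<open>\<bar>x - z\<bar>\<^sup>-\<^sup>b\<close>, uniformly in \<open>z\<close>, again because \<open>q > n\<close>; Tonelli's
  theorem then bounds the integral of \<open>\<bar>u\<bar> \<bar>U\<bar>\<^sup>2\<close> by the mass of \<open>\<nu>\<close>.
\<close>

section \<open>Calculus of twice differentiable functions\<close>

lemma partial_deriv_eq:
  assumes "(f has_derivative (\<lambda>h. G \<bullet> h)) (at x)"
  shows "partial_deriv i f x = G $ i"
proof -
  have "frechet_derivative f (at x) = (\<lambda>h. G \<bullet> h)"
    using frechet_derivative_at[OF assms] by simp
  then show ?thesis
    by (simp add: partial_deriv_def inner_axis)
qed

lemma has_derivative_gradient:
  fixes f :: "real ^ 'n::finite \<Rightarrow> real"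
  assumes "f differentiable (at x)"
  shows "(f has_derivative (\<lambda>h. gradient f x \<bullet> h)) (at x)"
proof -
  let ?D = "frechet_derivative f (at x)"
  have D: "(f has_derivative ?D) (at x)"
    using assms frechet_derivative_works by blast
  then have lin: "linear ?D" by (rule has_derivative_linear)
  have "?D h = gradient f x \<bullet> h" for h
  proof -
    have "?D h = ?D (\<Sum>i\<in>UNIV. (h $ i) *\<^sub>R axis i 1)"
      using basis_expansion[of h] by (simp add: scalar_mult_eq_scaleR)
    also have "\<dots> = (\<Sum>i\<in>UNIV. h $ i * ?D (axis i 1))"
      by (simp add: linear_sum[OF lin] linear_cmul[OF lin])
    also have "\<dots> = gradient f x \<bullet> h"
      by (simp add: inner_vec_def gradient_def partial_deriv_def mult.commute)
    finally show ?thesis .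
  qed
  then have "?D = (\<lambda>h. gradient f x \<bullet> h)" by auto
  with D show ?thesis by simp
qed

lemma gradient_component [simp]: "gradient f x $ i = partial_deriv i f x"
  by (simp add: gradient_def)

lemma partial_deriv_add:
  fixes f g :: "real ^ 'n::finite \<Rightarrow> real"
  assumes "f differentiable (at x)" "g differentiable (at x)"
  shows "partial_deriv i (\<lambda>y. f y + g y) x = partial_deriv i f x + partial_deriv i g x"
proof -
  have "((\<lambda>y. f y + g y) has_derivative (\<lambda>h. (gradient f x + gradient g x) \<bullet> h)) (at x)"
    unfolding inner_add_left
    using assms has_derivative_add has_derivative_gradient by blast
  from partial_deriv_eq[OF this] show ?thesis by simp
qed

lemma partial_deriv_mult:
  fixes f g :: "real ^ 'n::finite \<Rightarrow> real"
  assumes "f differentiable (at x)" "g differentiable (at x)"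
  shows "partial_deriv i (\<lambda>y. f y * g y) x = f x * partial_deriv i g x + partial_deriv i f x * g x"
proof -
  have "((\<lambda>y. f y * g y) has_derivative (\<lambda>h. (f x *\<^sub>R gradient g x + g x *\<^sub>R gradient f x) \<bullet> h)) (at x)"
    using has_derivative_mult[OF has_derivative_gradient[OF assms(1)] has_derivative_gradient[OF assms(2)]]
    by (simp add: inner_add_left mult.commute)
  from partial_deriv_eq[OF this] show ?thesis by (simp add: mult.commute)
qed

lemma partial_deriv_cong_open:
  assumes "open S" "x \<in> S" "\<And>y. y \<in> S \<Longrightarrow> f y = g y"
  shows "partial_deriv i f x = partial_deriv i g x"
proof -
  have "(f has_derivative D) (at x) \<longleftrightarrow> (g has_derivative D) (at x)" for D
    using has_derivative_transform_within_open[OF _ assms(1,2), of f D UNIV g]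
      has_derivative_transform_within_open[OF _ assms(1,2), of g D UNIV f] assms(3) by auto
  then show ?thesis by (simp add: partial_deriv_def frechet_derivative_def)
qed

lemma differentiable_cong_open:
  assumes "open S" "x \<in> S" "\<And>y. y \<in> S \<Longrightarrow> f y = g y" "f differentiable (at x)"
  shows "g differentiable (at x)"
  using assms unfolding differentiable_def
  by (meson has_derivative_transform_within_open)

lemma C1_cong_open:
  assumes S: "open S" and eq: "\<And>y. y \<in> S \<Longrightarrow> f y = g y" and f: "f \<in> C1 S"
  shows "g \<in> C1 S"
proof -
  have "continuous_on S (partial_deriv i g)" for i
  proof (rule continuous_on_eq)
    show "continuous_on S (partial_deriv i f)" using f by (simp add: C1_def)
    show "partial_deriv i f x = partial_deriv i g x" if "x \<in> S" for x
      by (rule partial_deriv_cong_open[OF S that eq])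
  qed
  moreover have "g differentiable (at x)" if "x \<in> S" for x
    using differentiable_cong_open[OF S that eq] f that by (simp add: C1_def)
  ultimately show ?thesis by (simp add: C1_def)
qed

lemma C1_continuous_on: "f \<in> C1 S \<Longrightarrow> continuous_on S f"
  unfolding C1_def
  by (auto intro!: continuous_at_imp_continuous_on differentiable_imp_continuous_within)

lemma C1_add:
  assumes "open S" "f \<in> C1 S" "g \<in> C1 S"
  shows "(\<lambda>x. f x + g x) \<in> C1 S"
proof -
  have "continuous_on S (partial_deriv i (\<lambda>x. f x + g x))" for i
  proof (rule continuous_on_eq)
    show "continuous_on S (\<lambda>x. partial_deriv i f x + partial_deriv i g x)"
      using assms C1_continuous_on[OF assms(2)] C1_continuous_on[OF assms(3)]
      by (intro continuous_intros) (auto simp: C1_def)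
    show "partial_deriv i f x + partial_deriv i g x = partial_deriv i (\<lambda>x. f x + g x) x" if "x \<in> S" for x
      using assms that by (subst partial_deriv_add) (auto simp: C1_def)
  qed
  then show ?thesis using assms by (auto simp: C1_def)
qed

lemma C1_mult:
  assumes "open S" "f \<in> C1 S" "g \<in> C1 S"
  shows "(\<lambda>x. f x * g x) \<in> C1 S"
proof -
  have "continuous_on S (partial_deriv i (\<lambda>x. f x * g x))" for i
  proof (rule continuous_on_eq)
    show "continuous_on S (\<lambda>x. f x * partial_deriv i g x + partial_deriv i f x * g x)"
      using assms C1_continuous_on[OF assms(2)] C1_continuous_on[OF assms(3)]
      by (intro continuous_intros) (auto simp: C1_def)
    show "f x * partial_deriv i g x + partial_deriv i f x * g x = partial_deriv i (\<lambda>x. f x * g x) x" if "x \<in> S" for x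
      using assms that by (subst partial_deriv_mult) (auto simp: C1_def)
  qed
  then show ?thesis using assms by (auto simp: C1_def)
qed

lemma C2_mult:
  assumes S: "open S" and f: "f \<in> C2 S" and g: "g \<in> C2 S"
  shows "(\<lambda>x. f x * g x) \<in> C2 S"
proof -
  have "(\<lambda>x. f x * partial_deriv i g x + partial_deriv i f x * g x) \<in> C1 S" for i
    using f g by (intro C1_add C1_mult S) (auto simp: C2_def)
  then have "partial_deriv i (\<lambda>x. f x * g x) \<in> C1 S" for i
    by (rule C1_cong_open[OF S, rotated]) (use f g in \<open>auto simp: C2_def C1_def partial_deriv_mult\<close>)
  then show ?thesis using C1_mult[OF S] f g by (auto simp: C2_def)
qed

lemma gradient_mult:
  fixes f g :: "real ^ 'n::finite \<Rightarrow> real"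
  assumes "f differentiable (at x)" "g differentiable (at x)"
  shows "gradient (\<lambda>y. f y * g y) x = f x *\<^sub>R gradient g x + g x *\<^sub>R gradient f x"
  by (simp add: vec_eq_iff partial_deriv_mult[OF assms] mult.commute)

lemma laplacian_mult:
  fixes f g :: "real ^ 'n::finite \<Rightarrow> real"
  assumes S: "open S" "x \<in> S" and f: "f \<in> C2 S" and g: "g \<in> C2 S"
  shows "laplacian (\<lambda>y. f y * g y) x
    = f x * laplacian g x + 2 * (gradient f x \<bullet> gradient g x) + g x * laplacian f x"
proof -
  have d: "f differentiable (at y)" "g differentiable (at y)"
    "partial_deriv i f differentiable (at y)" "partial_deriv i g differentiable (at y)"
    if "y \<in> S" for y i
    using f g that by (auto simp: C2_def C1_def)
  have "partial_deriv i (partial_deriv i (\<lambda>y. f y * g y)) x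
     = f x * partial_deriv i (partial_deriv i g) x + 2 * (partial_deriv i f x * partial_deriv i g x)
       + g x * partial_deriv i (partial_deriv i f) x" for i
  proof -
    have "partial_deriv i (partial_deriv i (\<lambda>y. f y * g y)) x
      = partial_deriv i (\<lambda>y. f y * partial_deriv i g y + partial_deriv i f y * g y) x"
      by (rule partial_deriv_cong_open[OF S]) (simp add: partial_deriv_mult d)
    also have "\<dots> = partial_deriv i (\<lambda>y. f y * partial_deriv i g y) x
        + partial_deriv i (\<lambda>y. partial_deriv i f y * g y) x"
      by (rule partial_deriv_add) (use d[OF S(2)] in auto)
    finally show ?thesis
      using d[OF S(2)] by (simp add: partial_deriv_mult)
  qed
  then show ?thesis
    by (simp add: laplacian_def inner_vec_def sum.distrib sum_distrib_left)
qed

text \<open>Outside the closed ball the function and its derivatives vanish, and the complement of the ball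
  together with \<open>S\<close> covers the whole space by two open sets; so all derivatives are continuous on
  the whole space, and their restrictions are the required extensions to the boundary.\<close>

lemma C2_0_if_supported_in_cball:
  fixes f :: "real ^ 'n::finite \<Rightarrow> real"
  assumes S: "open S" "cball a r \<subseteq> S" and f: "f \<in> C2 S" and 0: "\<And>x. x \<notin> cball a r \<Longrightarrow> f x = 0"
  shows "f \<in> C2_0 S"
proof -
  let ?E = "- cball a r"
  have E: "open ?E" by (simp add: open_Compl)
  have U: "UNIV = S \<union> ?E" using S by auto
  have pd0: "partial_deriv i (\<lambda>x. 0::real) x = 0" for i and x :: "real ^ 'n"
    by (simp add: partial_deriv_def)
  have p1: "partial_deriv i f x = 0" if "x \<in> ?E" for i x
    using partial_deriv_cong_open[OF E that, of f "\<lambda>_. 0"] 0 by (simp add: pd0)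
  have p2: "partial_deriv j (partial_deriv i f) x = 0" if "x \<in> ?E" for i j x
    using partial_deriv_cong_open[OF E that, of "partial_deriv i f" "\<lambda>_. 0"] p1 by (simp add: pd0)
  have glue: "continuous_on UNIV g" if "continuous_on S g" "\<And>x. x \<in> ?E \<Longrightarrow> g x = 0"
    for g :: "real ^ 'n \<Rightarrow> real"
    unfolding U using that
    by (intro continuous_on_open_Un S E) (auto intro: continuous_on_eq[OF continuous_on_const[where c=0]])
  have c: "continuous_on UNIV f" "continuous_on UNIV (partial_deriv i f)"
    "continuous_on UNIV (partial_deriv j (partial_deriv i f))" for i j
    using f C1_continuous_on[of f S] p1 p2 0 by (auto intro!: glue simp: C2_def C1_def)
  have ext: "extends_continuously S g" if "continuous_on UNIV g" for g
    unfolding extends_continuously_def using continuous_on_subset[OF that subset_UNIV] by blast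
  have "f x = 0" if "x \<in> frontier S" for x
    using that S by (intro 0) (auto simp: frontier_def interior_open)
  then show ?thesis
    using f c ext continuous_on_subset[OF c(1) subset_UNIV]
    by (auto simp: C2_0_def C2_closure_def C1_closure_def C2_def)
qed

lemma radial_has_derivative:
  fixes c :: "real ^ 'n::finite" and h h1 :: "real \<Rightarrow> real"
  assumes "\<And>s. s \<ge> 0 \<Longrightarrow> (h has_real_derivative h1 s) (at s)"
  shows "((\<lambda>x. h ((x - c) \<bullet> (x - c))) has_derivative
    (\<lambda>v. ((2 * h1 ((x - c) \<bullet> (x - c))) *\<^sub>R (x - c)) \<bullet> v)) (at x)"
proof -
  have q: "((\<lambda>x. (x - c) \<bullet> (x - c)) has_derivative (\<lambda>v. 2 * ((x - c) \<bullet> v))) (at x)"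
    by (auto intro!: derivative_eq_intros simp: inner_commute)
  have "(h has_derivative (\<lambda>t. h1 ((x - c) \<bullet> (x - c)) * t)) (at ((x - c) \<bullet> (x - c)))"
    using assms[of "(x - c) \<bullet> (x - c)"] by (simp add: has_field_derivative_def)
  from has_derivative_compose[OF q this] show ?thesis
    by (simp add: mult_ac)
qed

text \<open>The cutoff and the Newton potential are both functions of the squared distance to a point; this
  form avoids the singularity of the norm at the centre.\<close>

lemma radial_C2:
  fixes c :: "real ^ 'n::finite" and h h1 h2 :: "real \<Rightarrow> real"
  assumes h1: "\<And>s. s \<ge> 0 \<Longrightarrow> (h has_real_derivative h1 s) (at s)"
    and h2: "\<And>s. s \<ge> 0 \<Longrightarrow> (h1 has_real_derivative h2 s) (at s)"
    and cont: "continuous_on {0..} h2"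
  shows "(\<lambda>x. h ((x - c) \<bullet> (x - c))) \<in> C2 UNIV" (is "?f \<in> _")
    and "gradient (\<lambda>x. h ((x - c) \<bullet> (x - c))) x = (2 * h1 ((x - c) \<bullet> (x - c))) *\<^sub>R (x - c)"
    and "laplacian (\<lambda>x. h ((x - c) \<bullet> (x - c))) x =
      4 * h2 ((x - c) \<bullet> (x - c)) * ((x - c) \<bullet> (x - c)) + 2 * real CARD('n) * h1 ((x - c) \<bullet> (x - c))"
proof -
  let ?q = "\<lambda>x. (x - c) \<bullet> (x - c)"
  have D: "(?f has_derivative (\<lambda>v. ((2 * h1 (?q x)) *\<^sub>R (x - c)) \<bullet> v)) (at x)" for x
    by (rule radial_has_derivative) (rule h1)
  have D1: "((\<lambda>x. h1 (?q x)) has_derivative (\<lambda>v. ((2 * h2 (?q x)) *\<^sub>R (x - c)) \<bullet> v)) (at x)" for x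
    by (rule radial_has_derivative) (rule h2)
  have p1: "partial_deriv i ?f = (\<lambda>x. 2 * h1 (?q x) * (x - c) $ i)" for i
    using partial_deriv_eq[OF D] by auto
  then show "gradient ?f x = (2 * h1 (?q x)) *\<^sub>R (x - c)"
    by (simp add: vec_eq_iff)
  have G: "(partial_deriv i ?f has_derivative
     (\<lambda>v. ((4 * h2 (?q x) * (x - c) $ i) *\<^sub>R (x - c) + (2 * h1 (?q x)) *\<^sub>R axis i 1) \<bullet> v)) (at x)" for i x
  proof -
    have "((\<lambda>x. x - c) has_derivative (\<lambda>v. v)) (at x)"
      by (auto intro!: derivative_eq_intros)
    from bounded_linear.has_derivative[OF bounded_linear_vec_nth this]
    have "((\<lambda>x. (x - c) $ i) has_derivative (\<lambda>v. v $ i)) (at x)" .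
    from has_derivative_mult[OF D1 this] 
    have "((\<lambda>x. 2 * (h1 (?q x) * (x - c) $ i)) has_derivative
      (\<lambda>v. 2 * (h1 (?q x) * v $ i + ((2 * h2 (?q x)) *\<^sub>R (x - c)) \<bullet> v * (x - c) $ i))) (at x)"
      by (rule has_derivative_mult_right)
    moreover have "2 * (t * v $ i + ((2 * t') *\<^sub>R w) \<bullet> v * w $ i)
      = ((4 * t' * w $ i) *\<^sub>R w + (2 * t) *\<^sub>R axis i 1) \<bullet> v" for t t' :: real and v w :: "real ^ 'n"
      by (simp add: inner_add_left inner_axis inner_commute[of "axis i 1"] algebra_simps)
    ultimately show ?thesis
      unfolding p1 by (simp only: mult.assoc)
  qed
  have p2: "partial_deriv j (partial_deriv i ?f) = (\<lambda>x. 4 * h2 (?q x) * (x - c) $ i * (x - c) $ j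
      + 2 * h1 (?q x) * (axis i 1 :: real ^ 'n) $ j)" for i j
    using partial_deriv_eq[OF G] by auto
  have ch2: "continuous_on UNIV (\<lambda>x. h2 (?q x))"
    by (rule continuous_on_compose2[OF cont]) (auto intro!: continuous_intros)
  have ch1: "continuous_on UNIV (\<lambda>x. h1 (?q x))"
    using has_derivative_continuous[OF D1] by (intro continuous_at_imp_continuous_on) auto
  show "?f \<in> C2 UNIV"
    unfolding C2_def C1_def
  proof (intro CollectI conjI allI ballI)
    show "?f differentiable at x" for x using D differentiable_def by blast
    show "continuous_on UNIV (partial_deriv i ?f)" for i
      unfolding p1 by (intro continuous_intros ch1)
    show "partial_deriv i ?f differentiable at x" for i x using G differentiable_def by blast
    show "continuous_on UNIV (partial_deriv j (partial_deriv i ?f))" for i j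
      unfolding p2 by (intro continuous_intros ch1 ch2)
  qed
  have "laplacian ?f x = (\<Sum>i\<in>UNIV. 4 * h2 (?q x) * ((x - c) $ i * (x - c) $ i) + 2 * h1 (?q x))"
    unfolding laplacian_def p2 by (intro sum.cong) (simp_all add: axis_def)
  also have "\<dots> = 4 * h2 (?q x) * (\<Sum>i\<in>UNIV. (x - c) $ i * (x - c) $ i) + 2 * real CARD('n) * h1 (?q x)"
    by (simp add: sum.distrib sum_distrib_left)
  also have "(\<Sum>i\<in>UNIV. (x - c) $ i * (x - c) $ i) = ?q x" by (simp add: inner_vec_def)
  finally show "laplacian ?f x = 4 * h2 (?q x) * ?q x + 2 * real CARD('n) * h1 (?q x)" .
qed

section \<open>Profiles of the cutoff and of the regularised Newton potential\<close>

text \<open>The exponent is at least two, so that the derivative exists at \<open>0\<close> as well, with a continuous value.\<close>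

lemma has_real_derivative_pos_part_power:
  "((\<lambda>t::real. max 0 t ^ Suc (Suc m)) has_real_derivative real (m + 2) * max 0 t ^ Suc m) (at t)"
proof -
  consider "t > 0" | "t < 0" | "t = 0" by linarith
  then show ?thesis
  proof cases
    case 1
    have "((\<lambda>t::real. t ^ Suc (Suc m)) has_real_derivative real (m + 2) * max 0 t ^ Suc m) (at t)"
      using 1 DERIV_pow[of "Suc (Suc m)" t] by (simp add: max_def)
    then show ?thesis
      by (rule has_field_derivative_transform_within_open[of _ _ _ "{0<..}"]) (use 1 in \<open>auto simp: max_def\<close>)
  next
    case 2
    have "((\<lambda>t::real. 0) has_real_derivative real (m + 2) * max 0 t ^ Suc m) (at t)"
      using 2 by (auto simp: max_def)
    then show ?thesis
      by (rule has_field_derivative_transform_within_open[of _ _ _ "{..<0}"]) (use 2 in \<open>auto simp: max_def\<close>)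
  next
    case 3
    have "((\<lambda>t::real. max 0 t ^ Suc m) \<longlongrightarrow> max 0 0 ^ Suc m) (at 0)"
      by (intro tendsto_intros)
    then have "((\<lambda>t::real. max 0 t ^ Suc m) \<longlongrightarrow> 0) (at 0)" by simp
    then have "((\<lambda>t::real. max 0 t ^ Suc (Suc m) / t) \<longlongrightarrow> 0) (at 0)"
      by (rule Lim_transform_eventually) (auto simp: eventually_at max_def intro!: exI[of _ 1])
    then show ?thesis using 3 by (simp add: DERIV_def)
  qed
qed

text \<open>The third power of the positive part is the smallest integer power that makes the cutoff twice continuously
  differentiable across the sphere of radius \<open>r\<close>.\<close>

definition bump_profile :: "real \<Rightarrow> real \<Rightarrow> real" where
  "bump_profile r s = max 0 (1 - s / r\<^sup>2) ^ 3"

lemma bump_profile_derivs: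
  assumes "r > 0"
  shows "(bump_profile r has_real_derivative - (3 / r\<^sup>2) * max 0 (1 - s / r\<^sup>2) ^ 2) (at s)"
    and "((\<lambda>s. - (3 / r\<^sup>2) * max 0 (1 - s / r\<^sup>2) ^ 2) has_real_derivative
          (6 / r ^ 4) * max 0 (1 - s / r\<^sup>2)) (at s)"
proof -
  have *: "((\<lambda>s. 1 - s / r\<^sup>2) has_real_derivative - (1 / r\<^sup>2)) (at s)"
    using assms by (auto intro!: derivative_eq_intros simp: divide_simps power2_eq_square power4_eq_xxxx)
  show "(bump_profile r has_real_derivative - (3 / r\<^sup>2) * max 0 (1 - s / r\<^sup>2) ^ 2) (at s)"
    using DERIV_chain2[OF has_real_derivative_pos_part_power[of 1] *]
    by (simp add: bump_profile_def[abs_def] numeral_eq_Suc)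
  have "((\<lambda>s. max 0 (1 - s / r\<^sup>2) ^ 2) has_real_derivative - (2 / r\<^sup>2) * max 0 (1 - s / r\<^sup>2)) (at s)"
    using DERIV_chain2[OF has_real_derivative_pos_part_power[of 0] *]
    by (simp add: numeral_eq_Suc)
  from DERIV_cmult[OF this, of "- (3 / r\<^sup>2)"]
  show "((\<lambda>s. - (3 / r\<^sup>2) * max 0 (1 - s / r\<^sup>2) ^ 2) has_real_derivative
          (6 / r ^ 4) * max 0 (1 - s / r\<^sup>2)) (at s)"
    by (simp add: power2_eq_square power4_eq_xxxx mult_ac)
qed

text \<open>A primitive of \<open>- s powr (- n / 2) / 2\<close>.  As a function of \<open>s = \<bar>x\<bar>\<^sup>2\<close> it is a multiple of the fundamental
  solution of the Laplacian in dimension \<open>n\<close>, logarithmic in the plane.\<close>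

definition newton_profile :: "nat \<Rightarrow> real \<Rightarrow> real" where
  "newton_profile n s = (if n = 2 then - ln s / 2 else s powr (1 - real n / 2) / (real n - 2))"

lemma newton_profile_deriv:
  assumes "s > 0" "n \<ge> 2"
  shows "(newton_profile n has_real_derivative - (1/2) * s powr (- (real n / 2))) (at s)"
proof (cases "n = 2")
  case True
  have "((\<lambda>s. - ln s / 2) has_real_derivative - (1/2) * s powr (- (real n / 2))) (at s)"
    using assms True by (auto intro!: derivative_eq_intros simp: powr_minus divide_simps)
  then show ?thesis using True by (simp add: newton_profile_def[abs_def])
next
  case False
  then have n: "real n - 2 \<noteq> 0" using assms by auto
  have "((\<lambda>s. s powr (1 - real n / 2) / (real n - 2)) has_real_derivative
     ((1 - real n / 2) * s powr (1 - real n / 2 - 1)) / (real n - 2)) (at s)"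
    using assms by (intro DERIV_cdivide has_real_derivative_powr) auto
  moreover have "((1 - real n / 2) * s powr (1 - real n / 2 - 1)) / (real n - 2) = - (1/2) * s powr (- (real n / 2))"
    using n by (simp add: field_simps)
  ultimately show ?thesis using False by (simp add: newton_profile_def[abs_def])
qed

text \<open>Giving up an arbitrarily small power absorbs the logarithm of the planar case, so that both cases
  can be treated with one kernel.\<close>

lemma newton_profile_bound:
  assumes n: "n \<ge> 2" and \<beta>: "\<beta> > real n - 2" and S: "S > 0"
  shows "\<exists>C\<ge>0. \<forall>s. 0 < s \<and> s \<le> S \<longrightarrow> \<bar>newton_profile n s\<bar> \<le> C * s powr (- \<beta> / 2)"
proof (cases "n = 2")
  case True
  define \<alpha> where "\<alpha> = \<beta> / 2"
  have \<alpha>: "\<alpha> > 0" using \<beta> True by (simp add: \<alpha>_def)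
  have "\<bar>newton_profile n s\<bar> \<le> (1 / \<alpha> + \<bar>ln S\<bar> * S powr \<alpha>) * s powr (- \<beta> / 2)" if s: "0 < s" "s \<le> S" for s
  proof (cases "s \<le> 1")
    case True
    have "ln (1 / s) \<le> (1 / s) powr \<alpha> / \<alpha>"
      using s True \<alpha> by (intro ln_powr_bound) auto
    also have "(1 / s) powr \<alpha> = s powr (- \<beta> / 2)"
      using s by (simp add: powr_minus powr_divide \<alpha>_def inverse_eq_divide)
    finally have "- ln s \<le> s powr (- \<beta> / 2) / \<alpha>" using s by (simp add: ln_div)
    moreover have "\<bar>newton_profile n s\<bar> \<le> - ln s"
      using \<open>n = 2\<close> s True by (simp add: newton_profile_def)
    ultimately have "\<bar>newton_profile n s\<bar> \<le> (1 / \<alpha>) * s powr (- \<beta> / 2)" by simp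
    also have "\<dots> \<le> (1 / \<alpha> + \<bar>ln S\<bar> * S powr \<alpha>) * s powr (- \<beta> / 2)"
      by (intro mult_right_mono) auto
    finally show ?thesis .
  next
    case False
    have "\<bar>newton_profile n s\<bar> \<le> \<bar>ln S\<bar>"
    proof -
      have "0 \<le> ln s" "ln s \<le> ln S" using s False by auto
      then show ?thesis using \<open>n = 2\<close> by (simp add: newton_profile_def)
    qed
    also have "\<dots> \<le> \<bar>ln S\<bar> * (S powr \<alpha> * s powr (- \<beta> / 2))"
    proof -
      have "S powr \<alpha> * s powr (- \<beta> / 2) = (S / s) powr \<alpha>"
      proof -
        have "s powr (- \<beta> / 2) = 1 / s powr \<alpha>"
          by (simp add: powr_minus_divide[symmetric] \<alpha>_def)
        then show ?thesis using s by (simp add: powr_divide)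
      qed
      moreover have "(S / s) powr \<alpha> \<ge> 1"
        using s \<alpha> by (intro ge_one_powr_ge_zero) auto
      ultimately show ?thesis by (simp add: mult_le_cancel_left1)
    qed
    also have "\<dots> \<le> (1 / \<alpha> + \<bar>ln S\<bar> * S powr \<alpha>) * s powr (- \<beta> / 2)"
      using \<alpha> by (simp add: distrib_right mult.assoc)
    finally show ?thesis .
  qed
  then show ?thesis using \<alpha> by (intro exI[of _ "1 / \<alpha> + \<bar>ln S\<bar> * S powr \<alpha>"]) auto
next
  case False
  then have n: "real n > 2" using assms by auto
  define \<gamma> where "\<gamma> = 1 - real n / 2 + \<beta> / 2"
  have \<gamma>: "\<gamma> \<ge> 0" using \<beta> by (simp add: \<gamma>_def field_simps)
  have "\<bar>newton_profile n s\<bar> \<le> (S powr \<gamma> / (real n - 2)) * s powr (- \<beta> / 2)" if s: "0 < s" "s \<le> S" for s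
  proof -
    have "\<bar>newton_profile n s\<bar> = s powr \<gamma> * s powr (- \<beta> / 2) / (real n - 2)"
      using False n by (simp add: newton_profile_def powr_add[symmetric] \<gamma>_def)
    also have "\<dots> \<le> S powr \<gamma> * s powr (- \<beta> / 2) / (real n - 2)"
      using s n \<gamma> by (intro divide_right_mono mult_right_mono powr_mono2) auto
    finally show ?thesis by simp
  qed
  then show ?thesis using n by (intro exI[of _ "S powr \<gamma> / (real n - 2)"]) auto
qed

section \<open>Lorentz spaces, weak type and powers\<close>

text \<open>Dyadic layers: on the set where \<open>f\<close> lies between consecutive powers of two the power \<open>f powr q\<close> is
  at most the larger power of two to the \<open>q\<close>, and the measures of these sets decay like a geometric
  sequence with ratio \<open>2 powr (- p)\<close>.  The bound depends on \<open>f\<close> only through \<open>C\<close>, which makes it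
  uniform for the translates of a singular kernel.\<close>

lemma weak_type_imp_nn_integral_powr_le:
  fixes f :: "'a \<Rightarrow> real"
  assumes f[measurable]: "f \<in> borel_measurable M" and nn: "\<And>x. x \<in> space M \<Longrightarrow> 0 \<le> f x"
    and q: "0 < q" "q < p" and C: "0 \<le> C"
    and weak: "\<And>t. t > 0 \<Longrightarrow> emeasure M {x \<in> space M. t < f x} \<le> ennreal (C * t powr (- p))"
  shows "(\<integral>\<^sup>+x. ennreal (f x powr q) \<partial>M)
    \<le> emeasure M (space M) + ennreal (C * 2 powr q / (1 - 2 powr (q - p)))"
proof -
  let ?w = "\<lambda>k::nat. 2 powr (q * (real k + 1))"
  let ?A = "\<lambda>k::nat. {x \<in> space M. 2 ^ k < f x}"
  have pt: "ennreal (f x powr q) \<le> 1 + (\<Sum>k. ennreal (?w k) * indicator (?A k) x)" if x: "x \<in> space M" for x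
  proof (cases "f x \<le> 1")
    case True
    then have "f x powr q \<le> 1" using nn[OF x] q by (intro powr_le1) auto
    then have "ennreal (f x powr q) \<le> 1" using ennreal_leI by fastforce
    then show ?thesis by (intro add_increasing2) auto
  next
    case False
    define k where "k = (LEAST k::nat. f x \<le> 2 ^ Suc k)"
    have ex: "\<exists>k::nat. f x \<le> 2 ^ Suc k"
    proof -
      obtain m where "f x < 2 ^ m" using real_arch_pow[of 2 "f x"] by auto
      moreover have "(2::real) ^ m \<le> 2 ^ Suc m" by (intro power_increasing) auto
      ultimately have "f x \<le> 2 ^ Suc m" by linarith
      then show ?thesis by blast
    qed
    have k1: "f x \<le> 2 ^ Suc k" unfolding k_def by (rule LeastI_ex[OF ex])
    have k2: "2 ^ k < f x"
    proof (cases k)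
      case 0 then show ?thesis using False by simp
    next
      case (Suc j)
      then have "j < (LEAST k::nat. f x \<le> 2 ^ Suc k)" unfolding k_def by simp
      from not_less_Least[OF this] show ?thesis unfolding Suc by simp
    qed
    have "f x powr q \<le> (2 ^ Suc k) powr q" using k1 False q by (intro powr_mono2) auto
    also have "(2 ^ Suc k :: real) = 2 powr (real k + 1)"
      by (simp add: powr_realpow[symmetric] powr_add)
    also have "\<dots> powr q = ?w k" by (simp add: powr_powr mult.commute)
    finally have "ennreal (f x powr q) \<le> ennreal (?w k) * indicator (?A k) x"
      using k2 x by (simp add: ennreal_leI)
    also have "\<dots> \<le> (\<Sum>k. ennreal (?w k) * indicator (?A k) x)"
    proof -
      let ?t = "\<lambda>k. ennreal (?w k) * indicator (?A k) x"
      have "sum ?t {k} \<le> suminf ?t" by (rule sum_le_suminf) auto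
      moreover have "sum ?t {k} = ?t k" by (subst sum.insert) simp_all
      ultimately show ?thesis by metis
    qed
    also have "\<dots> \<le> 1 + \<dots>" by (simp add: add_increasing)
    finally show ?thesis .
  qed
  have "(\<integral>\<^sup>+x. ennreal (f x powr q) \<partial>M) \<le> (\<integral>\<^sup>+x. 1 + (\<Sum>k. ennreal (?w k) * indicator (?A k) x) \<partial>M)"
    by (intro nn_integral_mono pt)
  also have "\<dots> = emeasure M (space M) + (\<Sum>k. ennreal (?w k) * emeasure M (?A k))"
    by (simp add: nn_integral_add nn_integral_suminf nn_integral_cmult_indicator)
  also have "(\<Sum>k. ennreal (?w k) * emeasure M (?A k)) \<le> (\<Sum>k. ennreal (C * 2 powr q * (2 powr (q - p)) ^ k))"
  proof (intro suminf_le)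
    fix k :: nat
    have "ennreal (?w k) * emeasure M (?A k) \<le> ennreal (?w k) * ennreal (C * (2 ^ k) powr (- p))"
      by (intro mult_left_mono weak) auto
    also have "\<dots> = ennreal (?w k * (C * (2 ^ k) powr (- p)))"
      using C by (simp add: ennreal_mult)
    also have "?w k * (C * (2 ^ k) powr (- p)) = C * 2 powr q * (2 powr (q - p)) ^ k"
      by (simp add: powr_realpow[symmetric] powr_powr powr_add[symmetric] algebra_simps)
    finally show "ennreal (?w k) * emeasure M (?A k) \<le> \<dots>" .
  qed auto
  also have "\<dots> = ennreal (C * 2 powr q / (1 - 2 powr (q - p)))"
  proof -
    have "2 powr (q - p) < (1::real)" using q powr_less_mono[of "q - p" 0 "2::real"] by simp
    then have "(\<lambda>k. C * 2 powr q * (2 powr (q - p)) ^ k) sums (C * 2 powr q * (1 / (1 - 2 powr (q - p))))"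
      by (intro sums_mult geometric_sums) auto
    then show ?thesis
      using C by (intro suminf_ennreal_eq) auto
  qed
  finally show ?thesis by (simp add: add_left_mono)
qed

lemma rearrangement_antimono:
  assumes "s \<le> t"
  shows "rearrangement S f t \<le> rearrangement S f s"
  unfolding rearrangement_def
  by (intro Inf_superset_mono) (auto intro: order_trans[OF _ ennreal_leI[OF assms]])

lemma le_rearrangement:
  assumes S: "S \<in> sets lebesgue" and f[measurable]: "f \<in> borel_measurable (lebesgue_on S)"
    and s: "ennreal s < emeasure (lebesgue_on S) {x \<in> S. \<tau> < f x}"
  shows "\<tau> \<le> rearrangement S f s"
  unfolding rearrangement_def
proof (intro Inf_greatest, clarify)
  fix t assume t: "emeasure (lebesgue_on S) {x \<in> S. t < f x} \<le> ennreal s"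
  show "\<tau> \<le> t"
  proof (rule ccontr)
    assume "\<not> \<tau> \<le> t"
    have "{x \<in> space (lebesgue_on S). t < f x} \<in> sets (lebesgue_on S)" by measurable
    then have "emeasure (lebesgue_on S) {x \<in> S. \<tau> < f x} \<le> emeasure (lebesgue_on S) {x \<in> S. t < f x}"
      using \<open>\<not> \<tau> \<le> t\<close> S by (intro emeasure_mono) (auto simp: space_restrict_space)
    with s t show False by simp
  qed
qed

lemma rearrangement_le_avg_rearrangement:
  assumes "t > 0"
  shows "rearrangement S f t \<le> avg_rearrangement S f t"
proof -
  have "rearrangement S f t = ennreal (1 / t) * (\<integral>\<^sup>+\<sigma>\<in>{0<..<t}. rearrangement S f t \<partial>lborel)"
    using assms by (simp add: nn_integral_cmult_indicator mult.assoc[symmetric] mult.commute ennreal_mult[symmetric])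
  also have "\<dots> \<le> avg_rearrangement S f t"
    unfolding avg_rearrangement_def
    by (intro mult_left_mono nn_integral_mono) (auto simp: indicator_def intro!: rearrangement_antimono)
  finally show ?thesis .
qed

text \<open>Both the rearrangement and its average are bounded below on \<open>(s/2, s)\<close> by the rearrangement at \<open>s\<close>,
  so the part of the Lorentz integral over that interval already controls \<open>s powr (1 / p)\<close> times this value.\<close>

lemma rearrangement_powr_bound:
  fixes S :: "(real ^ 'n::finite) set"
  assumes p: "p > 0" and L: "measure lebesgue S > 0" and fin: "lorentz_norm p S f < \<infinity>"
  shows "\<exists>K\<ge>0. \<forall>s. 0 < s \<and> s < measure lebesgue S \<longrightarrow> ennreal (s powr (1 / p)) * rearrangement S f s \<le> ennreal K"
proof -
  let ?L = "measure lebesgue S"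
  let ?g = "\<lambda>t. ennreal (t powr (1 / p)) * avg_rearrangement S f t * ennreal (1 / t)"
  define I where "I = (\<integral>\<^sup>+t\<in>{0<..<?L}. ?g t \<partial>lborel)"
  have "I < \<infinity>"
    using fin L unfolding lorentz_norm_def I_def[symmetric]
    by (auto simp: ennreal_mult_less_top)
  then obtain I' where I': "I = ennreal I'" "I' \<ge> 0" by (cases I) auto
  have "ennreal (s powr (1 / p)) * rearrangement S f s \<le> ennreal (2 * 2 powr (1 / p) * I')"
    if s: "0 < s" "s < ?L" for s
  proof -
    let ?c = "ennreal ((s / 2) powr (1 / p)) * rearrangement S f s * ennreal (1 / s)"
    have "?c * ennreal (s / 2) = (\<integral>\<^sup>+t\<in>{s/2<..<s}. ?c \<partial>lborel)"
      using s by (simp add: nn_integral_cmult_indicator)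
    also have "\<dots> \<le> I"
      unfolding I_def
    proof (intro nn_integral_mono)
      fix t
      show "?c * indicator {s/2<..<s} t \<le> ?g t * indicator {0<..<?L} t"
      proof (cases "t \<in> {s/2<..<s}")
        case True
        have "?c \<le> ?g t"
          using True s p rearrangement_antimono[of t s S f] rearrangement_le_avg_rearrangement[of t S f]
          by (intro mult_mono ennreal_leI powr_mono2) (auto simp: divide_simps)
        then show ?thesis using True s by simp
      qed simp
    qed
    finally have *: "?c * ennreal (s / 2) \<le> ennreal I'" using I' by simp
    have "ennreal (s powr (1 / p)) * rearrangement S f s
      = ennreal (2 * 2 powr (1 / p)) * (?c * ennreal (s / 2))"
    proof -
      have "s powr (1 / p) = (2 * 2 powr (1 / p)) * ((s / 2) powr (1 / p) * (1 / s) * (s / 2))"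
        using s by (simp add: powr_divide)
      then have "ennreal (s powr (1 / p)) = ennreal (2 * 2 powr (1 / p)) *
         (ennreal ((s / 2) powr (1 / p)) * ennreal (1 / s) * ennreal (s / 2))"
        using s by (simp add: ennreal_mult[symmetric])
      then show ?thesis by (simp add: mult_ac)
    qed
    also have "\<dots> \<le> ennreal (2 * 2 powr (1 / p)) * ennreal I'"
      by (intro mult_left_mono *) auto
    finally show ?thesis using I' by (simp add: ennreal_mult)
  qed
  then show ?thesis using I' by (intro exI[of _ "2 * 2 powr (1 / p) * I'"]) auto
qed

text \<open>The rearrangement is at least \<open>\<tau>\<close> at half the measure \<open>m\<close> of the superlevel set at \<open>\<tau>\<close>; the decay of the
  rearrangement then bounds \<open>m\<close>.\<close>

lemma lorentz_imp_weak_type: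
  fixes S :: "(real ^ 'n::finite) set" and g :: "real ^ 'n \<Rightarrow> real"
  assumes S: "S \<in> lmeasurable" and L: "measure lebesgue S > 0" and p: "p > 0"
    and g: "g \<in> lorentz_space p S"
  shows "\<exists>C\<ge>0. \<forall>\<tau>>0. emeasure (lebesgue_on S) {x \<in> S. \<tau> < \<bar>g x\<bar>} \<le> ennreal (C * \<tau> powr (- p))"
proof -
  have gm[measurable]: "g \<in> borel_measurable (lebesgue_on S)"
    and fin: "lorentz_norm p S (\<lambda>x. ennreal \<bar>g x\<bar>) < \<infinity>"
    using g by (auto simp: lorentz_space_def)
  have Sl: "S \<in> sets lebesgue" using S by auto
  interpret finite_measure "lebesgue_on S" by (rule finite_measure_lebesgue_on[OF S])
  obtain K where K: "K \<ge> 0"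
    "\<And>s. 0 < s \<Longrightarrow> s < measure lebesgue S \<Longrightarrow>
      ennreal (s powr (1 / p)) * rearrangement S (\<lambda>x. ennreal \<bar>g x\<bar>) s \<le> ennreal K"
    using rearrangement_powr_bound[OF p L fin] by blast
  have "emeasure (lebesgue_on S) {x \<in> S. \<tau> < \<bar>g x\<bar>} \<le> ennreal (2 * K powr p * \<tau> powr (- p))"
    if \<tau>: "\<tau> > 0" for \<tau>
  proof -
    define m where "m = measure (lebesgue_on S) {x \<in> S. \<tau> < \<bar>g x\<bar>}"
    have em: "emeasure (lebesgue_on S) {x \<in> S. \<tau> < \<bar>g x\<bar>} = ennreal m"
      by (simp add: m_def emeasure_eq_measure)
    have "m \<le> 2 * K powr p * \<tau> powr (- p)"
    proof (cases "m > 0")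
      case True
      have "m \<le> measure (lebesgue_on S) (space (lebesgue_on S))"
        unfolding m_def by (rule bounded_measure)
      then have mL: "m / 2 < measure lebesgue S"
        using True Sl by (simp add: measure_restrict_space)
      have "{x \<in> S. ennreal \<tau> < ennreal \<bar>g x\<bar>} = {x \<in> S. \<tau> < \<bar>g x\<bar>}"
        using \<tau> by (auto simp: ennreal_less_iff)
      then have "ennreal \<tau> \<le> rearrangement S (\<lambda>x. ennreal \<bar>g x\<bar>) (m / 2)"
        using True em by (intro le_rearrangement Sl) (auto simp: ennreal_less_iff)
      then have "ennreal ((m / 2) powr (1 / p)) * ennreal \<tau> \<le> ennreal K"
        using K(2)[of "m / 2"] True mL by (meson half_gt_zero mult_left_mono order_trans zero_le)
      then have "(m / 2) powr (1 / p) * \<tau> \<le> K"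
        using \<tau> K(1) by (simp add: ennreal_mult[symmetric] ennreal_le_iff)
      then have "((m / 2) powr (1 / p)) powr p \<le> (K / \<tau>) powr p"
        using \<tau> p by (intro powr_mono2) (auto simp: field_simps)
      then have "m / 2 \<le> (K / \<tau>) powr p" using p True by (simp add: powr_powr)
      then show ?thesis using \<tau> K(1) by (simp add: powr_divide powr_minus_divide mult.commute)
    next
      case False
      then have "m \<le> 0" by simp
      also have "0 \<le> 2 * K powr p * \<tau> powr (- p)" by simp
      finally show ?thesis .
    qed
    then show ?thesis unfolding em by (rule ennreal_leI)
  qed
  then show ?thesis by (intro exI[of _ "2 * K powr p"]) auto
qed

lemma lorentz_imp_powr_integrable:
  fixes S :: "(real ^ 'n::finite) set" and g :: "real ^ 'n \<Rightarrow> real"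
  assumes S: "S \<in> lmeasurable" and L: "measure lebesgue S > 0" and q: "0 < q" "q < p"
    and g: "g \<in> lorentz_space p S"
  shows "(\<integral>\<^sup>+x. ennreal (\<bar>g x\<bar> powr q) \<partial>lebesgue_on S) < \<infinity>"
proof -
  interpret finite_measure "lebesgue_on S" by (rule finite_measure_lebesgue_on[OF S])
  have [measurable]: "g \<in> borel_measurable (lebesgue_on S)" using g by (simp add: lorentz_space_def)
  obtain C where "C \<ge> 0"
    "\<And>\<tau>. \<tau> > 0 \<Longrightarrow> emeasure (lebesgue_on S) {x \<in> S. \<tau> < \<bar>g x\<bar>} \<le> ennreal (C * \<tau> powr (- p))"
    using lorentz_imp_weak_type[OF S L _ g] q by auto
  then have "(\<integral>\<^sup>+x. ennreal (\<bar>g x\<bar> powr q) \<partial>lebesgue_on S) \<le>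
    emeasure (lebesgue_on S) (space (lebesgue_on S)) + ennreal (C * 2 powr q / (1 - 2 powr (q - p)))"
    using q by (intro weak_type_imp_nn_integral_powr_le) auto
  also have "\<dots> < \<infinity>" by (simp add: emeasure_eq_measure ennreal_add_less_top)
  finally show ?thesis .
qed

lemma lorentz_vector_imp_powr_integrable:
  fixes S :: "(real ^ 'n::finite) set" and U :: "real ^ 'n \<Rightarrow> real ^ 'n"
  assumes S: "S \<in> lmeasurable" and L: "measure lebesgue S > 0" and q: "0 < q" "q < p"
    and U: "\<And>i. (\<lambda>x. U x $ i) \<in> lorentz_space p S"
  shows "(\<integral>\<^sup>+x. ennreal (norm (U x) powr q) \<partial>lebesgue_on S) < \<infinity>"
proof -
  have m: "(\<lambda>x. U x $ i) \<in> borel_measurable (lebesgue_on S)" for i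
    using U[of i] unfolding lorentz_space_def by blast
  let ?n = "real CARD('n)"
  have "ennreal (norm (U x) powr q) \<le> ennreal (?n powr q) * (\<Sum>i\<in>UNIV. ennreal (\<bar>U x $ i\<bar> powr q))" for x
  proof -
    obtain j where j: "\<And>i. \<bar>U x $ i\<bar> \<le> \<bar>U x $ j\<bar>"
    proof -
      have "finite (range (\<lambda>i. \<bar>U x $ i\<bar>))" by simp
      then have "Max (range (\<lambda>i. \<bar>U x $ i\<bar>)) \<in> range (\<lambda>i. \<bar>U x $ i\<bar>)" by (intro Max_in) auto
      then obtain j where j: "Max (range (\<lambda>i. \<bar>U x $ i\<bar>)) = \<bar>U x $ j\<bar>" by (elim imageE)
      have "\<bar>U x $ i\<bar> \<le> Max (range (\<lambda>i. \<bar>U x $ i\<bar>))" for i by (intro Max_ge) auto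
      then show ?thesis unfolding j by (rule that)
    qed
    have "norm (U x) \<le> (\<Sum>i\<in>UNIV. \<bar>U x $ i\<bar>)" by (rule norm_le_l1_cart)
    also have "\<dots> \<le> ?n * \<bar>U x $ j\<bar>" using j by (intro sum_bounded_above)
    finally have "norm (U x) powr q \<le> (?n * \<bar>U x $ j\<bar>) powr q" using q by (intro powr_mono2) auto
    also have "\<dots> = ?n powr q * \<bar>U x $ j\<bar> powr q" by (simp add: powr_mult)
    also have "\<dots> \<le> ?n powr q * (\<Sum>i\<in>UNIV. \<bar>U x $ i\<bar> powr q)"
      by (intro mult_left_mono member_le_sum) auto
    finally show ?thesis
      by (simp add: ennreal_mult[symmetric] sum_nonneg ennreal_leI)
  qed
  then have "(\<integral>\<^sup>+x. ennreal (norm (U x) powr q) \<partial>lebesgue_on S) \<le>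
    (\<integral>\<^sup>+x. ennreal (?n powr q) * (\<Sum>i\<in>UNIV. ennreal (\<bar>U x $ i\<bar> powr q)) \<partial>lebesgue_on S)"
    by (intro nn_integral_mono)
  also have "\<dots> = ennreal (?n powr q) * (\<Sum>i\<in>UNIV. \<integral>\<^sup>+x. ennreal (\<bar>U x $ i\<bar> powr q) \<partial>lebesgue_on S)"
    using m by (simp add: nn_integral_cmult nn_integral_sum del: sum_ennreal)
  also have "\<dots> < \<infinity>"
    using lorentz_imp_powr_integrable[OF S L q U] by (auto simp: ennreal_mult_less_top)
  finally show ?thesis .
qed

section \<open>Riesz kernels with integrable weights\<close>

text \<open>The value at \<open>0\<close> is infinite, so that the product estimate below holds without exceptional points.\<close>

definition riesz_kernel :: "real \<Rightarrow> 'a::real_normed_vector \<Rightarrow> ennreal" where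
  "riesz_kernel \<beta> x = (if x = 0 then \<infinity> else ennreal (norm x powr - \<beta>))"

lemma riesz_kernel_measurable [measurable]:
  "riesz_kernel \<beta> \<in> borel_measurable (borel :: 'a::{real_normed_vector, second_countable_topology} measure)"
  unfolding riesz_kernel_def[abs_def] by measurable

lemma riesz_kernel_commute: "riesz_kernel \<beta> (x - y) = riesz_kernel \<beta> (y - x)"
  by (simp add: riesz_kernel_def norm_minus_commute)

lemma id_measurable_lebesgue_on [measurable]: "(\<lambda>x. x) \<in> lebesgue_on S \<rightarrow>\<^sub>M (borel :: 'a::euclidean_space measure)"
  by (simp add: measurable_completion measurable_restrict_space1)

lemma AE_lebesgue_on_neq:
  fixes z :: "'a::euclidean_space"
  assumes "S \<in> sets lebesgue"
  shows "AE x in lebesgue_on S. x \<noteq> z"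
proof -
  have "AE x in lebesgue. x \<notin> {z}" by (rule AE_not_in) simp
  then show ?thesis
    using assms by (auto simp: AE_restrict_space_iff elim: eventually_mono)
qed

lemma nn_integral_riesz_kernel_bounded:
  fixes S :: "'a::euclidean_space set" and \<tau> :: real
  assumes S: "S \<in> lmeasurable" and \<tau>: "0 < \<tau>" "\<tau> < DIM('a)"
  shows "\<exists>C\<ge>0. \<forall>z. (\<integral>\<^sup>+x. riesz_kernel \<tau> (x - z) \<partial>lebesgue_on S) \<le> ennreal C"
proof -
  have Sl: "S \<in> sets lebesgue" using S by auto
  interpret finite_measure "lebesgue_on S" by (rule finite_measure_lebesgue_on[OF S])
  let ?n = "real DIM('a)"
  define v where "v = unit_ball_vol ?n"
  have v: "v \<ge> 0" by (simp add: v_def)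
  define C where "C = v * 2 powr \<tau> / (1 - 2 powr (\<tau> - ?n))"
  have C: "C \<ge> 0" 
  proof -
    have "2 powr (\<tau> - ?n) < (1::real)" using \<tau> powr_less_mono[of "\<tau> - ?n" 0 "2::real"] by simp
    then show ?thesis using v by (simp add: C_def)
  qed
  have "(\<integral>\<^sup>+x. riesz_kernel \<tau> (x - z) \<partial>lebesgue_on S) \<le>
     ennreal (measure (lebesgue_on S) (space (lebesgue_on S)) + C)" for z
  proof -
    have "(\<integral>\<^sup>+x. riesz_kernel \<tau> (x - z) \<partial>lebesgue_on S) =
       (\<integral>\<^sup>+x. ennreal ((1 / norm (x - z)) powr \<tau>) \<partial>lebesgue_on S)"
      using AE_lebesgue_on_neq[OF Sl, of z]
      by (intro nn_integral_cong_AE) (auto simp: riesz_kernel_def powr_divide powr_minus_divide)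
    also have "\<dots> \<le> emeasure (lebesgue_on S) (space (lebesgue_on S)) + ennreal C"
      unfolding C_def
    proof (rule weak_type_imp_nn_integral_powr_le)
      fix t :: real assume t: "t > 0"
      have "{x \<in> space (lebesgue_on S). t < 1 / norm (x - z)} \<in> sets (lebesgue_on S)" by measurable
      then have "emeasure (lebesgue_on S) {x \<in> space (lebesgue_on S). t < 1 / norm (x - z)}
        = emeasure lebesgue {x \<in> S. t < 1 / norm (x - z)}"
        using Sl by (simp add: emeasure_restrict_space space_restrict_space)
      also have "\<dots> \<le> emeasure lebesgue (ball z (1 / t))"
      proof (intro emeasure_mono subsetI)
        fix x assume "x \<in> {x \<in> S. t < 1 / norm (x - z)}"
        then have *: "t < 1 / norm (x - z)" by simp
        with t have "norm (x - z) > 0" by (cases "x = z") auto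
        with * t show "x \<in> ball z (1 / t)" by (simp add: dist_norm norm_minus_commute field_simps)
      qed simp
      also have "\<dots> = ennreal (v * (1 / t) ^ DIM('a))"
        using t by (simp add: emeasure_ball v_def)
      also have "(1 / t) ^ DIM('a) = t powr (- ?n)"
        using t by (simp add: powr_minus_divide powr_realpow power_divide)
      finally show "emeasure (lebesgue_on S) {x \<in> space (lebesgue_on S). t < 1 / norm (x - z)}
         \<le> ennreal (v * t powr (- ?n))" .
    qed (use \<tau> v in auto)
    also have "\<dots> = ennreal (measure (lebesgue_on S) (space (lebesgue_on S)) + C)"
      using C by (simp add: emeasure_eq_measure)
    finally show ?thesis .
  qed
  then show ?thesis using C by (intro exI[of _ "measure (lebesgue_on S) (space (lebesgue_on S)) + C"]) auto
qed

lemma mult_le_powr_add_powr: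
  fixes a b s :: real
  assumes "a \<ge> 0" "b \<ge> 0" "s > 1"
  shows "a * b \<le> a powr s + b powr (s / (s - 1))"
proof -
  let ?s' = "s / (s - 1)"
  have s': "?s' > 1" using assms by (simp add: field_simps)
  have "1 / s + 1 / ?s' = 1" using assms by (simp add: field_simps)
  then have "a * b \<le> a powr s / s + b powr ?s' / ?s'"
    using Youngs_inequality[of s ?s' a b] assms s' by blast
  also have "a powr s / s \<le> a powr s / 1" using assms by (intro divide_left_mono) auto
  also have "b powr ?s' / ?s' \<le> b powr ?s' / 1" using s' by (intro divide_left_mono) auto
  finally show ?thesis by simp
qed

text \<open>Young's inequality with exponents \<open>s\<close> and \<open>s / (s - 1)\<close>, applied pointwise: the power of the kernel stays
  integrable because its exponent is still below the dimension.\<close>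

lemma nn_integral_mult_riesz_kernel_bounded:
  fixes S :: "'a::euclidean_space set" and g :: "'a \<Rightarrow> real"
  assumes S: "S \<in> lmeasurable" and g[measurable]: "g \<in> borel_measurable (lebesgue_on S)"
    and nn: "\<And>x. g x \<ge> 0" and s: "s > 1"
    and fin: "(\<integral>\<^sup>+x. ennreal (g x powr s) \<partial>lebesgue_on S) < \<infinity>"
    and \<beta>: "0 < \<beta>" "\<beta> * (s / (s - 1)) < DIM('a)"
  shows "\<exists>C\<ge>0. \<forall>z. (\<integral>\<^sup>+x. ennreal (g x) * riesz_kernel \<beta> (x - z) \<partial>lebesgue_on S) \<le> ennreal C"
proof -
  have Sl: "S \<in> sets lebesgue" using S by auto
  let ?s' = "s / (s - 1)"
  have s': "?s' > 1" using s by (simp add: field_simps)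
  obtain C where C: "C \<ge> 0" "\<And>z. (\<integral>\<^sup>+x. riesz_kernel (\<beta> * ?s') (x - z) \<partial>lebesgue_on S) \<le> ennreal C"
  proof -
    have "0 < \<beta> * ?s'" using \<beta>(1) s' by (intro mult_pos_pos) auto
    from nn_integral_riesz_kernel_bounded[OF S this \<beta>(2)] that show ?thesis by blast
  qed
  obtain B where B: "B \<ge> 0" "(\<integral>\<^sup>+x. ennreal (g x powr s) \<partial>lebesgue_on S) = ennreal B"
    using fin by (cases "\<integral>\<^sup>+x. ennreal (g x powr s) \<partial>lebesgue_on S") auto
  have "(\<integral>\<^sup>+x. ennreal (g x) * riesz_kernel \<beta> (x - z) \<partial>lebesgue_on S) \<le> ennreal (B + C)" for z
  proof -
    have "(\<integral>\<^sup>+x. ennreal (g x) * riesz_kernel \<beta> (x - z) \<partial>lebesgue_on S)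
      \<le> (\<integral>\<^sup>+x. ennreal (g x powr s) + riesz_kernel (\<beta> * ?s') (x - z) \<partial>lebesgue_on S)"
    proof (rule nn_integral_mono)
      fix x
      show "ennreal (g x) * riesz_kernel \<beta> (x - z) \<le> ennreal (g x powr s) + riesz_kernel (\<beta> * ?s') (x - z)"
      proof (cases "x = z")
        case False
        have "g x * norm (x - z) powr - \<beta> \<le> g x powr s + (norm (x - z) powr - \<beta>) powr ?s'"
          using nn s by (intro mult_le_powr_add_powr) auto
        also have "(norm (x - z) powr - \<beta>) powr ?s' = norm (x - z) powr - (\<beta> * ?s')"
          by (simp add: powr_powr)
        finally show ?thesis
          using False nn by (simp add: riesz_kernel_def ennreal_mult[symmetric] ennreal_plus[symmetric] ennreal_leI del: ennreal_plus)
      qed (simp add: riesz_kernel_def)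
    qed
    also have "\<dots> = ennreal B + (\<integral>\<^sup>+x. riesz_kernel (\<beta> * ?s') (x - z) \<partial>lebesgue_on S)"
      by (simp add: nn_integral_add B)
    also have "\<dots> \<le> ennreal B + ennreal C" by (intro add_left_mono C)
    finally show ?thesis using B C by simp
  qed
  then show ?thesis using B C by (intro exI[of _ "B + C"]) auto
qed

section \<open>Composition of kernels and the mollifier\<close>

text \<open>A power \<open>\<beta>'\<close> of the larger distance \<open>M\<close> is traded for the distance \<open>d \<le> 2 M\<close>, the rest of it for
  the smaller distance \<open>m\<close>.\<close>

lemma powr_product_le:
  fixes D d m M :: real
  assumes m: "0 < m" "m \<le> M" "m \<le> D" and d: "0 < d" "d \<le> 2 * M"
    and e: "0 \<le> \<beta>'" "\<beta>' \<le> s" "s + t - \<beta>' \<le> \<tau>"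
  shows "M powr - s * m powr - t \<le> 2 powr \<beta>' * D powr (\<tau> - (s + t - \<beta>')) * (d powr - \<beta>' * m powr - \<tau>)"
proof -
  have "M powr - s = M powr - \<beta>' * M powr - (s - \<beta>')"
    by (simp add: powr_add[symmetric])
  also have "\<dots> \<le> (d / 2) powr - \<beta>' * m powr - (s - \<beta>')"
    using assms by (intro mult_mono powr_mono2') auto
  also have "(d / 2) powr - \<beta>' = 2 powr \<beta>' * d powr - \<beta>'"
    using d by (simp add: powr_divide powr_minus_divide)
  finally have "M powr - s * m powr - t \<le> (2 powr \<beta>' * d powr - \<beta>' * m powr - (s - \<beta>')) * m powr - t"
    by (intro mult_right_mono) auto
  also have "\<dots> = 2 powr \<beta>' * d powr - \<beta>' * (m powr (\<tau> - (s + t - \<beta>')) * m powr - \<tau>)"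
    by (simp add: powr_add[symmetric] mult.assoc algebra_simps)
  also have "\<dots> \<le> 2 powr \<beta>' * d powr - \<beta>' * (D powr (\<tau> - (s + t - \<beta>')) * m powr - \<tau>)"
    using assms by (intro mult_left_mono mult_right_mono powr_mono2) auto
  finally show ?thesis by (simp add: mult_ac)
qed

lemma riesz_kernel_pos: "riesz_kernel \<beta> x > 0"
  by (simp add: riesz_kernel_def)

text \<open>Of the distances from \<open>x\<close> to \<open>y\<close> and to \<open>z\<close> the larger one is at least half the distance from \<open>y\<close> to
  \<open>z\<close>.  So part of the product can be replaced by a kernel in \<open>y - z\<close>; the remaining singularity is
  put on the smaller distance, and the sum on the right covers both cases.\<close>

lemma riesz_kernel_product_le:
  fixes D :: real
  assumes D: "0 < D" and e: "0 \<le> \<beta>'" "\<beta>' \<le> \<beta>" "\<beta> \<le> \<gamma>" "\<gamma> + \<beta> - \<beta>' \<le> \<tau>"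
  shows "\<exists>C>0. \<forall>x y z :: 'a::real_normed_vector. norm (x - y) \<le> D \<longrightarrow> norm (x - z) \<le> D \<longrightarrow>
    riesz_kernel \<gamma> (x - y) * riesz_kernel \<beta> (x - z)
    \<le> ennreal C * (riesz_kernel \<beta>' (y - z) * (riesz_kernel \<tau> (x - y) + riesz_kernel \<tau> (x - z)))"
proof -
  define C where "C = 2 powr \<beta>' * D powr (\<tau> - (\<gamma> + \<beta> - \<beta>'))"
  have C: "C > 0" using D by (simp add: C_def)
  have "riesz_kernel \<gamma> (x - y) * riesz_kernel \<beta> (x - z)
    \<le> ennreal C * (riesz_kernel \<beta>' (y - z) * (riesz_kernel \<tau> (x - y) + riesz_kernel \<tau> (x - z)))"
    if le: "norm (x - y) \<le> D" "norm (x - z) \<le> D" for x y z :: 'a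
  proof (cases "x = y \<or> x = z \<or> y = z")
    case True
    have top: "ennreal C * (riesz_kernel \<beta>' (y - z) * (riesz_kernel \<tau> (x - y) + riesz_kernel \<tau> (x - z))) = \<infinity>"
    proof (cases "y = z")
      case True
      then show ?thesis
        using C riesz_kernel_pos[of \<tau> "x - y"] by (simp add: riesz_kernel_def[of \<beta>'] ennreal_top_mult ennreal_mult_top)
    next
      case False
      with True have *: "riesz_kernel \<tau> (x - y) + riesz_kernel \<tau> (x - z) = \<infinity>"
        by (auto simp: riesz_kernel_def)
      show ?thesis
        unfolding * using C riesz_kernel_pos[of \<beta>' "y - z"] by (simp add: ennreal_mult_top)
    qed
    show ?thesis unfolding top by simp
  next
    case False
    define A B d where "A = norm (x - z)" and "B = norm (x - y)" and "d = norm (y - z)"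
    have pos: "A > 0" "B > 0" "d > 0" using False by (auto simp: A_def B_def d_def)
    have "d \<le> A + B"
      using norm_triangle_ineq[of "y - x" "x - z"] by (simp add: A_def B_def d_def norm_minus_commute)
    have "B powr - \<gamma> * A powr - \<beta> \<le> C * (d powr - \<beta>' * (B powr - \<tau> + A powr - \<tau>))"
    proof (cases "B \<le> A")
      case True
      have "A powr - \<beta> * B powr - \<gamma> \<le> 2 powr \<beta>' * D powr (\<tau> - (\<beta> + \<gamma> - \<beta>')) * (d powr - \<beta>' * B powr - \<tau>)"
        using True pos e le \<open>d \<le> A + B\<close> by (intro powr_product_le) (auto simp: B_def)
      also have "\<dots> = C * (d powr - \<beta>' * B powr - \<tau>)" by (simp add: C_def add.commute)
      also have "\<dots> \<le> C * (d powr - \<beta>' * (B powr - \<tau> + A powr - \<tau>))"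
        using C by (intro mult_left_mono) auto
      finally show ?thesis by (simp add: mult.commute)
    next
      case False
      have "B powr - \<gamma> * A powr - \<beta> \<le> 2 powr \<beta>' * D powr (\<tau> - (\<gamma> + \<beta> - \<beta>')) * (d powr - \<beta>' * A powr - \<tau>)"
        using False pos e le \<open>d \<le> A + B\<close> by (intro powr_product_le) (auto simp: A_def)
      also have "\<dots> = C * (d powr - \<beta>' * A powr - \<tau>)" by (simp add: C_def)
      also have "\<dots> \<le> C * (d powr - \<beta>' * (B powr - \<tau> + A powr - \<tau>))"
        using C by (intro mult_left_mono) auto
      finally show ?thesis .
    qed
    then have "ennreal (B powr - \<gamma> * A powr - \<beta>) \<le> ennreal (C * (d powr - \<beta>' * (B powr - \<tau> + A powr - \<tau>)))"
      by (rule ennreal_leI)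
    then show ?thesis
      using False C by (simp add: riesz_kernel_def A_def B_def d_def ennreal_mult)
  qed
  with C show ?thesis by blast
qed

text \<open>The negative Laplacian of the regularised Newton potential.  It is the rescaling by \<open>\<epsilon>\<close> of one integrable
  profile, hence an approximate identity up to a constant factor.\<close>

definition mollifier :: "real \<Rightarrow> 'a::euclidean_space \<Rightarrow> real" where
  "mollifier \<epsilon> x = real DIM('a) * \<epsilon>\<^sup>2 * (x \<bullet> x + \<epsilon>\<^sup>2) powr (- (real DIM('a) / 2) - 1)"

lemma mollifier_nonneg: "mollifier \<epsilon> x \<ge> 0"
  by (simp add: mollifier_def)

lemma mollifier_commute: "mollifier \<epsilon> (x - y) = mollifier \<epsilon> (y - x)"
proof -
  have "(x - y) \<bullet> (x - y) = (y - x) \<bullet> (y - x)" by (simp add: inner_diff algebra_simps)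
  then show ?thesis by (simp add: mollifier_def)
qed

lemma mollifier_measurable [measurable]: "mollifier \<epsilon> \<in> borel_measurable borel"
  unfolding mollifier_def[abs_def] by measurable

lemma mollifier_ge:
  fixes x :: "'a::euclidean_space"
  assumes "\<epsilon> > 0" "norm x < \<epsilon>"
  shows "mollifier \<epsilon> x \<ge> real DIM('a) * 2 powr (- (real DIM('a) / 2) - 1) * (1 / \<epsilon>) ^ DIM('a)"
proof -
  let ?n = "real DIM('a)"
  have "x \<bullet> x < \<epsilon>\<^sup>2" using assms by (simp add: power2_norm_eq_inner[symmetric] power_strict_mono)
  then have "(2 * \<epsilon>\<^sup>2) powr (- (?n / 2) - 1) \<le> (x \<bullet> x + \<epsilon>\<^sup>2) powr (- (?n / 2) - 1)"
    using assms by (intro powr_mono2') (auto simp: add_nonneg_pos)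
  moreover have "(2 * \<epsilon>\<^sup>2) powr (- (?n / 2) - 1) = 2 powr (- (?n / 2) - 1) * (1 / \<epsilon>) ^ DIM('a) / \<epsilon>\<^sup>2"
  proof -
    have "(\<epsilon>\<^sup>2) powr (- (?n / 2) - 1) = \<epsilon> powr (- ?n - 2)"
      using assms by (simp add: powr_powr flip: powr_numeral)
    also have "\<dots> = (1 / \<epsilon>) ^ DIM('a) / \<epsilon>\<^sup>2"
      using assms by (simp add: powr_diff powr_minus_divide powr_realpow power_divide)
    finally show ?thesis using assms by (simp add: powr_mult)
  qed
  ultimately have "?n * \<epsilon>\<^sup>2 * (2 powr (- (?n / 2) - 1) * (1 / \<epsilon>) ^ DIM('a) / \<epsilon>\<^sup>2) \<le> mollifier \<epsilon> x"
    unfolding mollifier_def by (intro mult_left_mono) auto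
  then show ?thesis using assms by simp
qed

lemma mollifier_le:
  fixes x :: "'a::euclidean_space"
  assumes "\<epsilon> > 0" "\<delta> > 0" "\<delta> \<le> norm x \<or> \<delta> \<le> \<epsilon>"
  shows "mollifier \<epsilon> x \<le> real DIM('a) * \<epsilon>\<^sup>2 * (1 / \<delta>) ^ (DIM('a) + 2)"
proof -
  let ?n = "real DIM('a)"
  have "\<delta>\<^sup>2 \<le> x \<bullet> x + \<epsilon>\<^sup>2"
  proof -
    have "\<delta>\<^sup>2 \<le> (norm x)\<^sup>2 \<or> \<delta>\<^sup>2 \<le> \<epsilon>\<^sup>2" using assms by (auto intro: power_mono)
    then show ?thesis
      by (auto simp: power2_norm_eq_inner intro: add_increasing add_increasing2)
  qed
  then have "(x \<bullet> x + \<epsilon>\<^sup>2) powr (- (?n / 2) - 1) \<le> (\<delta>\<^sup>2) powr (- (?n / 2) - 1)"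
    using assms by (intro powr_mono2') auto
  also have "(\<delta>\<^sup>2) powr (- (?n / 2) - 1) = \<delta> powr (- (?n + 2))"
    using assms by (simp add: powr_powr flip: powr_numeral)
  also have "\<dots> = 1 / (\<delta> powr real (DIM('a) + 2))"
    by (simp only: powr_minus_divide) (simp add: add.commute)
  also have "\<dots> = (1 / \<delta>) ^ (DIM('a) + 2)"
    using assms by (subst powr_realpow) (simp_all add: power_divide)
  finally show ?thesis
    unfolding mollifier_def by (intro mult_left_mono) auto
qed

text \<open>Dyadic annuli: at distance \<open>2 ^ k * \<epsilon>\<close> the mollifier is smaller than at the centre by a factor
  \<open>2 ^ (k * (n + 2))\<close>, up to a constant, while the volume grows only by the factor \<open>2 ^ (k * n)\<close>.\<close>

lemma mollifier_integral_le:
  fixes S :: "'a::euclidean_space set"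
  assumes S: "S \<in> sets lebesgue"
  shows "\<exists>C>0. \<forall>\<epsilon>>0. \<forall>y. (\<integral>\<^sup>+x. ennreal (mollifier \<epsilon> (x - y)) \<partial>lebesgue_on S) \<le> ennreal C"
proof -
  let ?n = "DIM('a)"
  define v where "v = unit_ball_vol (real ?n)"
  have v: "v > 0" by (simp add: v_def)
  define C where "C = real ?n * 2 ^ (?n + 2) * v * (4 / 3)"
  have C: "C > 0" using v by (simp add: C_def)
  have "(\<integral>\<^sup>+x. ennreal (mollifier \<epsilon> (x - y)) \<partial>lebesgue_on S) \<le> ennreal C" if \<epsilon>: "\<epsilon> > 0" for \<epsilon> and y :: 'a
  proof -
    define c where "c k = real ?n * \<epsilon>\<^sup>2 * (2 / (2 ^ k * \<epsilon>)) ^ (?n + 2)" for k :: nat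
    let ?t = "\<lambda>k x. ennreal (c k) * indicator (ball y (2 ^ k * \<epsilon>)) x"
    have pt: "ennreal (mollifier \<epsilon> (x - y)) \<le> (\<Sum>k. ?t k x)" for x
    proof -
      have ex: "\<exists>k::nat. norm (x - y) < 2 ^ k * \<epsilon>"
      proof -
        obtain k :: nat where "norm (x - y) / \<epsilon> < 2 ^ k" using real_arch_pow[of 2] by auto
        then show ?thesis using \<epsilon> by (auto simp: field_simps)
      qed
      define k where "k = (LEAST k::nat. norm (x - y) < 2 ^ k * \<epsilon>)"
      have k: "norm (x - y) < 2 ^ k * \<epsilon>" unfolding k_def by (rule LeastI_ex[OF ex])
      have "2 ^ k * \<epsilon> / 2 \<le> norm (x - y) \<or> 2 ^ k * \<epsilon> / 2 \<le> \<epsilon>"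
      proof (cases k)
        case 0 then show ?thesis using \<epsilon> by simp
      next
        case (Suc j)
        then have "j < (LEAST k::nat. norm (x - y) < 2 ^ k * \<epsilon>)" by (simp add: k_def)
        from not_less_Least[OF this] show ?thesis using Suc by simp
      qed
      then have "mollifier \<epsilon> (x - y) \<le> real ?n * \<epsilon>\<^sup>2 * (1 / (2 ^ k * \<epsilon> / 2)) ^ (?n + 2)"
        using \<epsilon> by (intro mollifier_le) auto
      then have "mollifier \<epsilon> (x - y) \<le> c k" by (simp add: c_def)
      then have "ennreal (mollifier \<epsilon> (x - y)) \<le> ?t k x"
        using k by (simp add: dist_norm norm_minus_commute ennreal_leI)
      also have "\<dots> = (\<Sum>k\<in>{k}. ?t k x)" by (subst sum.insert) simp_all
      also have "\<dots> \<le> (\<Sum>k. ?t k x)" by (rule sum_le_suminf) auto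
      finally show ?thesis .
    qed
    have "(\<integral>\<^sup>+x. ennreal (mollifier \<epsilon> (x - y)) \<partial>lebesgue_on S) \<le> (\<integral>\<^sup>+x. ennreal (mollifier \<epsilon> (x - y)) \<partial>lebesgue)"
      using S by (simp add: nn_integral_restrict_space indicator_def) (intro nn_integral_mono, auto)
    also have "\<dots> \<le> (\<integral>\<^sup>+x. (\<Sum>k. ?t k x) \<partial>lebesgue)"
      by (intro nn_integral_mono pt)
    also have "\<dots> = (\<Sum>k. ennreal (c k) * emeasure lebesgue (ball y (2 ^ k * \<epsilon>)))"
      by (subst nn_integral_suminf)
        (auto simp: nn_integral_cmult_indicator intro!: borel_measurable_times_ennreal borel_measurable_indicator)
    also have "\<dots> = (\<Sum>k. ennreal (real ?n * 2 ^ (?n + 2) * v * (1 / 4) ^ k))"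
    proof (rule arg_cong[where f=suminf], rule ext)
      fix k :: nat
      have "ennreal (c k) * emeasure lebesgue (ball y (2 ^ k * \<epsilon>)) = ennreal (c k * (v * (2 ^ k * \<epsilon>) ^ ?n))"
      proof -
        have "emeasure lebesgue (ball y (2 ^ k * \<epsilon>)) = ennreal (v * (2 ^ k * \<epsilon>) ^ ?n)"
          using \<epsilon> by (simp add: emeasure_ball v_def)
        moreover have "c k \<ge> 0" using \<epsilon> unfolding c_def by (intro mult_nonneg_nonneg zero_le_power) auto
        ultimately show ?thesis by (simp only: ennreal_mult')
      qed
      also have "c k * (v * (2 ^ k * \<epsilon>) ^ ?n) = real ?n * 2 ^ (?n + 2) * v * (1 / 4) ^ k"
      proof -
        define w where "w = 2 ^ k * \<epsilon>"
        have w: "w > 0" using \<epsilon> by (simp add: w_def)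
        have "c k * (v * w ^ ?n) = real ?n * 2 ^ (?n + 2) * v * (\<epsilon> / w)\<^sup>2"
        proof -
          have "c k = real ?n * \<epsilon>\<^sup>2 * (2 / w) ^ (?n + 2)" by (simp only: c_def w_def)
          then show ?thesis using w by (simp add: power_divide power_add power2_eq_square field_simps)
        qed
        also have "(\<epsilon> / w)\<^sup>2 = (1 / 4) ^ k"
          using \<epsilon> by (simp add: w_def power_divide power_mult[symmetric] mult.commute[of k 2]) (simp add: power_mult)
        finally show ?thesis by (simp add: w_def)
      qed
      finally show "ennreal (c k) * emeasure lebesgue (ball y (2 ^ k * \<epsilon>)) =
         ennreal (real ?n * 2 ^ (?n + 2) * v * (1 / 4) ^ k)" .
    qed
    also have "\<dots> = ennreal C"
    proof (rule suminf_ennreal_eq)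
      have "(\<lambda>k. real ?n * 2 ^ (?n + 2) * v * (1 / 4) ^ k) sums (real ?n * 2 ^ (?n + 2) * v * (1 / (1 - 1 / 4)))"
        by (intro sums_mult geometric_sums) auto
      then show "(\<lambda>k. real ?n * 2 ^ (?n + 2) * v * (1 / 4) ^ k) sums C" by (simp add: C_def)
    qed (use v in auto)
    finally show ?thesis .
  qed
  with C show ?thesis by blast
qed

lemma mollifier_integral_ge:
  "\<exists>c>0. \<forall>S \<epsilon>. \<forall>y :: 'a::euclidean_space. S \<in> sets lebesgue \<longrightarrow> \<epsilon> > 0 \<longrightarrow> ball y \<epsilon> \<subseteq> S \<longrightarrow>
    ennreal c \<le> (\<integral>\<^sup>+x. ennreal (mollifier \<epsilon> (x - y)) \<partial>lebesgue_on S)"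
proof -
  let ?n = "DIM('a)"
  define v where "v = unit_ball_vol (real ?n)"
  have v: "v > 0" by (simp add: v_def)
  define b where "b = real ?n * 2 powr (- (real ?n / 2) - 1)"
  have b: "b > 0" by (simp add: b_def)
  have "ennreal (b * v) \<le> (\<integral>\<^sup>+x. ennreal (mollifier \<epsilon> (x - y)) \<partial>lebesgue_on S)"
    if S: "S \<in> sets lebesgue" "\<epsilon> > 0" "ball y \<epsilon> \<subseteq> S" for S \<epsilon> and y :: 'a
  proof -
    have "ennreal (b * v) = ennreal (b * (1 / \<epsilon>) ^ ?n) * emeasure lebesgue (ball y \<epsilon>)"
      using S(2) v b by (simp add: emeasure_ball v_def[symmetric] ennreal_mult[symmetric] power_divide)
    also have "\<dots> = (\<integral>\<^sup>+x. ennreal (b * (1 / \<epsilon>) ^ ?n) * indicator (ball y \<epsilon>) x \<partial>lebesgue)"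
      by (simp add: nn_integral_cmult_indicator)
    also have "\<dots> \<le> (\<integral>\<^sup>+x. ennreal (mollifier \<epsilon> (x - y)) * indicator S x \<partial>lebesgue)"
      using S mollifier_ge[OF S(2)]
      by (intro nn_integral_mono) (auto simp: indicator_def b_def dist_norm norm_minus_commute intro!: ennreal_leI)
    also have "\<dots> = (\<integral>\<^sup>+x. ennreal (mollifier \<epsilon> (x - y)) \<partial>lebesgue_on S)"
      using S(1) by (simp add: nn_integral_restrict_space)
    finally show ?thesis .
  qed
  with b v show ?thesis by (intro exI[of _ "b * v"]) auto
qed

section \<open>Convergence of the mollification\<close>

text \<open>A measurable function is almost everywhere the limit of continuous functions; truncation at a fixed
  level turns this into convergence in the mean by dominated convergence.\<close>

lemma L1_approx_continuous:
  fixes f :: "'a::euclidean_space \<Rightarrow> real"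
  assumes S: "S \<in> lmeasurable" and f: "integrable (lebesgue_on S) f" and e: "e > 0"
  shows "\<exists>g. continuous_on UNIV g \<and> (\<integral>\<^sup>+x. ennreal \<bar>f x - g x\<bar> \<partial>lebesgue_on S) < ennreal e"
proof -
  have Sl: "S \<in> sets lebesgue" using S by auto
  interpret finite_measure "lebesgue_on S" by (rule finite_measure_lebesgue_on[OF S])
  let ?M = "lebesgue_on S"
  have fm[measurable]: "f \<in> borel_measurable ?M" using f by (rule borel_measurable_integrable)
  define clamp where "clamp k t = max (- real k) (min (real k) t)" for k and t :: real
  have clamp_m[measurable]: "clamp k \<in> borel_measurable borel" for k
    unfolding clamp_def[abs_def] by measurable
  have clamp_c: "isCont (clamp k) t" for k t
    unfolding clamp_def[abs_def] by (intro continuous_intros)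
  have "(\<lambda>k. LINT x|?M. \<bar>f x - clamp k (f x)\<bar>) \<longlonglongrightarrow> (LINT x|?M. 0)"
  proof (rule integral_dominated_convergence)
    show "integrable ?M (\<lambda>x. \<bar>f x\<bar>)" using f by simp
    show "AE x in ?M. (\<lambda>k. \<bar>f x - clamp k (f x)\<bar>) \<longlonglongrightarrow> 0"
    proof (rule AE_I2)
      fix x
      obtain K :: nat where K: "\<bar>f x\<bar> \<le> real K" using real_arch_simple by blast
      have "\<bar>f x - clamp k (f x)\<bar> = 0" if "k \<ge> K" for k
        using K that by (auto simp: clamp_def)
      then show "(\<lambda>k. \<bar>f x - clamp k (f x)\<bar>) \<longlonglongrightarrow> 0"
        by (intro tendsto_eventually) (auto simp: eventually_sequentially)
    qed
    show "AE x in ?M. norm \<bar>f x - clamp k (f x)\<bar> \<le> \<bar>f x\<bar>" for k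
      by (rule AE_I2) (auto simp: clamp_def)
  qed (auto)
  then have "\<forall>\<^sub>F k in sequentially. (LINT x|?M. \<bar>f x - clamp k (f x)\<bar>) < e / 2"
    using e by (intro order_tendstoD(2)) auto
  then obtain k where k: "(LINT x|?M. \<bar>f x - clamp k (f x)\<bar>) < e / 2"
    by (auto simp: eventually_sequentially)
  have "(\<lambda>x. if x \<in> S then f x else 0) \<in> borel_measurable lebesgue"
    using fm Sl by (simp add: borel_measurable_if)
  from lebesgue_measurable_imp_measurable_on[OF this, of UNIV]
  obtain N g where N: "negligible N" and g: "\<And>n. continuous_on UNIV (g n)"
    and lim: "\<And>x. x \<notin> N \<Longrightarrow> (\<lambda>n. g n x) \<longlonglongrightarrow> (if x \<in> S then f x else 0)"
    unfolding measurable_on_def by (auto simp: fun_eq_iff)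
  have g_m[measurable]: "g n \<in> borel_measurable ?M" for n
    using measurable_compose[OF id_measurable_lebesgue_on borel_measurable_continuous_onI[OF g]] by simp
  have clamp_int: "integrable ?M (\<lambda>x. clamp k (h x))" if [measurable]: "h \<in> borel_measurable ?M" for h
    by (rule integrable_const_bound[of _ "real k"]) (auto simp: clamp_def)
  have "(\<lambda>n. LINT x|?M. \<bar>clamp k (f x) - clamp k (g n x)\<bar>) \<longlonglongrightarrow> (LINT x|?M. 0)"
  proof (rule integral_dominated_convergence)
    show "integrable ?M (\<lambda>x. 2 * real k)" by simp
    have "AE x in lebesgue. x \<notin> N" using N by (intro AE_not_in) (simp add: negligible_iff_null_sets)
    then have "AE x in ?M. x \<notin> N" using Sl by (auto simp: AE_restrict_space_iff elim: eventually_mono)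
    then show "AE x in ?M. (\<lambda>n. \<bar>clamp k (f x) - clamp k (g n x)\<bar>) \<longlonglongrightarrow> 0"
      using AE_space
    proof eventually_elim
      case (elim x)
      then have "(\<lambda>n. g n x) \<longlonglongrightarrow> f x" using lim[of x] Sl by (simp add: space_restrict_space)
      then have "(\<lambda>n. clamp k (g n x)) \<longlonglongrightarrow> clamp k (f x)" by (rule isCont_tendsto_compose[OF clamp_c])
      then have "(\<lambda>n. \<bar>clamp k (f x) - clamp k (g n x)\<bar>) \<longlonglongrightarrow> \<bar>clamp k (f x) - clamp k (f x)\<bar>"
        by (intro tendsto_intros)
      then show ?case by simp
    qed
    show "AE x in ?M. norm \<bar>clamp k (f x) - clamp k (g n x)\<bar> \<le> 2 * real k" for n
      by (rule AE_I2) (auto simp: clamp_def)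
  qed auto
  then have "\<forall>\<^sub>F n in sequentially. (LINT x|?M. \<bar>clamp k (f x) - clamp k (g n x)\<bar>) < e / 2"
    using e by (intro order_tendstoD(2)) auto
  then obtain n where n: "(LINT x|?M. \<bar>clamp k (f x) - clamp k (g n x)\<bar>) < e / 2"
    by (auto simp: eventually_sequentially)
  define h where "h x = clamp k (g n x)" for x
  have h: "continuous_on UNIV h"
    unfolding h_def[abs_def] clamp_def using g by (intro continuous_intros) auto
  have i1: "integrable ?M (\<lambda>x. \<bar>f x - clamp k (f x)\<bar>)" "integrable ?M (\<lambda>x. \<bar>clamp k (f x) - h x\<bar>)"
    using f clamp_int[of f] clamp_int[of "g n"] by (auto simp: h_def)
  have "(\<integral>\<^sup>+x. ennreal \<bar>f x - h x\<bar> \<partial>?M) \<le>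
     (\<integral>\<^sup>+x. ennreal (\<bar>f x - clamp k (f x)\<bar> + \<bar>clamp k (f x) - h x\<bar>) \<partial>?M)"
    by (intro nn_integral_mono ennreal_leI) auto
  also have "\<dots> = ennreal (LINT x|?M. \<bar>f x - clamp k (f x)\<bar> + \<bar>clamp k (f x) - h x\<bar>)"
    using i1 by (intro nn_integral_eq_integral) auto
  also have "\<dots> = ennreal ((LINT x|?M. \<bar>f x - clamp k (f x)\<bar>) + (LINT x|?M. \<bar>clamp k (f x) - h x\<bar>))"
    using i1 by simp
  also have "\<dots> < ennreal e"
    using k n e by (intro ennreal_lessI) (auto simp: h_def)
  finally show ?thesis using h by blast
qed

lemma fst_measurable_lebesgue_on_pair [measurable]:
  "fst \<in> lebesgue_on S \<Otimes>\<^sub>M M \<rightarrow>\<^sub>M (borel :: 'a::euclidean_space measure)"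
  using measurable_compose[OF measurable_fst id_measurable_lebesgue_on] by simp

lemma snd_measurable_lebesgue_on_pair [measurable]:
  "snd \<in> M \<Otimes>\<^sub>M lebesgue_on S \<rightarrow>\<^sub>M (borel :: 'a::euclidean_space measure)"
  using measurable_compose[OF measurable_snd id_measurable_lebesgue_on] by simp

text \<open>For a continuous function the claim follows from uniform continuity and from the smallness of the
  mollifier away from the origin.  The error made by replacing \<open>f\<close> by a continuous function is controlled
  by the uniform bound on the integral of the mollifier.\<close>

lemma mollifier_approximate_identity:
  fixes f :: "'a::euclidean_space \<Rightarrow> real"
  assumes S: "S \<in> lmeasurable" and b: "bounded S" and f: "integrable (lebesgue_on S) f" and e: "e > 0"
  shows "\<exists>\<epsilon>0>0. \<forall>\<epsilon>. 0 < \<epsilon> \<longrightarrow> \<epsilon> < \<epsilon>0 \<longrightarrow>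
    (\<integral>\<^sup>+y. (\<integral>\<^sup>+x. ennreal \<bar>f x - f y\<bar> * ennreal (mollifier \<epsilon> (x - y)) \<partial>lebesgue_on S) \<partial>lebesgue_on S) \<le> ennreal e"
proof -
  have Sl: "S \<in> sets lebesgue" using S by auto
  interpret finite_measure "lebesgue_on S" by (rule finite_measure_lebesgue_on[OF S])
  interpret P: pair_sigma_finite "lebesgue_on S" "lebesgue_on S" ..
  let ?M = "lebesgue_on S" and ?n = "DIM('a)"
  have [measurable]: "f \<in> borel_measurable ?M" using f by (rule borel_measurable_integrable)
  define \<mu> where "\<mu> = measure ?M (space ?M)"
  have \<mu>: "emeasure ?M (space ?M) = ennreal \<mu>" "\<mu> \<ge> 0" by (simp_all add: \<mu>_def emeasure_eq_measure)
  obtain C where C: "C > 0" "\<And>\<epsilon> y. \<epsilon> > 0 \<Longrightarrow> (\<integral>\<^sup>+x. ennreal (mollifier \<epsilon> (x - y)) \<partial>?M) \<le> ennreal C"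
    using mollifier_integral_le[OF Sl] by blast
  \<comment> \<open>Two error terms, each of size at most \<open>C * e1\<close>, come from the approximation of \<open>f\<close>.\<close>
  define e1 where "e1 = e / (8 * C)"
  have e1: "e1 > 0" using e C by (simp add: e1_def)
  obtain g where g: "continuous_on UNIV g" and fg: "(\<integral>\<^sup>+x. ennreal \<bar>f x - g x\<bar> \<partial>?M) < ennreal e1"
    using L1_approx_continuous[OF S f e1] by blast
  have gm0[measurable]: "g \<in> borel_measurable borel" using g by (rule borel_measurable_continuous_onI)
  have gm[measurable]: "g \<in> borel_measurable ?M"
    using measurable_compose[OF id_measurable_lebesgue_on gm0] by simp
  have K: "compact (closure S)" using b by (simp add: compact_closure)
  have gK: "continuous_on (closure S) g" using g continuous_on_subset by blast
  obtain G where G: "G > 0" "\<And>x. x \<in> S \<Longrightarrow> \<bar>g x\<bar> \<le> G"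
  proof -
    have "bounded (g ` closure S)" using gK K by (intro compact_imp_bounded compact_continuous_image)
    then obtain G where "G > 0" "\<forall>y\<in>g ` closure S. norm y \<le> G" by (auto simp: bounded_pos)
    then show ?thesis using closure_subset[of S] by (intro that[of G]) auto
  qed
  define \<omega> where "\<omega> = e / (4 * (C * \<mu> + 1))"
  have \<omega>: "\<omega> > 0" using e C \<mu> by (simp add: \<omega>_def add_nonneg_pos)
  obtain \<delta> where \<delta>: "\<delta> > 0" "\<And>x y. x \<in> S \<Longrightarrow> y \<in> S \<Longrightarrow> dist x y < \<delta> \<Longrightarrow> \<bar>g x - g y\<bar> < \<omega>"
  proof -
    have "uniformly_continuous_on (closure S) g" by (rule compact_uniformly_continuous[OF gK K])
    then obtain \<delta> where "\<delta> > 0" "\<forall>x\<in>closure S. \<forall>y\<in>closure S. dist y x < \<delta> \<longrightarrow> dist (g y) (g x) < \<omega>"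
      unfolding uniformly_continuous_on_def using \<omega> by meson
    then show ?thesis using closure_subset[of S] by (intro that[of \<delta>]) (auto simp: dist_real_def)
  qed
  define L where "L = 2 * G * (real ?n * (1 / \<delta>) ^ (?n + 2))"
  have L: "L > 0" using G \<delta> by (simp add: L_def)
  define \<epsilon>0 where "\<epsilon>0 = min 1 (e / (4 * (L * \<mu> * \<mu> + 1)))"
  have \<epsilon>0: "\<epsilon>0 > 0" using e L \<mu> by (simp add: \<epsilon>0_def add_nonneg_pos)
  have "(\<integral>\<^sup>+y. (\<integral>\<^sup>+x. ennreal \<bar>f x - f y\<bar> * ennreal (mollifier \<epsilon> (x - y)) \<partial>?M) \<partial>?M) \<le> ennreal e"
    if \<epsilon>: "0 < \<epsilon>" "\<epsilon> < \<epsilon>0" for \<epsilon>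
  proof -
    let ?m = "\<lambda>x y. ennreal (mollifier \<epsilon> (x - y))"
    let ?d = "\<lambda>x. ennreal \<bar>f x - g x\<bar>"
    have pt: "ennreal \<bar>f x - f y\<bar> * ?m x y \<le> ?d x * ?m x y + ?d y * ?m x y + (ennreal \<omega> * ?m x y + ennreal (L * \<epsilon>\<^sup>2))"
      if "x \<in> space ?M" "y \<in> space ?M" for x y
    proof -
      have xy: "x \<in> S" "y \<in> S" using that Sl by (auto simp: space_restrict_space)
      have "\<bar>g x - g y\<bar> * mollifier \<epsilon> (x - y) \<le> \<omega> * mollifier \<epsilon> (x - y) + L * \<epsilon>\<^sup>2"
      proof (cases "dist x y < \<delta>")
        case True
        then have "\<bar>g x - g y\<bar> * mollifier \<epsilon> (x - y) \<le> \<omega> * mollifier \<epsilon> (x - y)"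
          using \<delta>(2)[OF xy] by (intro mult_right_mono) (auto simp: mollifier_nonneg)
        then show ?thesis using L by (simp add: add_increasing2)
      next
        case False
        have "\<bar>g x - g y\<bar> \<le> 2 * G" using G(2)[OF xy(1)] G(2)[OF xy(2)] by linarith
        moreover have "mollifier \<epsilon> (x - y) \<le> real ?n * \<epsilon>\<^sup>2 * (1 / \<delta>) ^ (?n + 2)"
          using False \<epsilon> \<delta> by (intro mollifier_le) (auto simp: dist_norm)
        ultimately have "\<bar>g x - g y\<bar> * mollifier \<epsilon> (x - y) \<le> (2 * G) * (real ?n * \<epsilon>\<^sup>2 * (1 / \<delta>) ^ (?n + 2))"
          using G by (intro mult_mono) (auto simp: mollifier_nonneg)
        also have "\<dots> = L * \<epsilon>\<^sup>2" by (simp add: L_def)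
        finally show ?thesis using \<omega> mollifier_nonneg[of \<epsilon> "x - y"] by (simp add: add_increasing)
      qed
      moreover have "\<bar>f x - f y\<bar> * mollifier \<epsilon> (x - y) \<le>
        (\<bar>f x - g x\<bar> + \<bar>f y - g y\<bar> + \<bar>g x - g y\<bar>) * mollifier \<epsilon> (x - y)"
        by (intro mult_right_mono) (auto simp: mollifier_nonneg)
      ultimately have "\<bar>f x - f y\<bar> * mollifier \<epsilon> (x - y) \<le> \<bar>f x - g x\<bar> * mollifier \<epsilon> (x - y)
        + \<bar>f y - g y\<bar> * mollifier \<epsilon> (x - y) + (\<omega> * mollifier \<epsilon> (x - y) + L * \<epsilon>\<^sup>2)"
        by (simp add: algebra_simps)
      then show ?thesis
        using \<omega> L by (simp add: mollifier_nonneg ennreal_mult[symmetric] ennreal_plus[symmetric] ennreal_leI del: ennreal_plus)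
    qed
    have "(\<integral>\<^sup>+y. (\<integral>\<^sup>+x. ennreal \<bar>f x - f y\<bar> * ?m x y \<partial>?M) \<partial>?M) \<le>
      (\<integral>\<^sup>+y. (\<integral>\<^sup>+x. ?d x * ?m x y + ?d y * ?m x y + (ennreal \<omega> * ?m x y + ennreal (L * \<epsilon>\<^sup>2)) \<partial>?M) \<partial>?M)"
      by (intro nn_integral_mono pt)
    also have "\<dots> = (\<integral>\<^sup>+y. (\<integral>\<^sup>+x. ?d x * ?m x y \<partial>?M) \<partial>?M) + (\<integral>\<^sup>+y. (\<integral>\<^sup>+x. ?d y * ?m x y \<partial>?M) \<partial>?M)
      + ((\<integral>\<^sup>+y. (\<integral>\<^sup>+x. ennreal \<omega> * ?m x y \<partial>?M) \<partial>?M) + (\<integral>\<^sup>+y. (\<integral>\<^sup>+x. ennreal (L * \<epsilon>\<^sup>2) \<partial>?M) \<partial>?M))"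
      by (simp add: nn_integral_add)
    also have "\<dots> \<le> ennreal (C * e1) + ennreal (C * e1) + (ennreal (\<omega> * C * \<mu>) + ennreal (L * \<epsilon>\<^sup>2 * \<mu> * \<mu>))"
    proof (intro add_mono)
      have *: "(\<integral>\<^sup>+y. ?d y * (\<integral>\<^sup>+x. ?m x y \<partial>?M) \<partial>?M) \<le> ennreal (C * e1)"
      proof -
        have "(\<integral>\<^sup>+y. ?d y * (\<integral>\<^sup>+x. ?m x y \<partial>?M) \<partial>?M) \<le> (\<integral>\<^sup>+y. ?d y * ennreal C \<partial>?M)"
          using C \<epsilon> by (intro nn_integral_mono mult_left_mono) auto
        also have "\<dots> = (\<integral>\<^sup>+y. ?d y \<partial>?M) * ennreal C" by (simp add: nn_integral_multc)
        also have "\<dots> \<le> ennreal e1 * ennreal C" using fg by (intro mult_right_mono) auto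
        finally show ?thesis using e1 C by (simp add: ennreal_mult mult.commute)
      qed
      show "(\<integral>\<^sup>+y. (\<integral>\<^sup>+x. ?d y * ?m x y \<partial>?M) \<partial>?M) \<le> ennreal (C * e1)"
        using * by (simp add: nn_integral_cmult)
      have "(\<integral>\<^sup>+y. (\<integral>\<^sup>+x. ?d x * ?m x y \<partial>?M) \<partial>?M) = (\<integral>\<^sup>+x. (\<integral>\<^sup>+y. ?d x * ?m x y \<partial>?M) \<partial>?M)"
        by (rule P.Fubini') measurable
      also have "\<dots> = (\<integral>\<^sup>+x. (\<integral>\<^sup>+y. ?d x * ?m y x \<partial>?M) \<partial>?M)"
        by (subst mollifier_commute) (rule refl)
      also have "\<dots> \<le> ennreal (C * e1)" using * by (simp add: nn_integral_cmult)
      finally show "(\<integral>\<^sup>+y. (\<integral>\<^sup>+x. ?d x * ?m x y \<partial>?M) \<partial>?M) \<le> ennreal (C * e1)" .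
      have "(\<integral>\<^sup>+y. (\<integral>\<^sup>+x. ennreal \<omega> * ?m x y \<partial>?M) \<partial>?M) = (\<integral>\<^sup>+y. ennreal \<omega> * (\<integral>\<^sup>+x. ?m x y \<partial>?M) \<partial>?M)"
        by (simp add: nn_integral_cmult)
      also have "\<dots> \<le> (\<integral>\<^sup>+y. ennreal \<omega> * ennreal C \<partial>?M)"
        using C \<epsilon> by (intro nn_integral_mono mult_left_mono) auto
      also have "\<dots> = ennreal (\<omega> * C * \<mu>)" using \<omega> C \<mu> by (simp add: ennreal_mult)
      finally show "(\<integral>\<^sup>+y. (\<integral>\<^sup>+x. ennreal \<omega> * ?m x y \<partial>?M) \<partial>?M) \<le> ennreal (\<omega> * C * \<mu>)" .
      show "(\<integral>\<^sup>+y. (\<integral>\<^sup>+x. ennreal (L * \<epsilon>\<^sup>2) \<partial>?M) \<partial>?M) \<le> ennreal (L * \<epsilon>\<^sup>2 * \<mu> * \<mu>)"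
        using L \<mu> by (simp add: ennreal_mult)
    qed
    also have "\<dots> = ennreal (C * e1 + C * e1 + (\<omega> * C * \<mu> + L * \<epsilon>\<^sup>2 * \<mu> * \<mu>))"
      using C e1 \<omega> L \<mu> by (simp add: ennreal_plus[symmetric] del: ennreal_plus)
    also have "\<dots> \<le> ennreal e"
    proof (rule ennreal_leI)
      have "C * e1 = e / 8" using C by (simp add: e1_def)
      moreover have "\<omega> * C * \<mu> \<le> e / 4"
      proof -
        have "\<omega> * C * \<mu> \<le> \<omega> * (C * \<mu> + 1)" using \<omega> by (simp add: algebra_simps)
        also have "\<dots> = e / 4"
        proof -
          define X where "X = C * \<mu> + 1"
          have "X > 0" using C \<mu> by (simp add: X_def add_nonneg_pos)
          then show ?thesis unfolding \<omega>_def X_def[symmetric] by simp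
        qed
        finally show ?thesis .
      qed
      moreover have "L * \<epsilon>\<^sup>2 * \<mu> * \<mu> \<le> e / 4"
      proof -
        have "\<epsilon>\<^sup>2 \<le> \<epsilon>" using \<epsilon> by (simp add: \<epsilon>0_def power2_eq_square mult_le_one)
        then have "(L * \<mu> * \<mu>) * \<epsilon>\<^sup>2 \<le> (L * \<mu> * \<mu> + 1) * \<epsilon>0"
          using L \<mu> \<epsilon> by (intro mult_mono) auto
        also have "\<dots> \<le> (L * \<mu> * \<mu> + 1) * (e / (4 * (L * \<mu> * \<mu> + 1)))"
          using L \<mu> by (intro mult_left_mono) (auto simp: \<epsilon>0_def)
        also have "\<dots> = e / 4"
        proof -
          define X where "X = L * \<mu> * \<mu> + 1"
          have "X > 0" using L \<mu> by (simp add: X_def add_nonneg_pos)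
          then show ?thesis unfolding X_def[symmetric] by simp
        qed
        finally show ?thesis by (simp add: mult_ac)
      qed
      ultimately show "C * e1 + C * e1 + (\<omega> * C * \<mu> + L * \<epsilon>\<^sup>2 * \<mu> * \<mu>) \<le> e" using e by linarith
    qed
    finally show ?thesis .
  qed
  with \<epsilon>0 show ?thesis by blast
qed

text \<open>The excess of \<open>c \<bar>f\<bar>\<close> over \<open>\<Phi>\<close> is at most the mean oscillation of \<open>f\<close> at scale \<open>\<epsilon>\<close>, whose integral
  tends to \<open>0\<close>; a nonnegative function with integral \<open>0\<close> vanishes almost everywhere.  The
  lower bound \<open>c\<close> of the mass of the mollifier near \<open>y\<close> stands in for its total mass.\<close>

lemma AE_le_if_mollified_le:
  fixes f :: "'a::euclidean_space \<Rightarrow> real"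
  assumes S: "S \<in> lmeasurable" and b: "bounded S" and f: "integrable (lebesgue_on S) f"
    and \<Phi>[measurable]: "\<Phi> \<in> borel_measurable (lebesgue_on S)"
    and B[measurable]: "B \<in> sets (lebesgue_on S)" and \<delta>: "\<delta> > 0" "\<And>y. y \<in> B \<Longrightarrow> ball y \<delta> \<subseteq> S"
    and le: "\<And>\<epsilon>. 0 < \<epsilon> \<Longrightarrow> \<epsilon> < 1 \<Longrightarrow> AE y in lebesgue_on S. y \<in> B \<longrightarrow>
        ennreal \<bar>LINT x|lebesgue_on S. f x * mollifier \<epsilon> (x - y)\<bar> \<le> \<Phi> y"
  shows "\<exists>C\<ge>0. AE y in lebesgue_on S. y \<in> B \<longrightarrow> ennreal \<bar>f y\<bar> \<le> ennreal C * \<Phi> y"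
proof -
  have Sl: "S \<in> sets lebesgue" using S by auto
  let ?M = "lebesgue_on S"
  interpret finite_measure ?M by (rule finite_measure_lebesgue_on[OF S])
  have [measurable]: "f \<in> borel_measurable ?M" using f by (rule borel_measurable_integrable)
  obtain c where c: "c > 0" "\<And>\<epsilon> y. \<epsilon> > 0 \<Longrightarrow> ball y \<epsilon> \<subseteq> S \<Longrightarrow>
    ennreal c \<le> (\<integral>\<^sup>+x. ennreal (mollifier \<epsilon> (x - y)) \<partial>?M)"
    using mollifier_integral_ge[where 'a='a] Sl by metis
  let ?h = "\<lambda>y. (ennreal (c * \<bar>f y\<bar>) - \<Phi> y) * indicator B y"
  let ?A = "\<lambda>\<epsilon> y. \<integral>\<^sup>+x. ennreal \<bar>f x - f y\<bar> * ennreal (mollifier \<epsilon> (x - y)) \<partial>?M"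
  have *: "AE y in ?M. ?h y \<le> ?A \<epsilon> y" if \<epsilon>: "0 < \<epsilon>" "\<epsilon> < 1" "\<epsilon> \<le> \<delta>" for \<epsilon>
    using le[OF \<epsilon>(1,2)]
  proof eventually_elim
    case (elim y)
    show ?case
    proof (cases "y \<in> B")
      case True
      define m where "m x = mollifier \<epsilon> (x - y)" for x
      have [measurable]: "m \<in> borel_measurable ?M" unfolding m_def[abs_def] by measurable
      have m0: "m x \<ge> 0" for x by (simp add: m_def mollifier_nonneg)
      define H where "H = real DIM('a) * \<epsilon>\<^sup>2 * (1 / \<epsilon>) ^ (DIM('a) + 2)"
      have mb: "m x \<le> H" for x
        unfolding m_def H_def using \<epsilon> by (intro mollifier_le) auto
      have H0: "H \<ge> 0" using \<epsilon> by (simp add: H_def)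
      have mi: "integrable ?M m"
        using m0 mb by (intro integrable_const_bound[of _ H]) auto
      have fmi: "integrable ?M (\<lambda>x. f x * m x)"
      proof (rule Bochner_Integration.integrable_bound)
        show "integrable ?M (\<lambda>x. f x * H)"
          using f by (rule integrable_mult_left)
        show "AE x in ?M. norm (f x * m x) \<le> norm (f x * H)"
          using m0 mb H0 by (intro AE_I2) (auto simp: abs_mult intro!: mult_left_mono)
      qed measurable
      have "ball y \<epsilon> \<subseteq> S" using \<delta>(2)[OF True] \<epsilon> subset_ball[of \<epsilon> \<delta> y] by blast
      then have "ennreal c \<le> (\<integral>\<^sup>+x. ennreal (m x) \<partial>?M)" unfolding m_def using c(2) \<epsilon> by blast
      also have "\<dots> = ennreal (LINT x|?M. m x)" using mi m0 by (intro nn_integral_eq_integral) auto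
      finally have cm: "c \<le> (LINT x|?M. m x)" using c(1) m0 by (simp add: ennreal_le_iff)
      have "c * \<bar>f y\<bar> \<le> (LINT x|?M. m x) * \<bar>f y\<bar>" by (intro mult_right_mono cm) auto
      also have "\<dots> = \<bar>LINT x|?M. f y * m x\<bar>"
        using cm c(1) by (simp add: abs_mult mult.commute)
      also have "\<dots> = \<bar>(LINT x|?M. f x * m x) - (LINT x|?M. (f x - f y) * m x)\<bar>"
        using fmi mi by (simp add: left_diff_distrib)
      also have "\<dots> \<le> \<bar>LINT x|?M. f x * m x\<bar> + \<bar>LINT x|?M. (f x - f y) * m x\<bar>"
        by (rule abs_triangle_ineq4)
      finally have "ennreal (c * \<bar>f y\<bar>) \<le> ennreal \<bar>LINT x|?M. f x * m x\<bar> + ennreal \<bar>LINT x|?M. (f x - f y) * m x\<bar>"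
        by (simp add: ennreal_plus[symmetric] ennreal_leI del: ennreal_plus)
      also have "\<dots> \<le> \<Phi> y + ?A \<epsilon> y"
      proof (intro add_mono)
        show "ennreal \<bar>LINT x|?M. f x * m x\<bar> \<le> \<Phi> y" using elim True by (simp add: m_def)
        have "integrable ?M (\<lambda>x. (f x - f y) * m x)" using fmi mi by (simp add: left_diff_distrib)
        from integral_norm_bound_ennreal[OF this]
        show "ennreal \<bar>LINT x|?M. (f x - f y) * m x\<bar> \<le> ?A \<epsilon> y"
          by (simp add: abs_mult m0 ennreal_mult m_def mollifier_nonneg)
      qed
      finally show ?thesis using True by (simp add: ennreal_minus_le_iff)
    qed simp
  qed
  have small: "(\<integral>\<^sup>+y. ?h y \<partial>?M) \<le> ennreal e" if "e > 0" for e
  proof -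
    obtain \<epsilon>0 where \<epsilon>0: "\<epsilon>0 > 0" "\<And>\<epsilon>. 0 < \<epsilon> \<Longrightarrow> \<epsilon> < \<epsilon>0 \<Longrightarrow> (\<integral>\<^sup>+y. ?A \<epsilon> y \<partial>?M) \<le> ennreal e"
      using mollifier_approximate_identity[OF S b f \<open>e > 0\<close>] by blast
    \<comment> \<open>The scale has to stay below \<open>\<delta>\<close>, where the mollifier has mass at least \<open>c\<close> inside \<open>S\<close>.\<close>
    define \<epsilon> where "\<epsilon> = min (\<epsilon>0 / 2) (min (1 / 2) \<delta>)"
    have \<epsilon>: "0 < \<epsilon>" "\<epsilon> < \<epsilon>0" "\<epsilon> < 1" "\<epsilon> \<le> \<delta>" using \<epsilon>0 \<delta> by (auto simp: \<epsilon>_def min_def)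
    have "(\<integral>\<^sup>+y. ?h y \<partial>?M) \<le> (\<integral>\<^sup>+y. ?A \<epsilon> y \<partial>?M)"
      using * \<epsilon> by (intro nn_integral_mono_AE) auto
    also have "\<dots> \<le> ennreal e" using \<epsilon>0 \<epsilon> by auto
    finally show ?thesis .
  qed
  have "(\<integral>\<^sup>+y. ?h y \<partial>?M) \<le> 0"
    by (rule ennreal_le_epsilon) (use small in simp)
  then have "(\<integral>\<^sup>+y. ?h y \<partial>?M) = 0" by simp
  then have "AE y in ?M. ?h y = 0" by (subst (asm) nn_integral_0_iff_AE) measurable
  then have "AE y in ?M. y \<in> B \<longrightarrow> ennreal \<bar>f y\<bar> \<le> ennreal (1 / c) * \<Phi> y"
  proof eventually_elim
    case (elim y)
    show ?case
    proof
      assume "y \<in> B"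
      with elim have "ennreal (c * \<bar>f y\<bar>) \<le> \<Phi> y"
        by (cases "\<Phi> y") (auto simp: ennreal_minus_if split: if_splits)
      then have "ennreal (1 / c) * ennreal (c * \<bar>f y\<bar>) \<le> ennreal (1 / c) * \<Phi> y" by (rule mult_left_mono) simp
      then show "ennreal \<bar>f y\<bar> \<le> ennreal (1 / c) * \<Phi> y" using c(1) by (simp add: ennreal_mult[symmetric])
    qed
  qed
  then show ?thesis using c(1) by (intro exI[of _ "1 / c"]) auto
qed

section \<open>The test functions\<close>

definition bump :: "real \<Rightarrow> 'a::real_inner \<Rightarrow> 'a \<Rightarrow> real" where
  "bump r a x = bump_profile r ((x - a) \<bullet> (x - a))"

lemma bump_bounds: "0 \<le> bump r a x" "bump r a x \<le> 1"
  by (auto simp: bump_def bump_profile_def max_def intro!: power_le_one)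

lemma bump_center: "bump r a a = 1"
  by (simp add: bump_def bump_profile_def)

lemma bump_factor_eq_0:
  assumes "r > 0" "r \<le> norm (x - a)"
  shows "max 0 (1 - ((x - a) \<bullet> (x - a)) / r\<^sup>2) = 0"
proof -
  have "r\<^sup>2 \<le> (x - a) \<bullet> (x - a)"
    using assms power_mono[of r "norm (x - a)" 2] by (simp add: power2_norm_eq_inner)
  then show ?thesis using assms by (simp add: max_def divide_simps)
qed

lemma bump_ge:
  assumes "0 \<le> r'" "r' < r" "norm (x - a) \<le> r'"
  shows "(1 - r'\<^sup>2 / r\<^sup>2) ^ 3 \<le> bump r a x" "(1 - r'\<^sup>2 / r\<^sup>2) ^ 3 > 0"
proof -
  have "(x - a) \<bullet> (x - a) \<le> r'\<^sup>2"
    using assms power_mono[of "norm (x - a)" r' 2] by (simp add: power2_norm_eq_inner)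
  then have *: "1 - r'\<^sup>2 / r\<^sup>2 \<le> 1 - ((x - a) \<bullet> (x - a)) / r\<^sup>2"
    by (simp add: divide_right_mono)
  have "r'\<^sup>2 < r\<^sup>2" using assms by (intro power_strict_mono) auto
  then have p: "0 < 1 - r'\<^sup>2 / r\<^sup>2" using assms by simp
  then show "(1 - r'\<^sup>2 / r\<^sup>2) ^ 3 > 0" by simp
  show "(1 - r'\<^sup>2 / r\<^sup>2) ^ 3 \<le> bump r a x"
    unfolding bump_def bump_profile_def using * p by (intro power_mono) auto
qed

lemma bump_C2:
  fixes a :: "real ^ 'n::finite"
  assumes r: "r > 0"
  shows "bump r a \<in> C2 UNIV"
    and "gradient (bump r a) x = (- (6 / r\<^sup>2) * max 0 (1 - ((x - a) \<bullet> (x - a)) / r\<^sup>2) ^ 2) *\<^sub>R (x - a)"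
    and "laplacian (bump r a) x = (24 / r ^ 4) * max 0 (1 - ((x - a) \<bullet> (x - a)) / r\<^sup>2) * ((x - a) \<bullet> (x - a))
       - (6 * real CARD('n) / r\<^sup>2) * max 0 (1 - ((x - a) \<bullet> (x - a)) / r\<^sup>2) ^ 2"
proof -
  let ?h1 = "\<lambda>s. - (3 / r\<^sup>2) * max 0 (1 - s / r\<^sup>2) ^ 2" and ?h2 = "\<lambda>s. (6 / r ^ 4) * max 0 (1 - s / r\<^sup>2)"
  have c: "continuous_on {0..} ?h2" by (intro continuous_intros) (use r in auto)
  note R = radial_C2[of "bump_profile r" ?h1 ?h2, OF bump_profile_derivs[OF r] c, where c = a]
  have b: "bump r a = (\<lambda>x. bump_profile r ((x - a) \<bullet> (x - a)))" by (simp add: bump_def[abs_def])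
  show "bump r a \<in> C2 UNIV" unfolding b by (rule R(1))
  show "gradient (bump r a) x = (- (6 / r\<^sup>2) * max 0 (1 - ((x - a) \<bullet> (x - a)) / r\<^sup>2) ^ 2) *\<^sub>R (x - a)"
    unfolding b R(2) by simp
  show "laplacian (bump r a) x = (24 / r ^ 4) * max 0 (1 - ((x - a) \<bullet> (x - a)) / r\<^sup>2) * ((x - a) \<bullet> (x - a))
       - (6 * real CARD('n) / r\<^sup>2) * max 0 (1 - ((x - a) \<bullet> (x - a)) / r\<^sup>2) ^ 2"
    unfolding b R(3) by (simp add: algebra_simps)
qed

lemma bump_outside:
  fixes a :: "real ^ 'n::finite"
  assumes r: "r > 0" and x: "x \<notin> ball a r"
  shows "bump r a x = 0" "gradient (bump r a) x = 0" "laplacian (bump r a) x = 0"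
proof -
  have "r \<le> norm (x - a)" using x by (simp add: dist_norm norm_minus_commute)
  note 0 = bump_factor_eq_0[OF r this]
  show "bump r a x = 0" unfolding bump_def bump_profile_def 0 by simp
  show "gradient (bump r a) x = 0" unfolding bump_C2(2)[OF r] 0 by simp
  show "laplacian (bump r a) x = 0" unfolding bump_C2(3)[OF r] 0 by simp
qed

text \<open>The normalisation \<open>K \<ge> 1\<close> lets \<open>K\<close> bound the cutoff itself, too.\<close>

lemma bump_derivatives_bounded:
  fixes a :: "real ^ 'n::finite"
  assumes r: "r > 0"
  shows "\<exists>K\<ge>1. \<forall>x. norm (gradient (bump r a) x) \<le> K \<and> \<bar>laplacian (bump r a) x\<bar> \<le> K"
proof -
  define K where "K = max 1 (max (6 / r) (24 / r\<^sup>2 + 6 * real CARD('n) / r\<^sup>2))"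
  have "norm (gradient (bump r a) x) \<le> K \<and> \<bar>laplacian (bump r a) x\<bar> \<le> K" for x
  proof (cases "x \<in> ball a r")
    case False
    then show ?thesis using bump_outside[OF r False] by (simp add: K_def)
  next
    case True
    define q where "q = (x - a) \<bullet> (x - a)"
    define m where "m = max 0 (1 - q / r\<^sup>2)"
    have n: "norm (x - a) \<le> r" using True by (simp add: dist_norm norm_minus_commute)
    have q: "0 \<le> q" "q \<le> r\<^sup>2"
      using power_mono[OF n, of 2] by (auto simp: q_def power2_norm_eq_inner)
    have m: "0 \<le> m" "m \<le> 1" using q r by (auto simp: m_def)
    then have m2: "0 \<le> m\<^sup>2" "m\<^sup>2 \<le> 1" by (auto intro: power_le_one)
    have "norm (gradient (bump r a) x) = 6 / r\<^sup>2 * m\<^sup>2 * norm (x - a)"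
      unfolding bump_C2(2)[OF r] q_def[symmetric] m_def[symmetric] using m by simp
    also have "\<dots> \<le> 6 / r\<^sup>2 * 1 * r"
      using m2 n by (intro mult_mono) auto
    also have "\<dots> = 6 / r" using r by (simp add: power2_eq_square)
    finally have 1: "norm (gradient (bump r a) x) \<le> 6 / r" .
    have "\<bar>laplacian (bump r a) x\<bar> \<le> \<bar>24 / r ^ 4 * m * q\<bar> + \<bar>6 * real CARD('n) / r\<^sup>2 * m\<^sup>2\<bar>"
      unfolding bump_C2(3)[OF r] q_def[symmetric] m_def[symmetric] by (rule abs_triangle_ineq4)
    also have "\<dots> \<le> 24 / r ^ 4 * 1 * r\<^sup>2 + 6 * real CARD('n) / r\<^sup>2 * 1"
      using m m2 q unfolding abs_mult by (intro add_mono mult_mono) auto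
    also have "\<dots> = 24 / r\<^sup>2 + 6 * real CARD('n) / r\<^sup>2"
      using r by (simp add: power2_eq_square power4_eq_xxxx)
    finally show ?thesis using 1 by (simp add: K_def le_max_iff_disj)
  qed
  then show ?thesis by (intro exI[of _ K]) (simp add: K_def)
qed

text \<open>Adding \<open>\<epsilon>\<^sup>2\<close> to the squared distance removes the pole and keeps the function radial and smooth.\<close>

definition reg_newton :: "real \<Rightarrow> real ^ 'n::finite \<Rightarrow> real ^ 'n \<Rightarrow> real" where
  "reg_newton \<epsilon> c x = newton_profile CARD('n) ((x - c) \<bullet> (x - c) + \<epsilon>\<^sup>2)"

lemma reg_newton_C2:
  fixes c :: "real ^ 'n::finite"
  assumes \<epsilon>: "\<epsilon> > 0" and n: "CARD('n) \<ge> 2"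
  shows "reg_newton \<epsilon> c \<in> C2 UNIV"
    and "gradient (reg_newton \<epsilon> c) x = (- (((x - c) \<bullet> (x - c) + \<epsilon>\<^sup>2) powr (- (real CARD('n) / 2)))) *\<^sub>R (x - c)"
    and "laplacian (reg_newton \<epsilon> c) x = - mollifier \<epsilon> (x - c)"
proof -
  let ?n = "real CARD('n)"
  let ?h = "\<lambda>s. newton_profile CARD('n) (s + \<epsilon>\<^sup>2)"
    and ?h1 = "\<lambda>s. - (1/2) * (s + \<epsilon>\<^sup>2) powr (- (?n / 2))"
    and ?h2 = "\<lambda>s. (?n / 4) * (s + \<epsilon>\<^sup>2) powr (- (?n / 2) - 1)"
  have pos: "s + \<epsilon>\<^sup>2 > 0" if "s \<ge> 0" for s using \<epsilon> that by (simp add: add_nonneg_pos)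
  have sh: "((\<lambda>s. s + \<epsilon>\<^sup>2) has_real_derivative 1) (at s)" for s
    by (auto intro!: derivative_eq_intros)
  have d1: "(?h has_real_derivative ?h1 s) (at s)" if "s \<ge> 0" for s
    using DERIV_chain2[OF newton_profile_deriv[OF pos[OF that] n] sh] by simp
  have d2: "(?h1 has_real_derivative ?h2 s) (at s)" if "s \<ge> 0" for s
  proof -
    have "((\<lambda>s. (s + \<epsilon>\<^sup>2) powr (- (?n / 2))) has_real_derivative - (?n / 2) * (s + \<epsilon>\<^sup>2) powr (- (?n / 2) - 1)) (at s)"
      using DERIV_chain2[OF has_real_derivative_powr[OF pos[OF that], of "- (?n / 2)"] sh] by simp
    from DERIV_cmult[OF this, of "- (1/2)"] show ?thesis by simp
  qed
  have c: "continuous_on {0..} ?h2"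
    using pos by (intro continuous_intros) force
  have R: "(\<lambda>x. ?h ((x - c) \<bullet> (x - c))) \<in> C2 UNIV"
    "gradient (\<lambda>x. ?h ((x - c) \<bullet> (x - c))) x = (2 * ?h1 ((x - c) \<bullet> (x - c))) *\<^sub>R (x - c)"
    "laplacian (\<lambda>x. ?h ((x - c) \<bullet> (x - c))) x =
      4 * ?h2 ((x - c) \<bullet> (x - c)) * ((x - c) \<bullet> (x - c)) + 2 * ?n * ?h1 ((x - c) \<bullet> (x - c))"
    by (rule radial_C2[of ?h ?h1 ?h2, OF d1 d2 c], assumption+)+
  have b: "reg_newton \<epsilon> c = (\<lambda>x. newton_profile CARD('n) ((x - c) \<bullet> (x - c) + \<epsilon>\<^sup>2))"
    by (simp add: reg_newton_def[abs_def])
  show "reg_newton \<epsilon> c \<in> C2 UNIV" unfolding b by (rule R(1))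
  show "gradient (reg_newton \<epsilon> c) x = (- (((x - c) \<bullet> (x - c) + \<epsilon>\<^sup>2) powr (- (?n / 2)))) *\<^sub>R (x - c)"
    unfolding b R(2) by simp
  define s where "s = (x - c) \<bullet> (x - c) + \<epsilon>\<^sup>2"
  have s: "s > 0" using pos[of "(x - c) \<bullet> (x - c)"] by (simp add: s_def)
  have "s powr (- (?n / 2)) = s * s powr (- (?n / 2) - 1)"
    using s by (simp add: powr_diff powr_minus_divide)
  then have "4 * ((?n / 4) * s powr (- (?n / 2) - 1)) * (s - \<epsilon>\<^sup>2) + 2 * ?n * (- (1/2) * s powr (- (?n / 2)))
     = - (?n * \<epsilon>\<^sup>2 * s powr (- (?n / 2) - 1))"
    by (simp add: algebra_simps)
  then show "laplacian (reg_newton \<epsilon> c) x = - mollifier \<epsilon> (x - c)"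
    unfolding b R(3) mollifier_def s_def by simp
qed

text \<open>The bound by the singular kernel is uniform in \<open>\<epsilon>\<close>.\<close>

lemma norm_gradient_reg_newton_le:
  fixes c :: "real ^ 'n::finite"
  assumes \<epsilon>: "\<epsilon> > 0" and n: "CARD('n) \<ge> 2"
  shows "ennreal (norm (gradient (reg_newton \<epsilon> c) x)) \<le> riesz_kernel (real CARD('n) - 1) (x - c)"
proof (cases "x = c")
  case False
  let ?n = "real CARD('n)"
  define d where "d = norm (x - c)"
  have d: "d > 0" using False by (simp add: d_def)
  have "(x - c) \<bullet> (x - c) = d\<^sup>2" by (simp add: d_def power2_norm_eq_inner)
  then have "norm (gradient (reg_newton \<epsilon> c) x) = (d\<^sup>2 + \<epsilon>\<^sup>2) powr (- (?n / 2)) * d"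
    by (simp add: reg_newton_C2(2)[OF assms] d_def)
  also have "\<dots> \<le> (d\<^sup>2) powr (- (?n / 2)) * d"
    using d by (intro mult_right_mono powr_mono2') auto
  also have "(d\<^sup>2) powr (- (?n / 2)) = d powr (- ?n)" using d by (simp add: powr_powr flip: powr_numeral)
  also have "d powr (- ?n) * d = d powr (- ?n) * d powr 1" using d by simp
  also have "\<dots> = d powr - (?n - 1)" by (simp only: powr_add[symmetric]) simp
  finally show ?thesis using False by (simp add: riesz_kernel_def d_def ennreal_leI)
qed (simp add: riesz_kernel_def)

lemma reg_newton_le:
  assumes n: "CARD('n::finite) \<ge> 2" and \<beta>: "\<beta> > real CARD('n) - 2" and D: "D > 0"
  shows "\<exists>C\<ge>0. \<forall>\<epsilon>. 0 < \<epsilon> \<longrightarrow> \<epsilon> < 1 \<longrightarrow> (\<forall>x c :: real ^ 'n. norm (x - c) \<le> D \<longrightarrow>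
    ennreal \<bar>reg_newton \<epsilon> c x\<bar> \<le> ennreal C * riesz_kernel \<beta> (x - c))"
proof -
  obtain C where C: "C \<ge> 0" "\<And>s. 0 < s \<Longrightarrow> s \<le> D\<^sup>2 + 1 \<Longrightarrow> \<bar>newton_profile CARD('n) s\<bar> \<le> C * s powr (- \<beta> / 2)"
    using newton_profile_bound[OF n \<beta>, of "D\<^sup>2 + 1"] D by (auto simp: add_pos_pos)
  have \<beta>0: "\<beta> > 0" using \<beta> n by linarith
  have "ennreal \<bar>reg_newton \<epsilon> c x\<bar> \<le> ennreal (C + 1) * riesz_kernel \<beta> (x - c)"
    if \<epsilon>: "0 < \<epsilon>" "\<epsilon> < 1" and x: "norm (x - c) \<le> D" for \<epsilon> and x c :: "real ^ 'n"
  proof (cases "x = c")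
    case True
    then show ?thesis using C by (simp add: riesz_kernel_def ennreal_mult_top)
  next
    case False
    define d where "d = norm (x - c)"
    have d: "0 < d" "d \<le> D" using False x by (auto simp: d_def)
    have q: "(x - c) \<bullet> (x - c) = d\<^sup>2" by (simp add: d_def power2_norm_eq_inner)
    have "\<epsilon>\<^sup>2 \<le> 1" using \<epsilon> by (intro power_le_one) auto
    moreover have "d\<^sup>2 \<le> D\<^sup>2" using d by (intro power_mono) auto
    ultimately have le: "d\<^sup>2 + \<epsilon>\<^sup>2 \<le> D\<^sup>2 + 1" by linarith
    have "\<bar>reg_newton \<epsilon> c x\<bar> \<le> C * (d\<^sup>2 + \<epsilon>\<^sup>2) powr (- \<beta> / 2)"
      unfolding reg_newton_def q using d by (intro C(2) le) (auto simp: add_pos_nonneg)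
    also have "\<dots> \<le> C * (d\<^sup>2) powr (- \<beta> / 2)"
      using d \<beta>0 C(1) by (intro mult_left_mono powr_mono2') auto
    also have "(d\<^sup>2) powr (- \<beta> / 2) = d powr - \<beta>"
      using d by (simp add: powr_powr flip: powr_numeral)
    also have "C * d powr - \<beta> \<le> (C + 1) * d powr - \<beta>" by (intro mult_right_mono) auto
    finally have "ennreal \<bar>reg_newton \<epsilon> c x\<bar> \<le> ennreal ((C + 1) * d powr - \<beta>)" by (rule ennreal_leI)
    also have "\<dots> = ennreal (C + 1) * ennreal (d powr - \<beta>)" using C by (intro ennreal_mult) auto
    finally show ?thesis using False by (simp only: riesz_kernel_def d_def) simp
  qed
  then show ?thesis using C by (intro exI[of _ "C + 1"]) auto
qed

section \<open>Pointwise estimate of a solution\<close>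

lemma C2_subset: "f \<in> C2 T \<Longrightarrow> S \<subseteq> T \<Longrightarrow> f \<in> C2 S"
  unfolding C2_def C1_def using continuous_on_subset by blast

lemma C1_gradient_measurable:
  fixes f :: "real ^ 'n::finite \<Rightarrow> real"
  assumes "open S" "f \<in> C1 S"
  shows "gradient f \<in> borel_measurable (lebesgue_on S)"
proof (rule continuous_imp_measurable_on_sets_lebesgue)
  show "continuous_on S (gradient f)"
    unfolding gradient_def[abs_def] using assms by (intro continuous_on_vec_lambda) (auto simp: C1_def)
qed (use assms in simp)

lemma C1_measurable:
  fixes f :: "real ^ 'n::finite \<Rightarrow> real"
  assumes "open S" "f \<in> C1 S"
  shows "f \<in> borel_measurable (lebesgue_on S)"
  by (rule continuous_imp_measurable_on_sets_lebesgue) (use assms C1_continuous_on in auto)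

lemma C2_laplacian_measurable:
  fixes f :: "real ^ 'n::finite \<Rightarrow> real"
  assumes "open S" "f \<in> C2 S"
  shows "laplacian f \<in> borel_measurable (lebesgue_on S)"
proof (rule continuous_imp_measurable_on_sets_lebesgue)
  show "continuous_on S (laplacian f)"
    unfolding laplacian_def[abs_def] using assms by (intro continuous_on_sum) (auto simp: C2_def C1_def)
qed (use assms in simp)

lemma measurable_if_components_measurable:
  fixes U :: "'a \<Rightarrow> real ^ 'n::finite"
  assumes "\<And>i. (\<lambda>x. U x $ i) \<in> borel_measurable M"
  shows "U \<in> borel_measurable M"
  unfolding borel_measurable_euclidean_space[of U] using assms
  by (auto simp: Basis_vec_def inner_axis)

lemma kernel_integral_measurable [measurable]:
  fixes S :: "'a::euclidean_space set"
  assumes S: "S \<in> lmeasurable" and [measurable]: "g \<in> borel_measurable (lebesgue_on S)"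
  shows "(\<lambda>y. \<integral>\<^sup>+x. g x * riesz_kernel \<beta> (x - y) \<partial>lebesgue_on S) \<in> borel_measurable (lebesgue_on S)"
proof -
  interpret finite_measure "lebesgue_on S" by (rule finite_measure_lebesgue_on[OF S])
  show ?thesis by measurable
qed

text \<open>A fixed solution with Dirac source at \<open>a\<close>, together with the properties of the data on which the local
  estimates rest.\<close>

locale dirac_solution =
  fixes \<Omega> :: "(real ^ 'n::finite) set" and U :: "real ^ 'n \<Rightarrow> real ^ 'n" and V :: "real ^ 'n \<Rightarrow> ennreal"
    and a :: "real ^ 'n" and u :: "real ^ 'n \<Rightarrow> real"
  assumes dim: "CARD('n) \<ge> 2" and open_domain: "open \<Omega>" and bounded_domain: "bounded \<Omega>" and a: "a \<in> \<Omega>"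
    and U_measurable: "U \<in> borel_measurable (lebesgue_on \<Omega>)"
    and V_measurable: "V \<in> borel_measurable (lebesgue_on \<Omega>)"
    and u_integrable: "integrable (lebesgue_on \<Omega>) u"
    and uV_finite: "(\<integral>\<^sup>+x. ennreal \<bar>u x\<bar> * V x \<partial>lebesgue_on \<Omega>) < \<infinity>"
    and solves: "solves_dirac \<Omega> U V a u"
begin

abbreviation M :: "(real ^ 'n) measure" where "M \<equiv> lebesgue_on \<Omega>"

text \<open>The density of the absolutely continuous part of the measure \<open>\<nu>\<close> whose potentials bound \<open>u\<close>.\<close>

definition \<rho> :: "real ^ 'n \<Rightarrow> ennreal" where
  "\<rho> x = ennreal \<bar>u x\<bar> * (1 + ennreal (norm (U x)) + V x)"

text \<open>The potential of \<open>\<nu> = \<delta>\<^sub>a + \<rho> dx\<close> with exponent \<open>\<beta>\<close>.\<close>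

definition pot :: "real \<Rightarrow> real ^ 'n \<Rightarrow> ennreal" where
  "pot \<beta> y = riesz_kernel \<beta> (a - y) + (\<integral>\<^sup>+x. \<rho> x * riesz_kernel \<beta> (x - y) \<partial>M)"

text \<open>The contribution of the first order terms, where the gradient of the Newton potential appears.  It
  is restricted to a ball because \<open>u\<close> is only controlled there.\<close>

definition drift_pot :: "real \<Rightarrow> real ^ 'n \<Rightarrow> ennreal" where
  "drift_pot r y = (\<integral>\<^sup>+x. (indicator (ball a r) x * ennreal \<bar>u x\<bar> * (1 + ennreal (norm (U x))))
     * riesz_kernel (real CARD('n) - 1) (x - y) \<partial>M)"

lemma lmeasurable_domain: "\<Omega> \<in> lmeasurable"
  using bounded_domain open_domain by (simp add: lmeasurable_open)

lemma lebesgue_domain: "\<Omega> \<in> sets lebesgue"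
  using lmeasurable_domain by auto

lemma space_M [simp]: "space M = \<Omega>"
  by (simp add: space_restrict_space lebesgue_domain)

declare U_measurable [measurable] V_measurable [measurable]

lemma u_measurable [measurable]: "u \<in> borel_measurable M"
  using u_integrable by (rule borel_measurable_integrable)

lemma \<rho>_measurable [measurable]: "\<rho> \<in> borel_measurable M"
  unfolding \<rho>_def[abs_def] by measurable

lemma indicator_ball_measurable [measurable]: "indicator (ball c r) \<in> borel_measurable M"
  using measurable_compose[OF id_measurable_lebesgue_on borel_measurable_indicator[of "ball c r" borel]] by simp

lemma pot_measurable [measurable]: "pot \<beta> \<in> borel_measurable M"
proof -
  have [measurable]: "(\<lambda>y. \<integral>\<^sup>+x. \<rho> x * riesz_kernel \<beta> (x - y) \<partial>M) \<in> borel_measurable M"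
    by (rule kernel_integral_measurable[OF lmeasurable_domain \<rho>_measurable])
  show ?thesis unfolding pot_def[abs_def] by measurable
qed

lemma drift_pot_measurable [measurable]: "drift_pot r \<in> borel_measurable M"
  unfolding drift_pot_def[abs_def]
  by (rule kernel_integral_measurable[OF lmeasurable_domain]) measurable

lemma uU_integrable: "integrable M (\<lambda>x. u x * norm (U x))"
  using solves by (simp add: solves_dirac_def)

lemma weak_equation:
  assumes "\<phi> \<in> C2_0 \<Omega>"
  shows "(LINT x|M. u x * (- laplacian \<phi> x - U x \<bullet> gradient \<phi> x + enn2real (V x) * \<phi> x)) = \<phi> a"
  using solves assms by (simp add: solves_dirac_def)

lemma \<rho>_finite: "(\<integral>\<^sup>+x. \<rho> x \<partial>M) < \<infinity>"
proof -
  have "\<rho> x = ennreal \<bar>u x\<bar> + ennreal \<bar>u x * norm (U x)\<bar> + ennreal \<bar>u x\<bar> * V x" for x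
    by (simp add: \<rho>_def distrib_left abs_mult ennreal_mult)
  then have "(\<integral>\<^sup>+x. \<rho> x \<partial>M) = (\<integral>\<^sup>+x. ennreal \<bar>u x\<bar> \<partial>M) + (\<integral>\<^sup>+x. ennreal \<bar>u x * norm (U x)\<bar> \<partial>M)
     + (\<integral>\<^sup>+x. ennreal \<bar>u x\<bar> * V x \<partial>M)"
    by (simp add: nn_integral_add)
  also have "\<dots> < \<infinity>"
    using u_integrable uU_integrable uV_finite by (simp add: integrable_iff_bounded)
  finally show ?thesis .
qed

lemma diameter_bound: "\<exists>D>0. \<forall>x\<in>\<Omega>. \<forall>y\<in>\<Omega>. norm (x - y) \<le> D"
proof -
  obtain b where "b > 0" "\<forall>x\<in>\<Omega>. norm x \<le> b" using bounded_domain by (auto simp: bounded_pos)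
  moreover have "norm (x - y) \<le> 2 * b" if "x \<in> \<Omega>" "y \<in> \<Omega>" for x y
  proof -
    have "norm x \<le> b" "norm y \<le> b" using that \<open>\<forall>x\<in>\<Omega>. norm x \<le> b\<close> by auto
    then show ?thesis using norm_triangle_ineq4[of x y] by linarith
  qed
  ultimately show ?thesis by (intro exI[of _ "2 * b"]) auto
qed

text \<open>Testing the equation with the cutoff times the regularised Newton potential with pole \<open>y\<close> isolates the
  mollification of \<open>u\<close> at \<open>y\<close>.  In the remainder the Newton potential is bounded by the kernel with
  exponent \<open>\<beta>\<close> and its gradient by the kernel with exponent \<open>n - 1\<close>; the latter occurs only with the
  factors \<open>u\<close> and \<open>u U\<close>, inside the ball.  All bounds are uniform in \<open>\<epsilon>\<close>.\<close>

lemma mollified_solution_bound: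
  assumes r: "r > 0" "cball a r \<subseteq> \<Omega>" and \<beta>: "\<beta> > real CARD('n) - 2"
  shows "\<exists>C\<ge>0. \<forall>\<epsilon> y. 0 < \<epsilon> \<longrightarrow> \<epsilon> < 1 \<longrightarrow> y \<in> ball a r \<longrightarrow>
    ennreal \<bar>LINT x|M. (bump r a x * u x) * mollifier \<epsilon> (x - y)\<bar> \<le> ennreal C * (pot \<beta> y + drift_pot r y)"
proof -
  let ?b = "bump r a" and ?n = "real CARD('n)"
  obtain D where D: "D > 0" "\<And>x y. x \<in> \<Omega> \<Longrightarrow> y \<in> \<Omega> \<Longrightarrow> norm (x - y) \<le> D"
    using diameter_bound by blast
  obtain K where K: "K \<ge> 1" "\<And>x. norm (gradient ?b x) \<le> K" "\<And>x. \<bar>laplacian ?b x\<bar> \<le> K"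
    using bump_derivatives_bounded[OF r(1)] by blast
  obtain C1 where C1: "C1 \<ge> 0" "\<And>\<epsilon> x c. 0 < \<epsilon> \<Longrightarrow> \<epsilon> < 1 \<Longrightarrow> norm (x - c) \<le> D \<Longrightarrow>
    ennreal \<bar>reg_newton \<epsilon> c x\<bar> \<le> ennreal C1 * riesz_kernel \<beta> (x - c :: real ^ 'n)"
    using reg_newton_le[OF dim \<beta> D(1)] by blast
  define C where "C = 2 * K + K * C1"
  have C: "C > 0" "C1 \<le> C" "2 * K \<le> C" "K * C1 \<le> C" 
    using K(1) C1(1) mult_right_mono[of 1 K C1] by (auto simp: C_def add_pos_nonneg)
  have "ennreal \<bar>LINT x|M. (?b x * u x) * mollifier \<epsilon> (x - y)\<bar> \<le> ennreal C * (pot \<beta> y + drift_pot r y)"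
    if \<epsilon>: "0 < \<epsilon>" "\<epsilon> < 1" and y: "y \<in> ball a r" for \<epsilon> y
  proof -
    let ?N = "reg_newton \<epsilon> y"
    have y\<Omega>: "y \<in> \<Omega>" using y r(2) by auto
    define \<phi> where "\<phi> x = ?b x * ?N x" for x
    have bC: "?b \<in> C2 \<Omega>" and NC: "?N \<in> C2 \<Omega>"
      using C2_subset[OF bump_C2(1)[OF r(1)]] C2_subset[OF reg_newton_C2(1)[OF \<epsilon>(1) dim]] by auto
    have \<phi>C: "\<phi> \<in> C2 \<Omega>"
      unfolding \<phi>_def[abs_def] by (rule C2_mult[OF open_domain bC NC])
    have \<phi>0: "\<phi> \<in> C2_0 \<Omega>"
    proof (rule C2_0_if_supported_in_cball[OF open_domain r(2) \<phi>C])
      fix x assume "x \<notin> cball a r"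
      then have "?b x = 0" by (intro bump_outside(1)[OF r(1)]) auto
      then show "\<phi> x = 0" by (simp add: \<phi>_def)
    qed
    define T where "T x = u x * (- laplacian \<phi> x - U x \<bullet> gradient \<phi> x + enn2real (V x) * \<phi> x)" for x
    have T: "(LINT x|M. T x) = \<phi> a" unfolding T_def by (rule weak_equation[OF \<phi>0])
    define R where "R x = T x - (?b x * u x) * mollifier \<epsilon> (x - y)" for x
    have \<phi>m: "\<phi> \<in> borel_measurable M" "gradient \<phi> \<in> borel_measurable M" "laplacian \<phi> \<in> borel_measurable M"
      and bm: "?b \<in> borel_measurable M"
      using C1_measurable[OF open_domain] C1_gradient_measurable[OF open_domain] C2_laplacian_measurable[OF open_domain \<phi>C]
        \<phi>C bC by (auto simp: C2_def)
    note [measurable] = \<phi>m bm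
    have Rm [measurable]: "R \<in> borel_measurable M" unfolding R_def[abs_def] T_def by measurable
    have R_eq: "R x = u x * (- 2 * (gradient ?b x \<bullet> gradient ?N x) - ?N x * laplacian ?b x
        - U x \<bullet> (?b x *\<^sub>R gradient ?N x + ?N x *\<^sub>R gradient ?b x) + enn2real (V x) * (?b x * ?N x))"
      if x: "x \<in> \<Omega>" for x
    proof -
      have d: "?b differentiable (at x)" "?N differentiable (at x)"
        using bC NC x by (auto simp: C2_def C1_def)
      have L: "laplacian \<phi> x = ?b x * (- mollifier \<epsilon> (x - y)) + 2 * (gradient ?b x \<bullet> gradient ?N x) + ?N x * laplacian ?b x"
        unfolding \<phi>_def[abs_def] laplacian_mult[OF open_domain x bC NC] reg_newton_C2(3)[OF \<epsilon>(1) dim] by simp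
      have G: "gradient \<phi> x = ?b x *\<^sub>R gradient ?N x + ?N x *\<^sub>R gradient ?b x"
        unfolding \<phi>_def[abs_def] by (rule gradient_mult[OF d])
      show ?thesis unfolding R_def T_def L G unfolding \<phi>_def by (simp add: algebra_simps)
    qed
    define g where "g x = indicator (ball a r) x * norm (gradient ?N x)" for x
    have g0: "g x \<ge> 0" for x by (simp add: g_def)
    have R_le: "ennreal \<bar>R x\<bar> \<le> ennreal C * (\<rho> x * riesz_kernel \<beta> (x - y)
        + (indicator (ball a r) x * ennreal \<bar>u x\<bar> * (1 + ennreal (norm (U x)))) * riesz_kernel (?n - 1) (x - y))"
      if x: "x \<in> \<Omega>" for x
    proof -
      let ?W = "norm (U x)" and ?v = "enn2real (V x)"
      have b: "0 \<le> ?b x" "?b x \<le> 1" by (rule bump_bounds)+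
      have gb: "norm (gradient ?b x) * norm (gradient ?N x) \<le> K * g x" "?b x * norm (gradient ?N x) \<le> g x"
        using K(1) K(2)[of x] bump_outside[OF r(1), of x] b
        by (auto simp: g_def indicator_def mult_right_mono mult_left_le_one_le)
      have "\<bar>- 2 * (gradient ?b x \<bullet> gradient ?N x) - ?N x * laplacian ?b x
        - U x \<bullet> (?b x *\<^sub>R gradient ?N x + ?N x *\<^sub>R gradient ?b x) + ?v * (?b x * ?N x)\<bar>
        \<le> 2 * (K * g x) + K * \<bar>?N x\<bar> + (?W * g x + ?W * (K * \<bar>?N x\<bar>)) + ?v * (K * \<bar>?N x\<bar>)"
      proof -
        have 1: "\<bar>gradient ?b x \<bullet> gradient ?N x\<bar> \<le> K * g x"
          using Cauchy_Schwarz_ineq2[of "gradient ?b x" "gradient ?N x"] gb(1) by linarith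
        have 2: "\<bar>?N x * laplacian ?b x\<bar> \<le> K * \<bar>?N x\<bar>"
        proof -
          have "\<bar>laplacian ?b x\<bar> * \<bar>?N x\<bar> \<le> K * \<bar>?N x\<bar>" using K(3)[of x] by (intro mult_right_mono) auto
          then show ?thesis by (simp add: abs_mult mult.commute)
        qed
        have "norm (?b x *\<^sub>R gradient ?N x + ?N x *\<^sub>R gradient ?b x) \<le> g x + K * \<bar>?N x\<bar>"
        proof -
          have "norm (?b x *\<^sub>R gradient ?N x) \<le> g x" using gb(2) b by simp
          moreover have "norm (?N x *\<^sub>R gradient ?b x) \<le> K * \<bar>?N x\<bar>"
          proof -
            have "norm (gradient ?b x) * \<bar>?N x\<bar> \<le> K * \<bar>?N x\<bar>" using K(2)[of x] by (intro mult_right_mono) auto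
            then show ?thesis by (simp add: mult.commute)
          qed
          ultimately show ?thesis by (meson norm_triangle_le add_mono)
        qed
        then have 3: "\<bar>U x \<bullet> (?b x *\<^sub>R gradient ?N x + ?N x *\<^sub>R gradient ?b x)\<bar> \<le> ?W * (g x + K * \<bar>?N x\<bar>)"
          using Cauchy_Schwarz_ineq2 by (meson mult_left_mono norm_ge_zero order_trans)
        have "\<bar>?b x * ?N x\<bar> \<le> K * \<bar>?N x\<bar>"
          using b K(1) unfolding abs_mult by (intro mult_right_mono) auto
        then have 4: "\<bar>?v * (?b x * ?N x)\<bar> \<le> ?v * (K * \<bar>?N x\<bar>)"
          by (simp only: abs_mult[of ?v]) (simp add: mult_left_mono)
        show ?thesis using 1 2 3 4 unfolding distrib_left by linarith
      qed
      also have "\<dots> \<le> (2 * K) * (g x * (1 + ?W)) + K * (\<bar>?N x\<bar> * (1 + ?W + ?v))"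
      proof -
        have "?W * g x \<le> 2 * K * (?W * g x)"
          using mult_right_mono[of 1 "2 * K" "?W * g x"] K(1) g0[of x] by simp
        then show ?thesis by (simp add: algebra_simps)
      qed
      finally have "\<bar>R x\<bar> \<le> \<bar>u x\<bar> * ((2 * K) * (g x * (1 + ?W)) + K * (\<bar>?N x\<bar> * (1 + ?W + ?v)))"
        unfolding R_eq[OF x] abs_mult by (rule mult_left_mono) simp
      then have "ennreal \<bar>R x\<bar> \<le> ennreal (\<bar>u x\<bar> * ((2 * K) * (g x * (1 + ?W)) + K * (\<bar>?N x\<bar> * (1 + ?W + ?v))))"
        by (rule ennreal_leI)
      also have "\<dots> = ennreal \<bar>u x\<bar> * (ennreal (2 * K) * (ennreal (g x) * (1 + ennreal ?W))
          + ennreal K * (ennreal \<bar>?N x\<bar> * (1 + ennreal ?W + ennreal ?v)))"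
        using K(1) g0[of x] by (simp add: ennreal_mult)
      also have "\<dots> \<le> ennreal \<bar>u x\<bar> * (ennreal C * ((indicator (ball a r) x * riesz_kernel (?n - 1) (x - y)) * (1 + ennreal ?W))
          + ennreal C * (riesz_kernel \<beta> (x - y) * (1 + ennreal ?W + V x)))"
      proof (intro mult_left_mono[of _ _ "ennreal \<bar>u x\<bar>"] add_mono)
        have "ennreal (g x) \<le> indicator (ball a r) x * riesz_kernel (?n - 1) (x - y)"
          using norm_gradient_reg_newton_le[OF \<epsilon>(1) dim, of y x] by (simp add: g_def indicator_def)
        then show "ennreal (2 * K) * (ennreal (g x) * (1 + ennreal ?W)) \<le>
          ennreal C * ((indicator (ball a r) x * riesz_kernel (?n - 1) (x - y)) * (1 + ennreal ?W))"
          using C(3) by (intro mult_mono ennreal_leI) auto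
        have "ennreal K * (ennreal \<bar>?N x\<bar> * (1 + ennreal ?W + ennreal ?v)) \<le>
          ennreal K * ((ennreal C1 * riesz_kernel \<beta> (x - y)) * (1 + ennreal ?W + V x))"
          using C1(2)[OF \<epsilon> D(2)[OF x y\<Omega>]]
          by (intro mult_left_mono mult_mono add_left_mono) (auto simp: ennreal_enn2real_if)
        also have "\<dots> = ennreal (K * C1) * (riesz_kernel \<beta> (x - y) * (1 + ennreal ?W + V x))"
          using K(1) C1(1) by (simp add: ennreal_mult mult_ac)
        also have "\<dots> \<le> ennreal C * (riesz_kernel \<beta> (x - y) * (1 + ennreal ?W + V x))"
          using C(4) by (intro mult_right_mono ennreal_leI) auto
        finally show "ennreal K * (ennreal \<bar>?N x\<bar> * (1 + ennreal ?W + ennreal ?v)) \<le> \<dots>" .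
      qed auto
      also have "\<dots> = ennreal C * (\<rho> x * riesz_kernel \<beta> (x - y)
        + (indicator (ball a r) x * ennreal \<bar>u x\<bar> * (1 + ennreal ?W)) * riesz_kernel (?n - 1) (x - y))"
      proof -
        have "t * (c * ((i * k1) * P) + c * (k2 * Q)) = c * ((t * Q) * k2 + (i * t * P) * k1)"
          for t c i k1 k2 P Q :: ennreal
          by (simp only: distrib_left mult_ac add_ac)
        then show ?thesis unfolding \<rho>_def by blast
      qed
      finally show ?thesis .
    qed
    \<comment> \<open>If the remainder is not integrable, the right-hand side of the claim is infinite.\<close>
    define I where "I = (\<integral>\<^sup>+x. ennreal \<bar>R x\<bar> \<partial>M)"
    have "I \<le> (\<integral>\<^sup>+x. ennreal C * (\<rho> x * riesz_kernel \<beta> (x - y)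
        + (indicator (ball a r) x * ennreal \<bar>u x\<bar> * (1 + ennreal (norm (U x)))) * riesz_kernel (?n - 1) (x - y)) \<partial>M)"
      unfolding I_def by (intro nn_integral_mono R_le) simp
    also have "\<dots> = ennreal C * ((\<integral>\<^sup>+x. \<rho> x * riesz_kernel \<beta> (x - y) \<partial>M) + drift_pot r y)"
      unfolding drift_pot_def by (subst nn_integral_cmult, measurable, subst nn_integral_add, measurable)
    finally have I: "I \<le> ennreal C * ((\<integral>\<^sup>+x. \<rho> x * riesz_kernel \<beta> (x - y) \<partial>M) + drift_pot r y)" .
    show ?thesis
    proof (cases "I < \<infinity>")
      case False
      then have "I = top" by (simp add: less_top[symmetric])
      then have "ennreal C * ((\<integral>\<^sup>+x. \<rho> x * riesz_kernel \<beta> (x - y) \<partial>M) + drift_pot r y) = \<infinity>"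
        using I by (simp add: top_unique)
      then have "ennreal C * (pot \<beta> y + drift_pot r y) = \<infinity>"
        using C by (auto simp: pot_def ennreal_mult_eq_top_iff)
      then show ?thesis by simp
    next
      case True
      have Ri: "integrable M R" using True by (simp add: integrable_iff_bounded I_def)
      have fi: "integrable M (\<lambda>x. (?b x * u x) * mollifier \<epsilon> (x - y))"
      proof (rule Bochner_Integration.integrable_bound)
        define H where "H = real DIM(real ^ 'n) * \<epsilon>\<^sup>2 * (1 / \<epsilon>) ^ (DIM(real ^ 'n) + 2)"
        have H: "mollifier \<epsilon> (x - y) \<le> H" for x
          unfolding H_def using \<epsilon> by (intro mollifier_le) auto
        have H0: "H \<ge> 0" using \<epsilon> by (simp add: H_def)
        show "integrable M (\<lambda>x. u x * H)" using u_integrable by (rule integrable_mult_left)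
        show "AE x in M. norm ((?b x * u x) * mollifier \<epsilon> (x - y)) \<le> norm (u x * H)"
        proof (rule AE_I2)
          fix x
          have "?b x * \<bar>u x\<bar> \<le> 1 * \<bar>u x\<bar>" using bump_bounds[of r a x] by (intro mult_right_mono) auto
          then have "(?b x * \<bar>u x\<bar>) * mollifier \<epsilon> (x - y) \<le> \<bar>u x\<bar> * H"
            using H[of x] bump_bounds[of r a x] by (intro mult_mono) (auto simp: mollifier_nonneg)
          then show "norm ((?b x * u x) * mollifier \<epsilon> (x - y)) \<le> norm (u x * H)"
            using H0 bump_bounds[of r a x] by (simp add: abs_mult mollifier_nonneg)
        qed
      qed measurable
      have "T = (\<lambda>x. R x + (?b x * u x) * mollifier \<epsilon> (x - y))" by (simp add: R_def fun_eq_iff)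
      then have "\<phi> a = (LINT x|M. R x) + (LINT x|M. (?b x * u x) * mollifier \<epsilon> (x - y))"
        using T Ri fi by simp
      then have "\<bar>LINT x|M. (?b x * u x) * mollifier \<epsilon> (x - y)\<bar> \<le> \<bar>\<phi> a\<bar> + \<bar>LINT x|M. R x\<bar>" by linarith
      then have "ennreal \<bar>LINT x|M. (?b x * u x) * mollifier \<epsilon> (x - y)\<bar> \<le> ennreal \<bar>\<phi> a\<bar> + ennreal \<bar>LINT x|M. R x\<bar>"
        by (simp add: ennreal_plus[symmetric] ennreal_leI del: ennreal_plus)
      also have "\<dots> \<le> ennreal C * riesz_kernel \<beta> (a - y)
        + ennreal C * ((\<integral>\<^sup>+x. \<rho> x * riesz_kernel \<beta> (x - y) \<partial>M) + drift_pot r y)"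
      proof (intro add_mono)
        have "ennreal \<bar>\<phi> a\<bar> \<le> ennreal C1 * riesz_kernel \<beta> (a - y)"
          using C1(2)[OF \<epsilon> D(2)[OF a y\<Omega>]] by (simp add: \<phi>_def bump_center)
        also have "\<dots> \<le> ennreal C * riesz_kernel \<beta> (a - y)"
          using C(2) by (intro mult_right_mono ennreal_leI) auto
        finally show "ennreal \<bar>\<phi> a\<bar> \<le> ennreal C * riesz_kernel \<beta> (a - y)" .
        have "ennreal \<bar>LINT x|M. R x\<bar> \<le> I"
          using integral_norm_bound_ennreal[OF Ri] by (simp add: I_def)
        then show "ennreal \<bar>LINT x|M. R x\<bar> \<le> ennreal C * ((\<integral>\<^sup>+x. \<rho> x * riesz_kernel \<beta> (x - y) \<partial>M) + drift_pot r y)"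
          using I by simp
      qed
      also have "\<dots> = ennreal C * (pot \<beta> y + drift_pot r y)"
        by (simp add: pot_def distrib_left add_ac)
      finally show ?thesis .
    qed
  qed
  then show ?thesis using C by (intro exI[of _ C]) auto
qed

end

section \<open>Improvement of the exponent\<close>

context dirac_solution
begin

text \<open>The mollification is removed first; then the cutoff, which is bounded below on the smaller ball, is
  divided out.\<close>

lemma solution_bound_on_smaller_ball:
  assumes r: "0 \<le> r'" "r' < r" "cball a r \<subseteq> \<Omega>" and \<beta>: "\<beta> > real CARD('n) - 2"
  shows "\<exists>C\<ge>0. AE y in M. y \<in> ball a r' \<longrightarrow> ennreal \<bar>u y\<bar> \<le> ennreal C * (pot \<beta> y + drift_pot r y)"
proof -
  have r0: "r > 0" using r by simp
  obtain C0 where C0: "C0 \<ge> 0" "\<And>\<epsilon> y. 0 < \<epsilon> \<Longrightarrow> \<epsilon> < 1 \<Longrightarrow> y \<in> ball a r \<Longrightarrow>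
    ennreal \<bar>LINT x|M. (bump r a x * u x) * mollifier \<epsilon> (x - y)\<bar> \<le> ennreal C0 * (pot \<beta> y + drift_pot r y)"
    using mollified_solution_bound[OF r0 r(3) \<beta>] by blast
  obtain \<delta> where \<delta>: "\<delta> > 0" "(\<Union>x\<in>cball a r. ball x \<delta>) \<subseteq> \<Omega>"
    using compact_subset_open_imp_ball_epsilon_subset[OF compact_cball open_domain r(3)] by blast
  have bC: "bump r a \<in> C1 \<Omega>"
    using C2_subset[OF bump_C2(1)[OF r0], of \<Omega>] by (auto simp: C2_def)
  have [measurable]: "bump r a \<in> borel_measurable M" by (rule C1_measurable[OF open_domain bC])
  have "\<exists>C\<ge>0. AE y in M. y \<in> ball a r \<longrightarrow> ennreal \<bar>bump r a y * u y\<bar> \<le> ennreal C * (ennreal C0 * (pot \<beta> y + drift_pot r y))"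
  proof (rule AE_le_if_mollified_le[OF lmeasurable_domain bounded_domain])
    show "integrable M (\<lambda>x. bump r a x * u x)"
    proof (rule Bochner_Integration.integrable_bound[OF u_integrable])
      show "AE x in M. norm (bump r a x * u x) \<le> norm (u x)"
        using bump_bounds[of r a] by (intro AE_I2) (simp add: abs_mult mult_left_le_one_le)
    qed measurable
    show "ball a r \<in> sets M"
      using r(3) lebesgue_domain ball_subset_cball[of a r] by (auto simp: sets_restrict_space_iff)
    show "ball y \<delta> \<subseteq> \<Omega>" if "y \<in> ball a r" for y using \<delta>(2) that by fastforce
    show "AE y in M. y \<in> ball a r \<longrightarrow> ennreal \<bar>LINT x|M. (bump r a x * u x) * mollifier \<epsilon> (x - y)\<bar>
       \<le> ennreal C0 * (pot \<beta> y + drift_pot r y)" if "0 < \<epsilon>" "\<epsilon> < 1" for \<epsilon>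
      using C0(2)[OF that] by (intro AE_I2) auto
  qed (use \<delta> in \<open>measurable, auto\<close>)
  then obtain C where C: "C \<ge> 0"
    "AE y in M. y \<in> ball a r \<longrightarrow> ennreal \<bar>bump r a y * u y\<bar> \<le> ennreal C * (ennreal C0 * (pot \<beta> y + drift_pot r y))"
    by blast
  define c where "c = (1 - r'\<^sup>2 / r\<^sup>2) ^ 3"
  have c: "c > 0" unfolding c_def by (rule bump_ge(2)[of r' r "0 :: 'a::real_inner" 0]) (use r in auto)
  from C(2) have "AE y in M. y \<in> ball a r' \<longrightarrow> ennreal \<bar>u y\<bar> \<le> ennreal (C * C0 / c) * (pot \<beta> y + drift_pot r y)"
  proof eventually_elim
    case (elim y)
    show ?case
    proof
      assume y: "y \<in> ball a r'"
      have "c \<le> bump r a y"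
        unfolding c_def using y r by (intro bump_ge(1)) (auto simp: dist_norm norm_minus_commute)
      then have "c * \<bar>u y\<bar> \<le> bump r a y * \<bar>u y\<bar>" by (intro mult_right_mono) auto
      also have "\<dots> = \<bar>bump r a y * u y\<bar>" using bump_bounds[of r a y] by (simp add: abs_mult)
      finally have "\<bar>u y\<bar> \<le> (1 / c) * \<bar>bump r a y * u y\<bar>" using c by (simp add: field_simps)
      then have "ennreal \<bar>u y\<bar> \<le> ennreal (1 / c) * ennreal \<bar>bump r a y * u y\<bar>"
        using c by (simp add: ennreal_mult[symmetric] ennreal_leI)
      also have "\<dots> \<le> ennreal (1 / c) * (ennreal C * (ennreal C0 * (pot \<beta> y + drift_pot r y)))"
        using elim y r by (intro mult_left_mono) auto
      also have "\<dots> = ennreal (C * C0 / c) * (pot \<beta> y + drift_pot r y)"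
      proof -
        have "ennreal (C * C0 / c) = ennreal (1 / c) * (ennreal C * ennreal C0)"
          using c C(1) C0(1) by (simp add: ennreal_mult[symmetric])
        then show ?thesis by (simp add: mult.assoc)
      qed
      finally show "ennreal \<bar>u y\<bar> \<le> ennreal (C * C0 / c) * (pot \<beta> y + drift_pot r y)" .
    qed
  qed
  then show ?thesis using c C(1) C0(1) by (intro exI[of _ "C * C0 / c"]) auto
qed

lemma nn_integral_mult_pot:
  assumes [measurable]: "h \<in> borel_measurable M"
  shows "(\<integral>\<^sup>+x. h x * pot \<beta> x \<partial>M) = (\<integral>\<^sup>+x. h x * riesz_kernel \<beta> (x - a) \<partial>M)
    + (\<integral>\<^sup>+z. \<rho> z * (\<integral>\<^sup>+x. h x * riesz_kernel \<beta> (x - z) \<partial>M) \<partial>M)"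
proof -
  interpret finite_measure M by (rule finite_measure_lebesgue_on[OF lmeasurable_domain])
  interpret P: pair_sigma_finite M M ..
  have "(\<integral>\<^sup>+x. h x * pot \<beta> x \<partial>M) = (\<integral>\<^sup>+x. h x * riesz_kernel \<beta> (x - a) + h x * (\<integral>\<^sup>+z. \<rho> z * riesz_kernel \<beta> (z - x) \<partial>M) \<partial>M)"
    by (simp add: pot_def distrib_left riesz_kernel_commute[of \<beta> a])
  also have "\<dots> = (\<integral>\<^sup>+x. h x * riesz_kernel \<beta> (x - a) \<partial>M) + (\<integral>\<^sup>+x. h x * (\<integral>\<^sup>+z. \<rho> z * riesz_kernel \<beta> (z - x) \<partial>M) \<partial>M)"
    by (rule nn_integral_add) measurable
  also have "(\<integral>\<^sup>+x. h x * (\<integral>\<^sup>+z. \<rho> z * riesz_kernel \<beta> (z - x) \<partial>M) \<partial>M)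
     = (\<integral>\<^sup>+x. (\<integral>\<^sup>+z. h x * (\<rho> z * riesz_kernel \<beta> (z - x)) \<partial>M) \<partial>M)"
    by (simp add: nn_integral_cmult)
  also have "\<dots> = (\<integral>\<^sup>+z. (\<integral>\<^sup>+x. h x * (\<rho> z * riesz_kernel \<beta> (z - x)) \<partial>M) \<partial>M)"
    by (rule P.Fubini') measurable
  also have "\<dots> = (\<integral>\<^sup>+z. \<rho> z * (\<integral>\<^sup>+x. h x * riesz_kernel \<beta> (x - z) \<partial>M) \<partial>M)"
  proof (rule nn_integral_cong)
    fix z
    have "(\<integral>\<^sup>+x. h x * (\<rho> z * riesz_kernel \<beta> (z - x)) \<partial>M) = (\<integral>\<^sup>+x. \<rho> z * (h x * riesz_kernel \<beta> (x - z)) \<partial>M)"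
      by (simp only: riesz_kernel_commute[of \<beta> z] mult_ac)
    also have "\<dots> = \<rho> z * (\<integral>\<^sup>+x. h x * riesz_kernel \<beta> (x - z) \<partial>M)"
      by (rule nn_integral_cmult) measurable
    finally show "(\<integral>\<^sup>+x. h x * (\<rho> z * riesz_kernel \<beta> (z - x)) \<partial>M) = \<rho> z * (\<integral>\<^sup>+x. h x * riesz_kernel \<beta> (x - z) \<partial>M)" .
  qed
  finally show ?thesis .
qed

definition drift_weight :: "real ^ 'n \<Rightarrow> ennreal" where
  "drift_weight x = 1 + ennreal (norm (U x))"

lemma drift_weight_measurable [measurable]: "drift_weight \<in> borel_measurable M"
  unfolding drift_weight_def[abs_def] by measurable

text \<open>The exponent drops by at most \<open>\<tau> - (n - 1)\<close>: this is the gain from a drift that is integrable against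
  kernels more singular than the gradient of the Newton potential.\<close>

lemma drift_kernel_composition:
  assumes \<kappa>: "\<kappa> \<ge> 0" "\<And>z. (\<integral>\<^sup>+x. drift_weight x * riesz_kernel \<tau> (x - z) \<partial>M) \<le> ennreal \<kappa>"
    and e: "0 \<le> \<beta>'" "\<beta>' \<le> \<beta>" "\<beta> \<le> real CARD('n) - 1" "(real CARD('n) - 1) + \<beta> - \<beta>' \<le> \<tau>"
  shows "\<exists>C\<ge>0. \<forall>y\<in>\<Omega>. \<forall>z\<in>\<Omega>. (\<integral>\<^sup>+x. (drift_weight x * riesz_kernel (real CARD('n) - 1) (x - y)) * riesz_kernel \<beta> (x - z) \<partial>M)
    \<le> ennreal C * riesz_kernel \<beta>' (y - z)"
proof -
  let ?\<gamma> = "real CARD('n) - 1"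
  obtain D where D: "D > 0" "\<And>x y. x \<in> \<Omega> \<Longrightarrow> y \<in> \<Omega> \<Longrightarrow> norm (x - y) \<le> D"
    using diameter_bound by blast
  obtain C where C: "C > 0" "\<And>x y z :: real ^ 'n. norm (x - y) \<le> D \<Longrightarrow> norm (x - z) \<le> D \<Longrightarrow>
    riesz_kernel ?\<gamma> (x - y) * riesz_kernel \<beta> (x - z)
    \<le> ennreal C * (riesz_kernel \<beta>' (y - z) * (riesz_kernel \<tau> (x - y) + riesz_kernel \<tau> (x - z)))"
    using riesz_kernel_product_le[OF D(1) e] by blast
  have "(\<integral>\<^sup>+x. (drift_weight x * riesz_kernel ?\<gamma> (x - y)) * riesz_kernel \<beta> (x - z) \<partial>M)
    \<le> ennreal (C * (2 * \<kappa>)) * riesz_kernel \<beta>' (y - z)" if yz: "y \<in> \<Omega>" "z \<in> \<Omega>" for y z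
  proof -
    let ?k = "ennreal C * riesz_kernel \<beta>' (y - z)"
    have "(\<integral>\<^sup>+x. (drift_weight x * riesz_kernel ?\<gamma> (x - y)) * riesz_kernel \<beta> (x - z) \<partial>M)
      \<le> (\<integral>\<^sup>+x. ?k * (drift_weight x * riesz_kernel \<tau> (x - y) + drift_weight x * riesz_kernel \<tau> (x - z)) \<partial>M)"
    proof (rule nn_integral_mono)
      fix x assume "x \<in> space M"
      then have "drift_weight x * (riesz_kernel ?\<gamma> (x - y) * riesz_kernel \<beta> (x - z)) \<le>
        drift_weight x * (ennreal C * (riesz_kernel \<beta>' (y - z) * (riesz_kernel \<tau> (x - y) + riesz_kernel \<tau> (x - z))))"
        using yz by (intro mult_left_mono C(2) D(2)) auto
      then show "(drift_weight x * riesz_kernel ?\<gamma> (x - y)) * riesz_kernel \<beta> (x - z) \<le>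
        ?k * (drift_weight x * riesz_kernel \<tau> (x - y) + drift_weight x * riesz_kernel \<tau> (x - z))"
        by (simp only: distrib_left mult_ac)
    qed
    also have "\<dots> = ?k * ((\<integral>\<^sup>+x. drift_weight x * riesz_kernel \<tau> (x - y) \<partial>M)
       + (\<integral>\<^sup>+x. drift_weight x * riesz_kernel \<tau> (x - z) \<partial>M))"
      by (subst nn_integral_cmult, measurable, subst nn_integral_add, measurable)
    also have "\<dots> \<le> ?k * (ennreal \<kappa> + ennreal \<kappa>)"
      by (intro mult_left_mono add_mono \<kappa>(2)) auto
    also have "\<dots> = ennreal (C * (2 * \<kappa>)) * riesz_kernel \<beta>' (y - z)"
    proof -
      have "ennreal \<kappa> + ennreal \<kappa> = ennreal (2 * \<kappa>)"
        using \<kappa>(1) by (simp add: ennreal_plus[symmetric] del: ennreal_plus)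
      moreover have "ennreal (C * (2 * \<kappa>)) = ennreal C * ennreal (2 * \<kappa>)"
        using \<kappa>(1) C(1) by (intro ennreal_mult) auto
      ultimately show ?thesis by (simp only: mult_ac)
    qed
    finally show ?thesis .
  qed
  then show ?thesis using C(1) \<kappa>(1) by (intro exI[of _ "C * (2 * \<kappa>)"]) auto
qed

text \<open>Inserting the bound of \<open>u\<close> by its potential and exchanging the integrals leaves, for each point mass of
  \<open>\<nu>\<close>, the composition of two kernels with the weight \<open>1 + \<bar>U\<bar>\<close>.\<close>

lemma drift_pot_le_pot:
  assumes \<kappa>: "\<kappa> \<ge> 0" "\<And>z. (\<integral>\<^sup>+x. drift_weight x * riesz_kernel \<tau> (x - z) \<partial>M) \<le> ennreal \<kappa>"
    and e: "0 \<le> \<beta>'" "\<beta>' \<le> \<beta>" "\<beta> \<le> real CARD('n) - 1" "(real CARD('n) - 1) + \<beta> - \<beta>' \<le> \<tau>"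
    and C: "C \<ge> 0" "AE x in M. x \<in> ball a r \<longrightarrow> ennreal \<bar>u x\<bar> \<le> ennreal C * pot \<beta> x"
  shows "\<exists>C\<ge>0. \<forall>y\<in>\<Omega>. drift_pot r y \<le> ennreal C * pot \<beta>' y"
proof -
  let ?\<gamma> = "real CARD('n) - 1"
  obtain C' where C': "C' \<ge> 0" "\<And>y z. y \<in> \<Omega> \<Longrightarrow> z \<in> \<Omega> \<Longrightarrow>
    (\<integral>\<^sup>+x. (drift_weight x * riesz_kernel ?\<gamma> (x - y)) * riesz_kernel \<beta> (x - z) \<partial>M) \<le> ennreal C' * riesz_kernel \<beta>' (y - z)"
    using drift_kernel_composition[OF \<kappa> e] by blast
  have "drift_pot r y \<le> ennreal (C * C') * pot \<beta>' y" if y: "y \<in> \<Omega>" for y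
  proof -
    let ?h = "\<lambda>x. drift_weight x * riesz_kernel ?\<gamma> (x - y)"
    have "drift_pot r y \<le> (\<integral>\<^sup>+x. ennreal C * (?h x * pot \<beta> x) \<partial>M)"
      unfolding drift_pot_def
    proof (rule nn_integral_mono_AE)
      from C(2) show "AE x in M. (indicator (ball a r) x * ennreal \<bar>u x\<bar> * (1 + ennreal (norm (U x)))) * riesz_kernel ?\<gamma> (x - y)
        \<le> ennreal C * (?h x * pot \<beta> x)"
      proof eventually_elim
        case (elim x)
        have "indicator (ball a r) x * ennreal \<bar>u x\<bar> \<le> ennreal C * pot \<beta> x"
          using elim by (auto simp: indicator_def)
        then have "(indicator (ball a r) x * ennreal \<bar>u x\<bar>) * ?h x \<le> (ennreal C * pot \<beta> x) * ?h x"
          by (intro mult_right_mono) auto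
        then show ?case by (simp only: drift_weight_def mult_ac)
      qed
    qed
    also have "\<dots> = ennreal C * (\<integral>\<^sup>+x. ?h x * pot \<beta> x \<partial>M)"
      by (rule nn_integral_cmult) measurable
    also have "(\<integral>\<^sup>+x. ?h x * pot \<beta> x \<partial>M) = (\<integral>\<^sup>+x. ?h x * riesz_kernel \<beta> (x - a) \<partial>M)
       + (\<integral>\<^sup>+z. \<rho> z * (\<integral>\<^sup>+x. ?h x * riesz_kernel \<beta> (x - z) \<partial>M) \<partial>M)"
      by (rule nn_integral_mult_pot) measurable
    also have "\<dots> \<le> ennreal C' * riesz_kernel \<beta>' (y - a) + (\<integral>\<^sup>+z. \<rho> z * (ennreal C' * riesz_kernel \<beta>' (y - z)) \<partial>M)"
      using y a by (intro add_mono nn_integral_mono mult_left_mono C'(2)) auto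
    also have "\<dots> = ennreal C' * pot \<beta>' y"
    proof -
      have "(\<integral>\<^sup>+z. \<rho> z * (ennreal C' * riesz_kernel \<beta>' (y - z)) \<partial>M) = (\<integral>\<^sup>+z. ennreal C' * (\<rho> z * riesz_kernel \<beta>' (z - y)) \<partial>M)"
        by (simp only: riesz_kernel_commute[of \<beta>' y] mult_ac)
      also have "\<dots> = ennreal C' * (\<integral>\<^sup>+z. \<rho> z * riesz_kernel \<beta>' (z - y) \<partial>M)"
        by (rule nn_integral_cmult) measurable
      finally show ?thesis by (simp add: pot_def distrib_left riesz_kernel_commute[of \<beta>' y a])
    qed
    finally have "drift_pot r y \<le> ennreal C * (ennreal C' * pot \<beta>' y)"
      by (simp add: mult_left_mono)
    then show ?thesis using C(1) C'(1) by (simp add: ennreal_mult mult.assoc)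
  qed
  then show ?thesis using C(1) C'(1) by (intro exI[of _ "C * C'"]) auto
qed

text \<open>Starting from the exponent \<open>n - 1\<close>, each step lowers the exponent by \<open>\<tau> - (n - 1)\<close> until \<open>b\<close> is reached.
  Every step shrinks the ball, because the estimate holds only where the cutoff is bounded below; hence
  the induction over all radii below \<open>r\<close>.\<close>

lemma AE_solution_le_pot:
  assumes r: "cball a r \<subseteq> \<Omega>" and \<kappa>: "\<kappa> \<ge> 0" "\<And>z. (\<integral>\<^sup>+x. drift_weight x * riesz_kernel \<tau> (x - z) \<partial>M) \<le> ennreal \<kappa>"
    and \<tau>: "\<tau> > real CARD('n) - 1" and b: "real CARD('n) - 2 < b" "b \<le> real CARD('n) - 1"
    and r': "0 < r'" "r' < r"
  shows "\<exists>C\<ge>0. AE y in M. y \<in> ball a r' \<longrightarrow> ennreal \<bar>u y\<bar> \<le> ennreal C * pot b y"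
proof -
  let ?\<gamma> = "real CARD('n) - 1"
  define \<theta> where "\<theta> = \<tau> - ?\<gamma>"
  have \<theta>: "\<theta> > 0" using \<tau> by (simp add: \<theta>_def)
  \<comment> \<open>The maximum makes the sequence stop exactly at \<open>b\<close> and keeps all exponents above \<open>n - 2\<close>.\<close>
  define \<beta> where "\<beta> k = max b (?\<gamma> - real k * \<theta>)" for k :: nat
  have \<beta>: "b \<le> \<beta> k" "\<beta> k \<le> ?\<gamma>" "\<beta> (Suc k) \<le> \<beta> k" "\<beta> k - \<beta> (Suc k) \<le> \<theta>" for k
    using \<theta> b by (auto simp: \<beta>_def max_def algebra_simps)
  have b0: "b \<ge> 0" using b dim by linarith
  have main: "\<exists>C\<ge>0. AE y in M. y \<in> ball a s \<longrightarrow> ennreal \<bar>u y\<bar> \<le> ennreal C * pot (\<beta> k) y"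
    if "0 < s" "s < r" for k s
    using that
  proof (induction k arbitrary: s)
    case 0
    have \<beta>0: "\<beta> 0 = ?\<gamma>" using b by (simp add: \<beta>_def)
    obtain C where C: "C \<ge> 0" "AE y in M. y \<in> ball a s \<longrightarrow> ennreal \<bar>u y\<bar> \<le> ennreal C * (pot ?\<gamma> y + drift_pot r y)"
      using solution_bound_on_smaller_ball[of s r ?\<gamma>] 0 r by auto
    have dp: "drift_pot r y \<le> pot ?\<gamma> y" for y
    proof -
      have "drift_pot r y \<le> (\<integral>\<^sup>+x. \<rho> x * riesz_kernel ?\<gamma> (x - y) \<partial>M)"
        unfolding drift_pot_def
        by (intro nn_integral_mono mult_right_mono) (auto simp: \<rho>_def indicator_def intro!: mult_left_mono)
      then show ?thesis by (simp add: pot_def add_increasing)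
    qed
    from C(2) have "AE y in M. y \<in> ball a s \<longrightarrow> ennreal \<bar>u y\<bar> \<le> ennreal (C * 2) * pot (\<beta> 0) y"
    proof eventually_elim
      case (elim y)
      have "ennreal C * (pot ?\<gamma> y + drift_pot r y) \<le> ennreal C * (pot ?\<gamma> y + pot ?\<gamma> y)"
        by (intro mult_left_mono add_left_mono dp) auto
      also have "\<dots> = ennreal (C * 2) * pot (\<beta> 0) y"
        using C(1) by (simp add: \<beta>0 ennreal_mult mult.assoc mult_2)
      finally show ?case using elim by auto
    qed
    then show ?case using C(1) by (intro exI[of _ "C * 2"]) auto
  next
    case (Suc k)
    define t where "t = (s + r) / 2"
    have t: "0 < t" "t < r" "s < t" using Suc.prems by (auto simp: t_def)
    obtain C where C: "C \<ge> 0" "AE y in M. y \<in> ball a t \<longrightarrow> ennreal \<bar>u y\<bar> \<le> ennreal C * pot (\<beta> k) y"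
      using Suc.IH[OF t(1,2)] by blast
    obtain C1 where C1: "C1 \<ge> 0" "\<And>y. y \<in> \<Omega> \<Longrightarrow> drift_pot t y \<le> ennreal C1 * pot (\<beta> (Suc k)) y"
    proof -
      have "\<exists>C\<ge>0. \<forall>y\<in>\<Omega>. drift_pot t y \<le> ennreal C * pot (\<beta> (Suc k)) y"
      proof (rule drift_pot_le_pot[OF \<kappa> _ _ _ _ C])
        show "0 \<le> \<beta> (Suc k)" using b0 \<beta>(1)[of "Suc k"] by linarith
        show "?\<gamma> + \<beta> k - \<beta> (Suc k) \<le> \<tau>" using \<beta>(4)[of k] by (simp add: \<theta>_def)
      qed (use \<beta> in auto)
      then show ?thesis using that by blast
    qed
    have "cball a t \<subseteq> \<Omega>" using r t subset_cball[of t r a] by auto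
    then obtain C2 where C2: "C2 \<ge> 0"
      "AE y in M. y \<in> ball a s \<longrightarrow> ennreal \<bar>u y\<bar> \<le> ennreal C2 * (pot (\<beta> (Suc k)) y + drift_pot t y)"
      using solution_bound_on_smaller_ball[of s t "\<beta> (Suc k)"] Suc.prems t b(1) \<beta>(1)[of "Suc k"] by auto
    from C2(2) AE_space have "AE y in M. y \<in> ball a s \<longrightarrow> ennreal \<bar>u y\<bar> \<le> ennreal (C2 * (1 + C1)) * pot (\<beta> (Suc k)) y"
    proof eventually_elim
      case (elim y)
      have "ennreal C2 * (pot (\<beta> (Suc k)) y + drift_pot t y) \<le> ennreal C2 * (pot (\<beta> (Suc k)) y + ennreal C1 * pot (\<beta> (Suc k)) y)"
        using elim by (intro mult_left_mono add_left_mono C1(2)) auto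
      also have "\<dots> = ennreal (C2 * (1 + C1)) * pot (\<beta> (Suc k)) y"
        using C1(1) C2(1) by (simp add: ennreal_mult distrib_right mult.assoc)
      finally show ?case using elim by auto
    qed
    then show ?case using C1(1) C2(1) by (intro exI[of _ "C2 * (1 + C1)"]) auto
  qed
  obtain k :: nat where k: "\<beta> k = b"
  proof -
    obtain k :: nat where "(?\<gamma> - b) / \<theta> \<le> real k" using real_arch_simple by blast
    then have "?\<gamma> - real k * \<theta> \<le> b" using \<theta> by (simp add: field_simps)
    then show ?thesis by (intro that[of k]) (simp add: \<beta>_def)
  qed
  show ?thesis using main[OF r', of k] unfolding k .
qed

text \<open>Tonelli's theorem moves the weight \<open>\<bar>U\<bar>\<^sup>2\<close> onto the kernel, whose integrals against it are uniformly bounded.\<close>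

lemma solution_drift_square_integrable:
  assumes \<kappa>: "\<kappa> \<ge> 0" "\<And>z. (\<integral>\<^sup>+x. drift_weight x * riesz_kernel \<tau> (x - z) \<partial>M) \<le> ennreal \<kappa>"
    and \<kappa>': "\<And>z. (\<integral>\<^sup>+x. ennreal ((norm (U x))\<^sup>2) * riesz_kernel b (x - z) \<partial>M) \<le> ennreal \<kappa>'"
    and \<tau>: "\<tau> > real CARD('n) - 1" and b: "real CARD('n) - 2 < b" "b \<le> real CARD('n) - 1"
  shows "\<exists>r>0. cball a r \<subseteq> \<Omega> \<and>
    (\<integral>\<^sup>+x. indicator (ball a r) x * ennreal \<bar>u x\<bar> * ennreal ((norm (U x))\<^sup>2) \<partial>M) < \<infinity>"
proof -
  obtain R where R: "R > 0" "cball a R \<subseteq> \<Omega>" using open_domain a open_contains_cball by blast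
  define r where "r = R / 2"
  have r: "0 < r" "r < R" "cball a r \<subseteq> \<Omega>" using R subset_cball[of r R a] by (auto simp: r_def)
  obtain C where C: "C \<ge> 0" "AE y in M. y \<in> ball a r \<longrightarrow> ennreal \<bar>u y\<bar> \<le> ennreal C * pot b y"
    using AE_solution_le_pot[OF R(2) \<kappa> \<tau> b r(1,2)] by blast
  let ?h = "\<lambda>x. ennreal ((norm (U x))\<^sup>2)"
  have "(\<integral>\<^sup>+x. indicator (ball a r) x * ennreal \<bar>u x\<bar> * ?h x \<partial>M) \<le> (\<integral>\<^sup>+x. ennreal C * (?h x * pot b x) \<partial>M)"
  proof (rule nn_integral_mono_AE)
    from C(2) show "AE x in M. indicator (ball a r) x * ennreal \<bar>u x\<bar> * ?h x \<le> ennreal C * (?h x * pot b x)"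
    proof eventually_elim
      case (elim x)
      have "indicator (ball a r) x * ennreal \<bar>u x\<bar> \<le> ennreal C * pot b x"
        using elim by (auto simp: indicator_def)
      then have "(indicator (ball a r) x * ennreal \<bar>u x\<bar>) * ?h x \<le> (ennreal C * pot b x) * ?h x"
        by (intro mult_right_mono) auto
      then show ?case by (simp only: mult_ac)
    qed
  qed
  also have "\<dots> = ennreal C * (\<integral>\<^sup>+x. ?h x * pot b x \<partial>M)"
    by (rule nn_integral_cmult) measurable
  also have "(\<integral>\<^sup>+x. ?h x * pot b x \<partial>M) = (\<integral>\<^sup>+x. ?h x * riesz_kernel b (x - a) \<partial>M)
       + (\<integral>\<^sup>+z. \<rho> z * (\<integral>\<^sup>+x. ?h x * riesz_kernel b (x - z) \<partial>M) \<partial>M)"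
    by (rule nn_integral_mult_pot) measurable
  also have "\<dots> \<le> ennreal \<kappa>' + (\<integral>\<^sup>+z. \<rho> z * ennreal \<kappa>' \<partial>M)"
    by (intro add_mono nn_integral_mono mult_left_mono \<kappa>') auto
  also have "\<dots> = ennreal \<kappa>' + (\<integral>\<^sup>+z. \<rho> z \<partial>M) * ennreal \<kappa>'"
    by (simp add: nn_integral_multc)
  finally have "(\<integral>\<^sup>+x. indicator (ball a r) x * ennreal \<bar>u x\<bar> * ?h x \<partial>M)
    \<le> ennreal C * (ennreal \<kappa>' + (\<integral>\<^sup>+z. \<rho> z \<partial>M) * ennreal \<kappa>')"
    by (simp add: mult_left_mono)
  also have "\<dots> < \<infinity>" using \<rho>_finite by (simp add: ennreal_mult_less_top)
  finally show ?thesis using r by blast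
qed

end

section \<open>Cutoffs of small norm\<close>

text \<open>Both exponents come from Young's inequality with \<open>U\<close> in \<open>L\<^sup>q\<close>: the first condition is
  \<open>\<tau> < n - n / q\<close>, the second \<open>b < n - 2 n / q\<close>, and both leave room precisely because \<open>q > n\<close>.\<close>

lemma kato_bounds:
  fixes S :: "(real ^ 'n::finite) set" and U :: "real ^ 'n \<Rightarrow> real ^ 'n"
  assumes S: "S \<in> lmeasurable" and [measurable]: "U \<in> borel_measurable (lebesgue_on S)"
    and n: "CARD('n) \<ge> 2" and q: "q > real CARD('n)"
    and fin: "(\<integral>\<^sup>+x. ennreal (norm (U x) powr q) \<partial>lebesgue_on S) < \<infinity>"
  shows "\<exists>\<tau> > real CARD('n) - 1. \<exists>\<kappa>\<ge>0. \<forall>z.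
      (\<integral>\<^sup>+x. (1 + ennreal (norm (U x))) * riesz_kernel \<tau> (x - z) \<partial>lebesgue_on S) \<le> ennreal \<kappa>"
    and "\<exists>b > real CARD('n) - 2. b \<le> real CARD('n) - 1 \<and> (\<exists>\<kappa>\<ge>0. \<forall>z.
      (\<integral>\<^sup>+x. ennreal ((norm (U x))\<^sup>2) * riesz_kernel b (x - z) \<partial>lebesgue_on S) \<le> ennreal \<kappa>)"
proof -
  let ?n = "real CARD('n)"
  have n2: "?n \<ge> 2" using n by simp
  have nq: "0 < ?n / q" "?n / q < 1" using q n2 by auto
  show "\<exists>\<tau> > ?n - 1. \<exists>\<kappa>\<ge>0. \<forall>z.
      (\<integral>\<^sup>+x. (1 + ennreal (norm (U x))) * riesz_kernel \<tau> (x - z) \<partial>lebesgue_on S) \<le> ennreal \<kappa>"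
  proof -
    \<comment> \<open>The midpoint of the admissible interval between \<open>n - 1\<close> and \<open>n - n / q\<close>.\<close>
    define \<tau> where "\<tau> = ?n - (1 + ?n / q) / 2"
    have \<tau>: "?n - 1 < \<tau>" "\<tau> < ?n - ?n / q" using nq by (auto simp: \<tau>_def field_simps)
    have "\<tau> * (q / (q - 1)) < ?n"
    proof -
      have "\<tau> * q < (?n - ?n / q) * q" using \<tau>(2) q n2 by (intro mult_strict_right_mono) auto
      also have "\<dots> = ?n * (q - 1)" using q n2 by (simp add: field_simps)
      finally show ?thesis using q n2 by (simp add: field_simps)
    qed
    then obtain C1 where C1: "C1 \<ge> 0" "\<And>z. (\<integral>\<^sup>+x. ennreal (norm (U x)) * riesz_kernel \<tau> (x - z) \<partial>lebesgue_on S) \<le> ennreal C1"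
      using nn_integral_mult_riesz_kernel_bounded[OF S _ _ _ fin, of \<tau>] q n2 \<tau> by auto
    obtain C2 where C2: "C2 \<ge> 0" "\<And>z. (\<integral>\<^sup>+x. riesz_kernel \<tau> (x - z) \<partial>lebesgue_on S) \<le> ennreal C2"
      using nn_integral_riesz_kernel_bounded[OF S, of \<tau>] n2 \<tau> nq by auto
    have "(\<integral>\<^sup>+x. (1 + ennreal (norm (U x))) * riesz_kernel \<tau> (x - z) \<partial>lebesgue_on S) \<le> ennreal (C2 + C1)" for z
    proof -
      have "(\<integral>\<^sup>+x. (1 + ennreal (norm (U x))) * riesz_kernel \<tau> (x - z) \<partial>lebesgue_on S) =
        (\<integral>\<^sup>+x. riesz_kernel \<tau> (x - z) \<partial>lebesgue_on S) + (\<integral>\<^sup>+x. ennreal (norm (U x)) * riesz_kernel \<tau> (x - z) \<partial>lebesgue_on S)"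
        by (simp add: distrib_right nn_integral_add)
      also have "\<dots> \<le> ennreal C2 + ennreal C1" by (intro add_mono C1 C2)
      finally show ?thesis using C1 C2 by simp
    qed
    then show ?thesis using \<tau> C1 C2 by (intro exI[of _ \<tau>] conjI exI[of _ "C2 + C1"]) auto
  qed
  show "\<exists>b > ?n - 2. b \<le> ?n - 1 \<and> (\<exists>\<kappa>\<ge>0. \<forall>z.
      (\<integral>\<^sup>+x. ennreal ((norm (U x))\<^sup>2) * riesz_kernel b (x - z) \<partial>lebesgue_on S) \<le> ennreal \<kappa>)"
  proof -
    define m where "m = min (?n - 1) (?n - 2 * (?n / q))"
    define b where "b = (?n - 2 + m) / 2"
    have m: "?n - 2 < m" "m \<le> ?n - 1" "m \<le> ?n - 2 * (?n / q)" using nq by (auto simp: m_def)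
    then have b: "?n - 2 < b" "b \<le> ?n - 1" "b < ?n - 2 * (?n / q)" "b > 0" using n2 by (auto simp: b_def)
    have "b * ((q / 2) / (q / 2 - 1)) < ?n"
    proof -
      have "b * q < (?n - 2 * (?n / q)) * q" using b(3) q n2 by (intro mult_strict_right_mono) auto
      also have "\<dots> = ?n * (q - 2)" using q n2 by (simp add: field_simps)
      finally show ?thesis using q n2 by (simp add: field_simps)
    qed
    moreover have "((norm (U x))\<^sup>2) powr (q / 2) = norm (U x) powr q" for x
      by (cases "U x = 0") (simp_all add: powr_powr flip: powr_numeral)
    ultimately obtain C where "C \<ge> 0" "\<And>z. (\<integral>\<^sup>+x. ennreal ((norm (U x))\<^sup>2) * riesz_kernel b (x - z) \<partial>lebesgue_on S) \<le> ennreal C"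
      using nn_integral_mult_riesz_kernel_bounded[OF S, of "\<lambda>x. (norm (U x))\<^sup>2" "q / 2" b] fin q n2 b(4) by auto
    then show ?thesis using b by blast
  qed
qed

lemma le_mult_if_ennreal_divide_le:
  assumes "ennreal c / ennreal v \<le> ennreal e" "c \<ge> 0" "v \<ge> 0" "e \<ge> 0"
  shows "c \<le> e * v"
proof (cases "v = 0")
  case True
  then have "c = 0" using assms by (cases "c = 0") (auto simp: ennreal_divide_eq_top_iff top_unique)
  then show ?thesis using True by simp
next
  case False
  then have "ennreal (c / v) \<le> ennreal e" using assms by (simp add: divide_ennreal)
  then show ?thesis using assms False by (simp add: ennreal_le_iff field_simps)
qed

text \<open>This replaces an almost everywhere convergent subsequence of cutoffs: splitting \<open>f\<close> at the level \<open>T\<close>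
  reduces the integral of \<open>f \<psi>\<close> to the integral of \<open>\<psi>\<close>.\<close>

lemma nn_integral_tail_small:
  assumes [measurable]: "f \<in> borel_measurable M" and fin: "(\<integral>\<^sup>+x. f x \<partial>M) < \<infinity>" and e: "e > 0"
  shows "\<exists>T::nat. (\<integral>\<^sup>+x. f x * indicator {x. ennreal (real T) < f x} x \<partial>M) < ennreal e"
proof -
  have "(\<lambda>k. \<integral>\<^sup>+x. f x * indicator {x. ennreal (real k) < f x} x \<partial>M) \<longlonglongrightarrow> (\<integral>\<^sup>+x. 0 \<partial>M)"
  proof (rule nn_integral_dominated_convergence[where w = f])
    show "AE x in M. f x * indicator {x. ennreal (real k) < f x} x \<le> f x" for k
      by (auto simp: indicator_def)
    have "AE x in M. f x \<noteq> \<infinity>" using fin by (intro nn_integral_PInf_AE) auto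
    then show "AE x in M. (\<lambda>k. f x * indicator {x. ennreal (real k) < f x} x) \<longlonglongrightarrow> 0"
    proof eventually_elim
      case (elim x)
      then obtain c where c: "f x = ennreal c" "c \<ge> 0" by (cases "f x") auto
      obtain K :: nat where K: "c \<le> real K" using real_arch_simple by blast
      have "f x * indicator {x. ennreal (real k) < f x} x = 0" if "k \<ge> K" for k
        using that K c by (auto simp: indicator_def ennreal_less_iff)
      then show ?case by (intro tendsto_eventually) (auto simp: eventually_sequentially)
    qed
  qed (use fin in auto)
  then have "\<forall>\<^sub>F k in sequentially. (\<integral>\<^sup>+x. f x * indicator {x. ennreal (real k) < f x} x \<partial>M) < ennreal e"
    using e by (intro order_tendstoD(2)) auto
  then show ?thesis by (auto simp: eventually_sequentially)
qed

context dirac_solution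
begin

text \<open>All terms with derivatives of \<open>\<psi>\<close> carry the factor \<open>\<epsilon>\<close>.  The drift term is estimated by
  \<open>\<bar>U\<bar> sqrt V \<le> \<bar>U\<bar>\<^sup>2 + V\<close>, which is where the square of the drift appears.  On the set where \<open>V\<close> is infinite the
  norm gives no bound on the derivatives of \<open>\<psi>\<close>, but there \<open>u\<close> vanishes almost everywhere.\<close>

lemma cutoff_test_estimate:
  assumes r: "r > 0" "cball a r \<subseteq> \<Omega>"
  shows "\<exists>K\<ge>1. \<forall>\<psi>\<in>B2 \<Omega> S. \<forall>\<epsilon>>0. a \<in> S \<longrightarrow> V_inf_norm \<Omega> V \<psi> < ennreal \<epsilon> \<longrightarrow>
    1 \<le> ennreal \<epsilon> * (ennreal K * (\<integral>\<^sup>+x. \<rho> x \<partial>M)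
           + (\<integral>\<^sup>+x. indicator (ball a r) x * ennreal \<bar>u x\<bar> * ennreal ((norm (U x))\<^sup>2) \<partial>M))
       + ennreal K * (\<integral>\<^sup>+x. \<rho> x * ennreal (\<psi> x) \<partial>M)"
proof -
  let ?b = "bump r a"
  obtain K0 where K0: "K0 \<ge> 1" "\<And>x. norm (gradient ?b x) \<le> K0" "\<And>x. \<bar>laplacian ?b x\<bar> \<le> K0"
    using bump_derivatives_bounded[OF r(1)] by blast
  define K where "K = 2 * K0 + 2"
  have "1 \<le> ennreal \<epsilon> * (ennreal K * (\<integral>\<^sup>+x. \<rho> x \<partial>M)
           + (\<integral>\<^sup>+x. indicator (ball a r) x * ennreal \<bar>u x\<bar> * ennreal ((norm (U x))\<^sup>2) \<partial>M))
       + ennreal K * (\<integral>\<^sup>+x. \<rho> x * ennreal (\<psi> x) \<partial>M)"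
    if \<psi>: "\<psi> \<in> B2 \<Omega> S" and \<epsilon>: "\<epsilon> > 0" and aS: "a \<in> S" and small: "V_inf_norm \<Omega> V \<psi> < ennreal \<epsilon>" for \<psi> \<epsilon>
  proof -
    have \<psi>C: "\<psi> \<in> C2 \<Omega>" and \<psi>01: "\<And>x. 0 \<le> \<psi> x" "\<And>x. \<psi> x \<le> 1" and \<psi>a: "\<psi> a = 1"
      using \<psi> aS by (auto simp: B2_def C2_c_def)
    have bC: "?b \<in> C2 \<Omega>" using C2_subset[OF bump_C2(1)[OF r(1)]] by auto
    define \<phi> where "\<phi> x = ?b x * \<psi> x" for x
    have \<phi>C: "\<phi> \<in> C2 \<Omega>" unfolding \<phi>_def[abs_def] by (rule C2_mult[OF open_domain bC \<psi>C])
    have \<phi>0: "\<phi> \<in> C2_0 \<Omega>"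
    proof (rule C2_0_if_supported_in_cball[OF open_domain r(2) \<phi>C])
      fix x assume "x \<notin> cball a r"
      then have "?b x = 0" by (intro bump_outside(1)[OF r(1)]) auto
      then show "\<phi> x = 0" by (simp add: \<phi>_def)
    qed
    define T where "T x = u x * (- laplacian \<phi> x - U x \<bullet> gradient \<phi> x + enn2real (V x) * \<phi> x)" for x
    have T: "(LINT x|M. T x) = 1"
      unfolding T_def using weak_equation[OF \<phi>0] by (simp add: \<phi>_def bump_center \<psi>a)
    then have Ti: "integrable M T" using not_integrable_integral_eq by fastforce
    have \<psi>m[measurable]: "\<psi> \<in> borel_measurable M"
      using C1_measurable[OF open_domain] \<psi>C by (auto simp: C2_def)
    have AEu: "AE x in M. ennreal \<bar>u x\<bar> * V x \<noteq> \<infinity>"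
      using uV_finite by (intro nn_integral_PInf_AE) auto
    have es: "esssup M (\<lambda>x. ennreal (norm (gradient \<psi> x)) / ennreal_sqrt (V x)) \<le> ennreal \<epsilon>"
      "esssup M (\<lambda>x. ennreal \<bar>laplacian \<psi> x\<bar> / V x) \<le> ennreal \<epsilon>"
      using small unfolding V_inf_norm_def
      by (meson add_increasing add_increasing2 less_imp_le order_trans zero_le order_refl)+
    have AE1: "AE x in M. ennreal (norm (gradient \<psi> x)) / ennreal_sqrt (V x) \<le> ennreal \<epsilon>"
      using esssup_AE[of "\<lambda>x. ennreal (norm (gradient \<psi> x)) / ennreal_sqrt (V x)" M]
      by eventually_elim (use es(1) order_trans in blast)
    have AE2: "AE x in M. ennreal \<bar>laplacian \<psi> x\<bar> / V x \<le> ennreal \<epsilon>"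
      using esssup_AE[of "\<lambda>x. ennreal \<bar>laplacian \<psi> x\<bar> / V x" M]
      by eventually_elim (use es(2) order_trans in blast)
    have T_le: "AE x in M. ennreal \<bar>T x\<bar> \<le> ennreal \<epsilon> * (ennreal K * \<rho> x + indicator (ball a r) x * ennreal \<bar>u x\<bar> * ennreal ((norm (U x))\<^sup>2))
       + ennreal K * (\<rho> x * ennreal (\<psi> x))"
      using AEu AE1 AE2 AE_space
    proof eventually_elim
      case (elim x)
      then have x: "x \<in> \<Omega>" by simp
      show ?case
      proof (cases "u x = 0")
        case True
        then show ?thesis by (simp add: T_def)
      next
        case False
        then have "V x \<noteq> \<infinity>" using elim(1) by (auto simp: ennreal_mult_eq_top_iff)
        then obtain v where v: "V x = ennreal v" "v \<ge> 0" by (cases "V x") auto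
        let ?W = "norm (U x)" and ?i = "indicat_real (ball a r) x"
        have g: "norm (gradient \<psi> x) \<le> \<epsilon> * sqrt v"
          using elim(2) v \<epsilon> by (intro le_mult_if_ennreal_divide_le) (auto simp: ennreal_sqrt_def)
        have l: "\<bar>laplacian \<psi> x\<bar> \<le> \<epsilon> * v"
          using elim(3) v \<epsilon> by (intro le_mult_if_ennreal_divide_le) auto
        have sq: "sqrt v \<le> 1 + v" 
          using v(2) sum_squares_bound[of "sqrt v" 1] by simp
        have b: "0 \<le> ?b x" "?b x \<le> 1" "?b x \<le> ?i"
          using bump_bounds[of r a x] bump_outside(1)[OF r(1), of x a] by (auto simp: indicator_def)
        have d: "?b differentiable (at x)" "\<psi> differentiable (at x)"
          using bC \<psi>C x by (auto simp: C2_def C1_def)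
        have L: "laplacian \<phi> x = ?b x * laplacian \<psi> x + 2 * (gradient ?b x \<bullet> gradient \<psi> x) + \<psi> x * laplacian ?b x"
          unfolding \<phi>_def[abs_def] by (rule laplacian_mult[OF open_domain x bC \<psi>C])
        have G: "gradient \<phi> x = ?b x *\<^sub>R gradient \<psi> x + \<psi> x *\<^sub>R gradient ?b x"
          unfolding \<phi>_def[abs_def] by (rule gradient_mult[OF d])
        have 1: "\<bar>?b x * laplacian \<psi> x\<bar> \<le> \<epsilon> * v"
        proof -
          have "\<bar>?b x * laplacian \<psi> x\<bar> \<le> 1 * (\<epsilon> * v)"
            unfolding abs_mult using b l by (intro mult_mono) auto
          then show ?thesis by simp
        qed
        have 2: "\<bar>gradient ?b x \<bullet> gradient \<psi> x\<bar> \<le> K0 * (\<epsilon> * (1 + v))"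
        proof -
          have "\<bar>gradient ?b x \<bullet> gradient \<psi> x\<bar> \<le> norm (gradient ?b x) * norm (gradient \<psi> x)"
            by (rule Cauchy_Schwarz_ineq2)
          also have "\<dots> \<le> K0 * (\<epsilon> * sqrt v)" using K0(1) K0(2)[of x] g by (intro mult_mono) auto
          also have "\<dots> \<le> K0 * (\<epsilon> * (1 + v))" using K0(1) \<epsilon> sq by (intro mult_left_mono) auto
          finally show ?thesis .
        qed
        have 3: "\<bar>\<psi> x * laplacian ?b x\<bar> \<le> \<psi> x * K0"
          unfolding abs_mult using \<psi>01[of x] K0(3)[of x] by (intro mult_mono) auto
        have 4: "\<bar>U x \<bullet> gradient \<phi> x\<bar> \<le> \<epsilon> * (?i * ?W\<^sup>2 + v) + \<psi> x * (K0 * ?W)"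
        proof -
          have "\<bar>U x \<bullet> gradient \<phi> x\<bar> \<le> ?W * norm (gradient \<phi> x)" by (rule Cauchy_Schwarz_ineq2)
          also have "\<dots> \<le> ?W * (?b x * norm (gradient \<psi> x) + \<psi> x * norm (gradient ?b x))"
            unfolding G using b \<psi>01[of x] norm_triangle_ineq[of "?b x *\<^sub>R gradient \<psi> x" "\<psi> x *\<^sub>R gradient ?b x"]
            by (intro mult_left_mono) auto
          also have "\<dots> \<le> ?W * (?i * (\<epsilon> * sqrt v) + \<psi> x * K0)"
            using b g \<psi>01[of x] K0(2)[of x] by (intro mult_left_mono add_mono mult_mono) auto
          also have "\<dots> = \<epsilon> * (?i * (?W * sqrt v)) + \<psi> x * (K0 * ?W)" by (simp add: algebra_simps)
          also have "\<dots> \<le> \<epsilon> * (?i * ?W\<^sup>2 + v) + \<psi> x * (K0 * ?W)"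
          proof -
            have "2 * (?W * sqrt v) \<le> ?W\<^sup>2 + v"
              using sum_squares_bound[of ?W "sqrt v"] v(2) by (simp add: mult.assoc)
            moreover have "0 \<le> ?W * sqrt v" using v by simp
            ultimately have "?W * sqrt v \<le> ?W\<^sup>2 + v" by linarith
            then have "?i * (?W * sqrt v) \<le> ?i * ?W\<^sup>2 + v" using v by (simp add: indicator_def)
            then show ?thesis using \<epsilon> by (simp add: mult_left_mono)
          qed
          finally show ?thesis .
        qed
        have 5: "\<bar>v * \<phi> x\<bar> \<le> \<psi> x * v"
        proof -
          have "?b x * \<psi> x \<le> 1 * \<psi> x" using b \<psi>01 by (intro mult_right_mono) auto
          then have "v * (?b x * \<psi> x) \<le> v * \<psi> x" using v by (intro mult_left_mono) auto
          then show ?thesis using v b \<psi>01[of x] by (simp add: \<phi>_def abs_mult mult.commute)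
        qed
        have "\<bar>- laplacian \<phi> x - U x \<bullet> gradient \<phi> x + v * \<phi> x\<bar> \<le>
          \<epsilon> * v + 2 * (K0 * (\<epsilon> * (1 + v))) + \<psi> x * K0 + (\<epsilon> * (?i * ?W\<^sup>2 + v) + \<psi> x * (K0 * ?W)) + \<psi> x * v"
          unfolding L using 1 2 3 4 5 by linarith
        also have "\<dots> \<le> \<epsilon> * (K * (1 + ?W + v) + ?i * ?W\<^sup>2) + K * ((1 + ?W + v) * \<psi> x)"
        proof -
          have "\<epsilon> * (K * (1 + ?W + v) + ?i * ?W\<^sup>2) + K * ((1 + ?W + v) * \<psi> x)
            - (\<epsilon> * v + 2 * (K0 * (\<epsilon> * (1 + v))) + \<psi> x * K0 + (\<epsilon> * (?i * ?W\<^sup>2 + v) + \<psi> x * (K0 * ?W)) + \<psi> x * v)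
            = \<epsilon> * (2 + K * ?W) + \<psi> x * ((K0 + 2) * (1 + ?W) + (K - 1) * v)"
            unfolding K_def by (simp add: algebra_simps)
          also have "\<dots> \<ge> 0" using \<epsilon> K0(1) \<psi>01[of x] v unfolding K_def by (intro add_nonneg_nonneg mult_nonneg_nonneg) auto
          finally show ?thesis by linarith
        qed
        finally have "\<bar>T x\<bar> \<le> \<bar>u x\<bar> * (\<epsilon> * (K * (1 + ?W + v) + ?i * ?W\<^sup>2) + K * ((1 + ?W + v) * \<psi> x))"
          unfolding T_def v(1) abs_mult using v(2) by (intro mult_left_mono) auto
        then have "ennreal \<bar>T x\<bar> \<le> ennreal (\<bar>u x\<bar> * (\<epsilon> * (K * (1 + ?W + v) + ?i * ?W\<^sup>2) + K * ((1 + ?W + v) * \<psi> x)))"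
          by (rule ennreal_leI)
        also have "\<dots> = ennreal (\<epsilon> * (K * (\<bar>u x\<bar> * (1 + ?W + v)) + ?i * \<bar>u x\<bar> * ?W\<^sup>2) + K * ((\<bar>u x\<bar> * (1 + ?W + v)) * \<psi> x))"
          by (rule arg_cong[where f = ennreal]) (simp add: algebra_simps)
        also have "\<dots> = ennreal \<epsilon> * (ennreal K * ennreal (\<bar>u x\<bar> * (1 + ?W + v)) + ennreal (?i * \<bar>u x\<bar> * ?W\<^sup>2))
          + ennreal K * (ennreal (\<bar>u x\<bar> * (1 + ?W + v)) * ennreal (\<psi> x))"
          using \<epsilon> K0(1) v(2) \<psi>01[of x]
          by (simp only: ennreal_mult ennreal_plus K_def add_nonneg_nonneg mult_nonneg_nonneg abs_ge_zero norm_ge_zero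
              indicator_pos_le zero_le_power less_imp_le zero_le_one zero_le_numeral order_trans[OF zero_le_one])
        also have "ennreal (\<bar>u x\<bar> * (1 + ?W + v)) = \<rho> x"
          unfolding \<rho>_def v(1) using v(2) by (simp add: ennreal_mult)
        also have "ennreal (?i * \<bar>u x\<bar> * ?W\<^sup>2) = indicator (ball a r) x * ennreal \<bar>u x\<bar> * ennreal (?W\<^sup>2)"
          by (simp add: indicator_def ennreal_mult)
        finally show ?thesis .
      qed
    qed
    have "1 = ennreal \<bar>LINT x|M. T x\<bar>" using T by simp
    also have "\<dots> \<le> (\<integral>\<^sup>+x. ennreal \<bar>T x\<bar> \<partial>M)" using integral_norm_bound_ennreal[OF Ti] by simp
    also have "\<dots> \<le> (\<integral>\<^sup>+x. ennreal \<epsilon> * (ennreal K * \<rho> x + indicator (ball a r) x * ennreal \<bar>u x\<bar> * ennreal ((norm (U x))\<^sup>2))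
       + ennreal K * (\<rho> x * ennreal (\<psi> x)) \<partial>M)"
      by (rule nn_integral_mono_AE[OF T_le])
    also have "\<dots> = ennreal \<epsilon> * (ennreal K * (\<integral>\<^sup>+x. \<rho> x \<partial>M)
           + (\<integral>\<^sup>+x. indicator (ball a r) x * ennreal \<bar>u x\<bar> * ennreal ((norm (U x))\<^sup>2) \<partial>M))
       + ennreal K * (\<integral>\<^sup>+x. \<rho> x * ennreal (\<psi> x) \<partial>M)"
      by (simp add: nn_integral_add nn_integral_cmult)
    finally show ?thesis .
  qed
  then show ?thesis using K0(1) by (intro exI[of _ K]) (auto simp: K_def)
qed

text \<open>The order of the choices matters: the level \<open>L\<close> at which \<open>\<rho>\<close> is split depends on \<open>u\<close> alone, and the bound
  \<open>\<epsilon>\<close> on the norm of the cutoff is chosen after it.\<close>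

lemma no_solution:
  assumes r: "r > 0" "cball a r \<subseteq> \<Omega>"
    and fin: "(\<integral>\<^sup>+x. indicator (ball a r) x * ennreal \<bar>u x\<bar> * ennreal ((norm (U x))\<^sup>2) \<partial>M) < \<infinity>"
    and cap: "Cap \<Omega> V S = 0" and aS: "a \<in> S"
  shows False
proof -
  obtain K where K: "K \<ge> 1" "\<And>\<psi> \<epsilon>. \<psi> \<in> B2 \<Omega> S \<Longrightarrow> \<epsilon> > 0 \<Longrightarrow> V_inf_norm \<Omega> V \<psi> < ennreal \<epsilon> \<Longrightarrow>
    1 \<le> ennreal \<epsilon> * (ennreal K * (\<integral>\<^sup>+x. \<rho> x \<partial>M)
           + (\<integral>\<^sup>+x. indicator (ball a r) x * ennreal \<bar>u x\<bar> * ennreal ((norm (U x))\<^sup>2) \<partial>M))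
       + ennreal K * (\<integral>\<^sup>+x. \<rho> x * ennreal (\<psi> x) \<partial>M)"
    using cutoff_test_estimate[OF r, of S] aS by blast
  have "ennreal K * (\<integral>\<^sup>+x. \<rho> x \<partial>M)
      + (\<integral>\<^sup>+x. indicator (ball a r) x * ennreal \<bar>u x\<bar> * ennreal ((norm (U x))\<^sup>2) \<partial>M) < \<infinity>" (is "?Q < \<infinity>")
    using \<rho>_finite fin by (simp add: ennreal_mult_less_top)
  then obtain Q where Q: "?Q = ennreal Q" "Q \<ge> 0" by (cases ?Q) auto
  have "1 / (4 * K) > 0" using K(1) by simp
  from nn_integral_tail_small[OF \<rho>_measurable \<rho>_finite this]
  obtain L :: nat where L: "(\<integral>\<^sup>+x. \<rho> x * indicator {x. ennreal (real L) < \<rho> x} x \<partial>M) < ennreal (1 / (4 * K))"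
    by blast
  \<comment> \<open>The three contributions to the right-hand side are then at most a quarter each.\<close>
  define \<epsilon> where "\<epsilon> = 1 / (4 * (Q + K * real L + 1))"
  have P: "Q + K * real L + 1 > 0" using Q K by (simp add: add_nonneg_pos)
  have \<epsilon>: "\<epsilon> > 0" using P by (simp add: \<epsilon>_def)
  have "Cap \<Omega> V S < ennreal \<epsilon>" using cap \<epsilon> by simp
  then obtain \<psi> where \<psi>: "\<psi> \<in> B2 \<Omega> S" "V_inf_norm \<Omega> V \<psi> < ennreal \<epsilon>"
    unfolding Cap_def by (auto simp: INF_less_iff)
  have \<psi>01: "\<And>x. 0 \<le> \<psi> x" "\<And>x. \<psi> x \<le> 1" and \<psi>C: "\<psi> \<in> C2 \<Omega>"
    using \<psi> by (auto simp: B2_def C2_c_def)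
  have [measurable]: "\<psi> \<in> borel_measurable M"
    using C1_measurable[OF open_domain] \<psi>C by (auto simp: C2_def)
  have int\<psi>: "(\<integral>\<^sup>+x. ennreal (\<psi> x) \<partial>M) \<le> ennreal \<epsilon>"
  proof -
    have "(\<integral>\<^sup>+x. ennreal (\<psi> x) \<partial>M) = (\<integral>\<^sup>+x. ennreal \<bar>\<psi> x\<bar> \<partial>M)" using \<psi>01(1) by simp
    also have "\<dots> \<le> V_inf_norm \<Omega> V \<psi>" unfolding V_inf_norm_def by (simp add: add.assoc)
    finally show ?thesis using \<psi>(2) by simp
  qed
  have "(\<integral>\<^sup>+x. \<rho> x * ennreal (\<psi> x) \<partial>M) \<le>
    (\<integral>\<^sup>+x. ennreal (real L) * ennreal (\<psi> x) + \<rho> x * indicator {x. ennreal (real L) < \<rho> x} x \<partial>M)"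
  proof (rule nn_integral_mono)
    fix x
    have "\<rho> x * ennreal (\<psi> x) \<le> \<rho> x * 1" using \<psi>01[of x] by (intro mult_left_mono) auto
    moreover have "\<rho> x * ennreal (\<psi> x) \<le> ennreal (real L) * ennreal (\<psi> x)" if "\<not> ennreal (real L) < \<rho> x"
      using that by (intro mult_right_mono) auto
    ultimately show "\<rho> x * ennreal (\<psi> x) \<le> ennreal (real L) * ennreal (\<psi> x) + \<rho> x * indicator {x. ennreal (real L) < \<rho> x} x"
      by (cases "ennreal (real L) < \<rho> x") (auto simp: add_increasing)
  qed
  also have "\<dots> = ennreal (real L) * (\<integral>\<^sup>+x. ennreal (\<psi> x) \<partial>M) + (\<integral>\<^sup>+x. \<rho> x * indicator {x. ennreal (real L) < \<rho> x} x \<partial>M)"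
    by (simp add: nn_integral_add nn_integral_cmult)
  also have "\<dots> \<le> ennreal (real L) * ennreal \<epsilon> + ennreal (1 / (4 * K))"
    using L by (intro add_mono mult_left_mono int\<psi>) auto
  finally have int\<rho>\<psi>: "(\<integral>\<^sup>+x. \<rho> x * ennreal (\<psi> x) \<partial>M) \<le> ennreal (real L) * ennreal \<epsilon> + ennreal (1 / (4 * K))" .
  have "1 \<le> ennreal \<epsilon> * ennreal Q + ennreal K * (\<integral>\<^sup>+x. \<rho> x * ennreal (\<psi> x) \<partial>M)"
    using K(2)[OF \<psi>(1) \<epsilon> \<psi>(2)] unfolding Q .
  also have "\<dots> \<le> ennreal \<epsilon> * ennreal Q + ennreal K * (ennreal (real L) * ennreal \<epsilon> + ennreal (1 / (4 * K)))"
    by (intro add_left_mono mult_left_mono int\<rho>\<psi>) auto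
  also have "\<dots> = ennreal (\<epsilon> * Q + K * (real L * \<epsilon> + 1 / (4 * K)))"
    using \<epsilon> Q(2) K(1) by (simp add: ennreal_mult ennreal_plus)
  also have "\<dots> < 1"
  proof -
    have "\<epsilon> * Q + K * (real L * \<epsilon> + 1 / (4 * K)) = \<epsilon> * (Q + K * real L) + 1 / 4"
      using K(1) by (simp add: field_simps)
    also have "\<epsilon> * (Q + K * real L) \<le> \<epsilon> * (Q + K * real L + 1)" using \<epsilon> by (intro mult_left_mono) auto
    also have "\<epsilon> * (Q + K * real L + 1) = 1 / 4" using P unfolding \<epsilon>_def by (simp add: field_simps)
    finally show ?thesis by (simp add: ennreal_less_one_iff)
  qed
  finally show False by simp
qed

end

theorem theorem11:
  fixes \<Omega> :: "(real ^ 'n::finite) set"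
    and U :: "real ^ 'n \<Rightarrow> real ^ 'n"
    and V :: "real ^ 'n \<Rightarrow> ennreal"
    and p :: real
    and a :: "real ^ 'n"
  assumes "CARD('n) \<ge> 2"
    and "open \<Omega>" and "connected \<Omega>" and "bounded \<Omega>" and "C11_boundary \<Omega>"
    and "p > real CARD('n)"
    and "\<forall>i. (\<lambda>x. U x $ i) \<in> lorentz_space p \<Omega>"
    and "div_free_tangential \<Omega> U"
    and "potential \<Omega> V"
    and "compact (irregular_points \<Omega> V)"
    and "Cap \<Omega> V (irregular_points \<Omega> V) = 0"
    and "a \<in> \<Omega>"
    and "a \<in> irregular_points \<Omega> V"
  shows "\<not> (\<exists>u. u \<in> L1_weighted \<Omega> V \<inter> L1_0 \<Omega> \<and> solves_dirac \<Omega> U V a u)"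
proof
  assume "\<exists>u. u \<in> L1_weighted \<Omega> V \<inter> L1_0 \<Omega> \<and> solves_dirac \<Omega> U V a u"
  then obtain u where u: "u \<in> L1_weighted \<Omega> V" "u \<in> L1_0 \<Omega>" "solves_dirac \<Omega> U V a u" by blast
  have Um: "U \<in> borel_measurable (lebesgue_on \<Omega>)"
    using assms(7) by (intro measurable_if_components_measurable) (auto simp: lorentz_space_def)
  interpret dirac_solution \<Omega> U V a u
    using assms(1,2,4,9,12) u Um by unfold_locales (auto simp: potential_def L1_weighted_def L1_0_def)
  have pos: "measure lebesgue \<Omega> > 0"
  proof -
    have "\<not> negligible \<Omega>" using assms(2,12) open_not_negligible by blast
    then show ?thesis using lmeasurable_domain
      by (metis negligible_iff_measure0 measure_nonneg order_le_less)
  qed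
  define q where "q = (real CARD('n) + p) / 2"
  have q: "real CARD('n) < q" "q < p" "0 < q" using assms(6) by (auto simp: q_def intro: add_nonneg_pos)
  have fin: "(\<integral>\<^sup>+x. ennreal (norm (U x) powr q) \<partial>M) < \<infinity>"
    using lorentz_vector_imp_powr_integrable[OF lmeasurable_domain pos q(3,2)] assms(7) by blast
  obtain \<tau> \<kappa> where \<tau>: "\<tau> > real CARD('n) - 1" "\<kappa> \<ge> 0"
    "\<And>z. (\<integral>\<^sup>+x. (1 + ennreal (norm (U x))) * riesz_kernel \<tau> (x - z) \<partial>M) \<le> ennreal \<kappa>"
    using kato_bounds(1)[OF lmeasurable_domain Um dim q(1) fin] by blast
  obtain b \<kappa>' where b: "b > real CARD('n) - 2" "b \<le> real CARD('n) - 1"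
    "\<And>z. (\<integral>\<^sup>+x. ennreal ((norm (U x))\<^sup>2) * riesz_kernel b (x - z) \<partial>M) \<le> ennreal \<kappa>'"
    using kato_bounds(2)[OF lmeasurable_domain Um dim q(1) fin] by blast
  obtain r where "r > 0" "cball a r \<subseteq> \<Omega>"
    "(\<integral>\<^sup>+x. indicator (ball a r) x * ennreal \<bar>u x\<bar> * ennreal ((norm (U x))\<^sup>2) \<partial>M) < \<infinity>"
    using solution_drift_square_integrable[OF \<tau>(2) _ b(3) \<tau>(1) b(1,2)] \<tau>(3) by (auto simp: drift_weight_def)
  then show False using assms(11,13) by (rule no_solution)
qed

end
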